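(* Let $r, m \ge 1$ be fixed integers and let $n$ be sufficiently large. If $G$ is a graph on $n$ vertices with at least $n^{2-\frac{1}{r}} (\log n)^{\frac{60}{r}}$ edges, then $G$ contains an $r$-blow-up of a subdivision of $K_m$, where each edge of $K_m$ is subdivided at most $(\log n)^{6}$ times.
   Context: Logarithms are in base 2. For an integer $r \ge 1$ and a graph $F$, the $r$-blow-up $F[r]$ is the graph obtained by replacing each vertex of $F$ by an independent set of size $r$ (these sets pairwise disjoint) and each edge of $F$ by a complete bipartite graph $K_{r,r}$ between the corresponding sets. A subdivision of $K_m$ is obtained from $K_m$ by replacing each edge by a path between its endpoints, these paths internally vertex-disjoint; an edge is subdivided at most $t$ times if its path has at most $t$ internal vertices. *)

theory Defs
  imports Complex_Main
begin

type_synonym 'a graph = "'a set \<times> 'a set set"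

abbreviation verts :: "'a graph \<Rightarrow> 'a set" where
  "verts G \<equiv> fst G"

abbreviation edges :: "'a graph \<Rightarrow> 'a set set" where
  "edges G \<equiv> snd G"

definition simple_graph :: "'a graph \<Rightarrow> bool" where
  "simple_graph G \<longleftrightarrow> finite (verts G) \<and> edges G \<subseteq> {e. e \<subseteq> verts G \<and> card e = 2}"

definition complete_graph :: "nat \<Rightarrow> nat graph" where
  "complete_graph m = ({..<m}, {e. e \<subseteq> {..<m} \<and> card e = 2})"

(* Containment as a subgraph that need not be induced. *)
definition contains_copy :: "'a graph \<Rightarrow> 'b graph \<Rightarrow> bool" where
  "contains_copy G F \<longleftrightarrow>
     (\<exists>f. inj_on f (verts F) \<and> f ` verts F \<subseteq> verts G \<and> (\<forall>e\<in>edges F. f ` e \<in> edges G))"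

definition blow_up :: "nat \<Rightarrow> 'a graph \<Rightarrow> ('a \<times> nat) graph" where
  "blow_up r F =
     (verts F \<times> {..<r}, {{(u, i), (v, j)} | u v i j. {u, v} \<in> edges F \<and> i < r \<and> j < r})"

definition path_edges :: "'a list \<Rightarrow> 'a set set" where
  "path_edges p = {{p ! i, p ! Suc i} | i. Suc i < length p}"

definition internal_verts :: "'a list \<Rightarrow> 'a set" where
  "internal_verts p = set (butlast (tl p))"

(* H is a subdivision of F in which every edge is subdivided at most t times.
   The map b sends the vertices of F to the branch vertices, and P e is the vertex
   sequence, in either direction, of the path of H that replaces the edge e; H has no
   vertices or edges beyond these. *)
definition is_subdivision :: "'a graph \<Rightarrow> real \<Rightarrow> 'b graph \<Rightarrow> bool" where
  "is_subdivision F t H \<longleftrightarrow>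
     (\<exists>b P. inj_on b (verts F) \<and>
        (\<forall>e\<in>edges F.
           P e \<noteq> [] \<and> distinct (P e) \<and> {hd (P e), last (P e)} = b ` e \<and>
           internal_verts (P e) \<inter> b ` verts F = {} \<and>
           real (card (internal_verts (P e))) \<le> t) \<and>
        (\<forall>e\<in>edges F. \<forall>e'\<in>edges F.
           e \<noteq> e' \<longrightarrow> internal_verts (P e) \<inter> internal_verts (P e') = {}) \<and>
        verts H = b ` verts F \<union> (\<Union>e\<in>edges F. set (P e)) \<and>
        edges H = (\<Union>e\<in>edges F. path_edges (P e)))"

lemma simple_graph_complete_graph: "simple_graph (complete_graph m)"
  by (simp add: simple_graph_def complete_graph_def)

lemma simple_graph_blow_up:
  assumes "simple_graph F"
  shows "simple_graph (blow_up r F)"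
proof -
  have "e \<subseteq> verts (blow_up r F) \<and> card e = 2" if e: "e \<in> edges (blow_up r F)" for e
  proof -
    from e obtain u v i j where *: "e = {(u, i), (v, j)}" "{u, v} \<in> edges F" "i < r" "j < r"
      by (auto simp: blow_up_def)
    with assms have "{u, v} \<subseteq> verts F" "card {u, v} = 2"
      unfolding simple_graph_def by blast+
    moreover from this have "u \<noteq> v" by auto
    ultimately show ?thesis using * by (simp add: blow_up_def)
  qed
  moreover have "finite (verts (blow_up r F))"
    using assms by (simp add: simple_graph_def blow_up_def)
  ultimately show ?thesis by (auto simp: simple_graph_def)
qed

lemma simple_graph_subdivision:
  assumes "simple_graph F" "is_subdivision F t H"
  shows "simple_graph H"
proof -
  from assms(2) obtain b P where
    P: "\<forall>e\<in>edges F. distinct (P e)" and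
    V: "verts H = b ` verts F \<union> (\<Union>e\<in>edges F. set (P e))" and
    E: "edges H = (\<Union>e\<in>edges F. path_edges (P e))"
    unfolding is_subdivision_def by (elim exE conjE) (rule that; simp)
  have "edges F \<subseteq> Pow (verts F)" "finite (verts F)"
    using assms(1) by (auto simp: simple_graph_def)
  then have "finite (edges F)" "finite (verts F)"
    using finite_subset by auto
  then have "finite (verts H)" by (simp add: V)
  have path: "e \<subseteq> set p \<and> card e = 2" if p: "distinct p" "e \<in> path_edges p" for e and p :: "'b list"
  proof -
    from p(2) obtain i where i: "e = {p ! i, p ! Suc i}" "Suc i < length p"
      by (auto simp: path_edges_def)
    with p(1) have "p ! i \<noteq> p ! Suc i" by (simp add: nth_eq_iff_index_eq)
    with i show ?thesis by simp
  qed
  have "e \<subseteq> verts H \<and> card e = 2" if e: "e \<in> edges H" for e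
  proof -
    from e obtain e' where e': "e' \<in> edges F" "e \<in> path_edges (P e')"
      by (auto simp: E)
    with P path[of "P e'" e] have "e \<subseteq> set (P e')" "card e = 2" by simp_all
    with e'(1) show ?thesis by (auto simp: V)
  qed
  with \<open>finite (verts H)\<close> show ?thesis by (auto simp: simple_graph_def)
qed

end

(* Call two r-subsets of V(G) adjacent when they span a complete bipartite graph in G. A subdivision of
   K_m in this auxiliary graph whose vertices are pairwise disjoint r-sets is a blow-up of a subdivision
   in G. Convexity shows that the auxiliary graph has average degree at least about (log n)^(50 r), and the
   degree of an r-set A is a binomial coefficient in the number of common neighbours of A, so that for
   A of large degree only an r/(log n)^14 fraction of its neighbours contains a given vertex of G.

   Pigeonholing over dyadic degree classes and taking a minimal dense subset yields a bipartite
   subgraph of the auxiliary graph, almost regular on each side, with edge expansion at least about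
   1/(log n)^2. By Cheeger's inequality the random walk on it mixes within T = O((log n)^5) steps. A walk
   with 3 T steps conditioned on its two endpoints visits, by a union bound, with positive probability
   only pairwise disjoint sets that also avoid everything used before: for any two times, one of
   the three segments that they cut off is longer than T and hence mixed. The paths are chosen
   one after the other. *)

theory Submission
  imports Defs "HOL-Analysis.Convex" "HOL-Library.Indicator_Function"
begin

section \<open>Edge expansion and the Dirichlet form\<close>

text \<open>The obstacle is that conflicts must be rare relative to the degrees inside the expander,
  whereas the count of \<open>r\<close>-sets through a vertex of \<open>G\<close> is relative to
  degrees in the whole auxiliary graph. Therefore each \<open>r\<close>-set carries its dyadic
  degree as a weight; a minimal dense subset for these weights keeps a share of order
  \<open>1/k\<close> of the degree of every vertex that it retains, with \<open>k\<close> of order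
  \<open>r L\<close> and \<open>L = log n\<close>.

  The exponents balance as follows. All volumes are at most \<open>n^(2r)\<close>, so their
  logarithms are of order \<open>r L\<close>. The number of classes and the entropy term each cost
  one such factor, which gives \<phi> of order \<open>1/(r L)^2\<close>. Mixing needs
  \<open>\<phi>^2 T\<close> of order \<open>r L\<close>, hence \<open>T\<close> of order
  \<open>(r L)^5\<close>, and \<open>3 T\<close> fits below \<open>L^6\<close>. The union bound runs
  over about \<open>L^12\<close> pairs of times, while a one-step conflict has probability of order
  \<open>L / L^14\<close>, where the extra \<open>L\<close> is the loss in degrees. What remains is
  \<open>1/L\<close> times a constant in \<open>r\<close> and \<open>m\<close>; this is why
  \<open>L^14\<close> suffices.\<close>

locale sym_net =
  fixes U :: "'v set" and N :: "'v \<Rightarrow> 'v set"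
  assumes fin: "finite U"
    and N_sub: "x \<in> U \<Longrightarrow> N x \<subseteq> U"
    and N_sym: "x \<in> U \<Longrightarrow> y \<in> N x \<Longrightarrow> x \<in> N y"
    and N_ne: "x \<in> U \<Longrightarrow> N x \<noteq> {}"
begin

definition d :: "'v \<Rightarrow> real" where "d x = real (card (N x))"

definition vol :: "'v set \<Rightarrow> real" where "vol S = (\<Sum>x\<in>S. d x)"

definition cut :: "'v set \<Rightarrow> real" where "cut S = (\<Sum>x\<in>S. real (card (N x - S)))"

lemma N_fin [simp]: "x \<in> U \<Longrightarrow> finite (N x)"
  using N_sub fin finite_subset by blast

lemma d_ge1: "x \<in> U \<Longrightarrow> d x \<ge> 1"
  unfolding d_def using N_ne[of x] N_fin[of x]
  by (metis One_nat_def Suc_leI card_gt_0_iff of_nat_1 of_nat_le_iff)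

lemma d_pos: "x \<in> U \<Longrightarrow> d x > 0"
  using d_ge1[of x] by linarith

lemma d_nonneg [simp]: "d x \<ge> 0"
  by (simp add: d_def)

lemma vol_mono: "S \<subseteq> T \<Longrightarrow> T \<subseteq> U \<Longrightarrow> vol S \<le> vol T"
  unfolding vol_def by (rule sum_mono2) (auto intro: finite_subset[OF _ fin])

lemma vol_disjoint_Un:
  "S \<subseteq> U \<Longrightarrow> T \<subseteq> U \<Longrightarrow> S \<inter> T = {} \<Longrightarrow> vol (S \<union> T) = vol S + vol T"
  unfolding vol_def using fin by (intro sum.union_disjoint) (auto intro: finite_subset)

lemma vol_Diff: "S \<subseteq> U \<Longrightarrow> vol (U - S) = vol U - vol S"
  using vol_disjoint_Un[of S "U - S"] by (simp add: Un_absorb1)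

lemma sum_N_eq: "x \<in> U \<Longrightarrow> (\<Sum>y\<in>N x. f y) = (\<Sum>y\<in>U. if y \<in> N x then f y else 0)"
  using N_sub[of x] fin by (simp add: sum.If_cases Int_absorb1)

section \<open>Sums over ordered pairs of neighbours\<close>

lemma arc_sum_swap:
  "(\<Sum>x\<in>U. \<Sum>y\<in>N x. F x y) = (\<Sum>x\<in>U. \<Sum>y\<in>N x. F y x)"
  for F :: "'v \<Rightarrow> 'v \<Rightarrow> real"
proof -
  have "(\<Sum>x\<in>U. \<Sum>y\<in>N x. F x y) = (\<Sum>x\<in>U. \<Sum>y\<in>U. if y \<in> N x then F x y else 0)"
    by (intro sum.cong refl sum_N_eq)
  also have "\<dots> = (\<Sum>y\<in>U. \<Sum>x\<in>U. if y \<in> N x then F x y else 0)"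
    by (rule sum.swap)
  also have "\<dots> = (\<Sum>y\<in>U. \<Sum>x\<in>U. if x \<in> N y then F x y else 0)"
    using N_sym by (intro sum.cong refl if_cong) auto
  also have "\<dots> = (\<Sum>x\<in>U. \<Sum>y\<in>N x. F y x)"
    by (intro sum.cong refl sum_N_eq[symmetric])
  finally show ?thesis .
qed

lemma arc_sum_fst: "(\<Sum>x\<in>U. \<Sum>y\<in>N x. f x) = (\<Sum>x\<in>U. d x * f x)"
  by (simp add: d_def)

lemma arc_sum_snd: "(\<Sum>x\<in>U. \<Sum>y\<in>N x. f y) = (\<Sum>x\<in>U. d x * f x)"
  using arc_sum_swap[of "\<lambda>x y. f y"] by (simp add: d_def)

text \<open>An edge between \<open>S\<close> and its complement is an arc in both directions, while
  \<open>cut S\<close> counts only the one that leaves \<open>S\<close>; hence the factor 2.\<close>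

lemma arc_sum_cut:
  assumes "S \<subseteq> U"
  shows "(\<Sum>x\<in>U. \<Sum>y\<in>N x. \<bar>indicator S x - indicator S y\<bar>) = 2 * cut S"
proof -
  let ?I = "indicator S :: 'v \<Rightarrow> real"
  have "(\<Sum>x\<in>U. \<Sum>y\<in>N x. \<bar>?I x - ?I y\<bar>)
      = (\<Sum>x\<in>U. \<Sum>y\<in>N x. ?I x * (1 - ?I y) + ?I y * (1 - ?I x))"
    by (intro sum.cong refl) (auto simp: indicator_def)
  also have "\<dots> = 2 * (\<Sum>x\<in>U. \<Sum>y\<in>N x. ?I x * (1 - ?I y))"
    using arc_sum_swap[of "\<lambda>x y. ?I x * (1 - ?I y)"] by (simp add: sum.distrib)
  also have "(\<Sum>x\<in>U. \<Sum>y\<in>N x. ?I x * (1 - ?I y))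
      = (\<Sum>x\<in>U. if x \<in> S then real (card (N x - S)) else 0)"
  proof (intro sum.cong refl)
    fix x assume x: "x \<in> U"
    have "(\<Sum>y\<in>N x. 1 - ?I y) = (\<Sum>y\<in>N x - S. 1)"
      using x by (intro sum.mono_neutral_cong_right) (auto simp: indicator_def)
    then show "(\<Sum>y\<in>N x. ?I x * (1 - ?I y)) = (if x \<in> S then real (card (N x - S)) else 0)"
      by (simp add: sum_distrib_left[symmetric])
  qed
  also have "\<dots> = cut S"
    using assms fin by (simp add: cut_def sum.If_cases Int_absorb1)
  finally show ?thesis .
qed

text \<open>Co-area argument: peel off the smallest positive value of the function, level by level.\<close>

lemma coarea:
  fixes G :: "'v \<Rightarrow> real"
  assumes "S0 \<subseteq> U" and cut: "\<And>S. S \<subseteq> S0 \<Longrightarrow> \<phi> * vol S \<le> cut S"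
    and "\<And>x. G x \<ge> 0" and "\<And>x. x \<notin> S0 \<Longrightarrow> G x = 0"
  shows "2 * \<phi> * (\<Sum>x\<in>U. d x * G x) \<le> (\<Sum>x\<in>U. \<Sum>y\<in>N x. \<bar>G x - G y\<bar>)"
  using assms(3,4)
proof (induction "card {x. G x \<noteq> 0}" arbitrary: G rule: less_induct)
  case less
  define S where "S = {x. G x \<noteq> 0}"
  have SS0: "S \<subseteq> S0" using less.prems(2) by (auto simp: S_def)
  have finS: "finite S" using SS0 assms(1) fin by (meson finite_subset)
  show ?case
  proof (cases "S = {}")
    case True
    then have "G x = 0" for x by (auto simp: S_def)
    then show ?thesis by simp
  next
    case False
    define t where "t = Min (G ` S)"
    have t_in: "t \<in> G ` S" unfolding t_def using finS False by (intro Min_in) auto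
    have t_le: "t \<le> G x" if "x \<in> S" for x unfolding t_def using finS that by (intro Min_le) auto
    have t_pos: "t > 0"
    proof -
      obtain x where "x \<in> S" "t = G x" using t_in by auto
      then show ?thesis using less.prems(1)[of x] by (simp add: S_def)
    qed
    define G' where "G' = (\<lambda>x. G x - t * indicator S x)"
    have G'0: "G' x \<ge> 0" for x using t_le[of x] less.prems(1)[of x] by (auto simp: G'_def indicator_def)
    have sup': "x \<notin> S \<Longrightarrow> G' x = 0" for x by (simp add: G'_def S_def)
    obtain z where z: "z \<in> S" "t = G z" using t_in by auto
    have "{x. G' x \<noteq> 0} \<subset> S"
      using sup' z by (auto simp: G'_def indicator_def)
    then have "card {x. G' x \<noteq> 0} < card S" using finS by (rule psubset_card_mono[rotated])
    then have IH: "2 * \<phi> * (\<Sum>x\<in>U. d x * G' x) \<le> (\<Sum>x\<in>U. \<Sum>y\<in>N x. \<bar>G' x - G' y\<bar>)"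
      using less.hyps[of G'] G'0 sup' SS0 by (auto simp: S_def)
    have SU: "S \<subseteq> U" using SS0 assms(1) by auto
    \<comment> \<open>The absolute values add up without cancellation: \<open>G'\<close> vanishes
      off \<open>S\<close> and \<open>G\<close> is at least \<open>t\<close> on \<open>S\<close>, so
      the two differences never have opposite signs.\<close>
    have "\<bar>G x - G y\<bar> = \<bar>G' x - G' y\<bar> + t * \<bar>indicator S x - indicator S y\<bar>" for x y
      using t_le[of x] t_le[of y] t_pos sup'[of x] sup'[of y]
      by (auto simp: G'_def indicator_def S_def)
    then have "(\<Sum>x\<in>U. \<Sum>y\<in>N x. \<bar>G x - G y\<bar>)
        = (\<Sum>x\<in>U. \<Sum>y\<in>N x. \<bar>G' x - G' y\<bar>)
          + t * (\<Sum>x\<in>U. \<Sum>y\<in>N x. \<bar>indicator S x - indicator S y\<bar>)"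
      by (simp add: sum.distrib sum_distrib_left)
    also have "\<dots> = (\<Sum>x\<in>U. \<Sum>y\<in>N x. \<bar>G' x - G' y\<bar>) + t * (2 * cut S)"
      by (simp add: arc_sum_cut[OF SU])
    also have "\<dots> \<ge> 2 * \<phi> * (\<Sum>x\<in>U. d x * G' x) + t * (2 * (\<phi> * vol S))"
      using IH cut[OF SS0] t_pos by (intro add_mono mult_left_mono) auto
    finally have *: "(\<Sum>x\<in>U. \<Sum>y\<in>N x. \<bar>G x - G y\<bar>)
        \<ge> 2 * \<phi> * ((\<Sum>x\<in>U. d x * G' x) + t * vol S)"
      by (simp add: algebra_simps)
    have "vol S = (\<Sum>x\<in>U. d x * indicator S x)"
      unfolding vol_def using SU fin by (intro sum.mono_neutral_cong_left) (auto simp: indicator_def)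
    then have "(\<Sum>x\<in>U. d x * G' x) + t * vol S = (\<Sum>x\<in>U. d x * G x)"
      by (simp add: G'_def sum_distrib_left sum.distrib[symmetric] algebra_simps)
    with * show ?thesis by simp
  qed
qed

text \<open>The co-area bound is applied to the square of \<open>g\<close>. Factoring the difference
  of squares, Cauchy-Schwarz separates the Dirichlet form from the sum of
  \<open>(g x + g y)^2\<close>, and the latter is at most four times the weighted norm. The
  right-hand side counts every edge twice, so this is the usual gap of at least
  \<open>\<phi>^2 / 2\<close>.\<close>

lemma dirichlet_ge_of_small_support:
  fixes g :: "'v \<Rightarrow> real"
  assumes "S0 \<subseteq> U" and "\<And>S. S \<subseteq> S0 \<Longrightarrow> \<phi> * vol S \<le> cut S" and "\<phi> \<ge> 0"
    and "\<And>x. x \<notin> S0 \<Longrightarrow> g x = 0" and g0: "\<And>x. g x \<ge> 0"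
  shows "\<phi>\<^sup>2 * (\<Sum>x\<in>U. d x * (g x)\<^sup>2) \<le> (\<Sum>x\<in>U. \<Sum>y\<in>N x. (g x - g y)\<^sup>2)"
proof -
  define A where "A = (\<Sum>x\<in>U. d x * (g x)\<^sup>2)"
  define D where "D = (\<Sum>x\<in>U. \<Sum>y\<in>N x. (g x - g y)\<^sup>2)"
  define I where "I = Sigma U N"
  have finI: "finite I" unfolding I_def using fin by auto
  have S: "(\<Sum>x\<in>U. \<Sum>y\<in>N x. F x y) = (\<Sum>p\<in>I. F (fst p) (snd p))" for F :: "'v \<Rightarrow> 'v \<Rightarrow> real"
    unfolding I_def using fin by (subst sum.Sigma) (auto simp: case_prod_beta)
  have A0: "A \<ge> 0" unfolding A_def by (intro sum_nonneg mult_nonneg_nonneg) auto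
  have co: "2 * \<phi> * A \<le> (\<Sum>x\<in>U. \<Sum>y\<in>N x. \<bar>(g x)\<^sup>2 - (g y)\<^sup>2\<bar>)"
    unfolding A_def using assms by (intro coarea[of S0]) auto
  have "(\<Sum>x\<in>U. \<Sum>y\<in>N x. \<bar>(g x)\<^sup>2 - (g y)\<^sup>2\<bar>)
      = (\<Sum>x\<in>U. \<Sum>y\<in>N x. \<bar>g x - g y\<bar> * (g x + g y))"
    using g0 by (intro sum.cong refl) (simp add: power2_eq_square square_diff_square_factored abs_mult)
  then have "(2 * \<phi> * A)\<^sup>2 \<le> (\<Sum>x\<in>U. \<Sum>y\<in>N x. \<bar>g x - g y\<bar> * (g x + g y))\<^sup>2"
    using co A0 assms(3) by (intro power_mono) auto
  also have "\<dots> \<le> (\<Sum>x\<in>U. \<Sum>y\<in>N x. \<bar>g x - g y\<bar>\<^sup>2) * (\<Sum>x\<in>U. \<Sum>y\<in>N x. (g x + g y)\<^sup>2)"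
    unfolding S by (rule Cauchy_Schwarz_ineq_sum)
  also have "\<dots> \<le> D * (4 * A)"
  proof (intro mult_mono)
    have "(\<Sum>x\<in>U. \<Sum>y\<in>N x. (g x + g y)\<^sup>2) \<le> (\<Sum>x\<in>U. \<Sum>y\<in>N x. 2 * (g x)\<^sup>2 + 2 * (g y)\<^sup>2)"
      by (intro sum_mono) (simp add: power2_sum add.commute sum_squares_bound)
    also have "\<dots> = 2 * (\<Sum>x\<in>U. \<Sum>y\<in>N x. (g x)\<^sup>2) + 2 * (\<Sum>x\<in>U. \<Sum>y\<in>N x. (g y)\<^sup>2)"
      by (simp only: sum.distrib sum_distrib_left)
    also have "\<dots> = 4 * A"
      unfolding arc_sum_fst arc_sum_snd A_def by simp
    finally show "(\<Sum>x\<in>U. \<Sum>y\<in>N x. (g x + g y)\<^sup>2) \<le> 4 * A" .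
  qed (auto simp: D_def intro!: sum_nonneg)
  finally have "A * (\<phi>\<^sup>2 * A) \<le> A * D" by (simp add: power2_eq_square algebra_simps)
  moreover have "D \<ge> 0" unfolding D_def by (intro sum_nonneg) auto
  ultimately have "\<phi>\<^sup>2 * A \<le> D"
    using A0 by (cases "A = 0") auto
  then show ?thesis by (simp add: A_def D_def)
qed

text \<open>A weighted median: the least value of \<open>F\<close> whose lower level set carries at
  least half of the volume. It is the level at which \<open>F\<close> is cut into two parts of small
  support.\<close>

lemma exists_median:
  fixes F :: "'v \<Rightarrow> real"
  shows "\<exists>c. 2 * vol {x\<in>U. F x > c} \<le> vol U \<and> 2 * vol {x\<in>U. F x < c} \<le> vol U"
proof (cases "U = {}")
  case True
  then show ?thesis by (simp add: vol_def)
next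
  case False
  define C where "C = {v \<in> F ` U. vol U \<le> 2 * vol {x\<in>U. F x \<le> v}}"
  have finC: "finite C" using fin by (auto simp: C_def)
  have vol0: "vol U \<ge> 0" by (simp add: vol_def sum_nonneg)
  have "Max (F ` U) \<in> F ` U" using False fin by (intro Max_in) auto
  moreover have "{x\<in>U. F x \<le> Max (F ` U)} = U" using fin by auto
  ultimately have "Max (F ` U) \<in> C" using vol0 by (simp add: C_def)
  then have Cne: "C \<noteq> {}" by auto
  define c where "c = Min C"
  have cC: "c \<in> C" unfolding c_def using finC Cne by (rule Min_in)
  have "{x\<in>U. F x > c} = U - {x\<in>U. F x \<le> c}" by auto
  then have "vol {x\<in>U. F x > c} = vol U - vol {x\<in>U. F x \<le> c}" using vol_Diff[of "{x\<in>U. F x \<le> c}"] by auto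
  then have 1: "2 * vol {x\<in>U. F x > c} \<le> vol U" using cC by (simp add: C_def)
  have 2: "2 * vol {x\<in>U. F x < c} \<le> vol U"
  proof (rule ccontr)
    assume neg: "\<not> ?thesis"
    define L where "L = {x\<in>U. F x < c}"
    have "L \<noteq> {}"
    proof
      assume "L = {}"
      then have "vol L = 0" by (simp add: vol_def)
      then show False using neg vol0 by (simp add: L_def)
    qed
    moreover have "finite L" using fin by (simp add: L_def)
    ultimately have "Max (F ` L) \<in> F ` L" and ub: "\<And>x. x \<in> L \<Longrightarrow> F x \<le> Max (F ` L)"
      by auto
    \<comment> \<open>The largest value below \<open>c\<close> would already qualify, against the
      minimality of \<open>c\<close>.\<close>
    then obtain z where z: "z \<in> L" "F z = Max (F ` L)" by auto
    have "{x\<in>U. F x \<le> F z} = L" using ub z by (auto simp: L_def)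
    moreover have "F z \<in> F ` U" using z(1) by (auto simp: L_def)
    ultimately have "F z \<in> C" using neg by (simp add: C_def L_def)
    then have "c \<le> F z" unfolding c_def using finC by (intro Min_le)
    then show False using z by (simp add: L_def)
  qed
  show ?thesis using 1 2 by blast
qed

text \<open>The positive and the negative part of \<open>F - c\<close>, with \<open>c\<close> a
  median, are each supported on at most half of the volume, so expansion is available for all
  subsets of their supports. Their Dirichlet forms together do not exceed that of
  \<open>F\<close>.\<close>

theorem cheeger:
  fixes F :: "'v \<Rightarrow> real"
  assumes exp: "\<And>S. S \<subseteq> U \<Longrightarrow> 2 * vol S \<le> vol U \<Longrightarrow> \<phi> * vol S \<le> cut S" and "\<phi> \<ge> 0"
    and mean: "(\<Sum>x\<in>U. d x * F x) = 0"
  shows "\<phi>\<^sup>2 * (\<Sum>x\<in>U. d x * (F x)\<^sup>2) \<le> (\<Sum>x\<in>U. \<Sum>y\<in>N x. (F x - F y)\<^sup>2)"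
proof -
  obtain c where c: "2 * vol {x\<in>U. F x > c} \<le> vol U" "2 * vol {x\<in>U. F x < c} \<le> vol U"
    using exists_median by blast
  define g where "g = (\<lambda>x. if x \<in> U then max 0 (F x - c) else 0)"
  define h where "h = (\<lambda>x. if x \<in> U then max 0 (c - F x) else 0)"
  have small: "\<phi> * vol S \<le> cut S" if "S \<subseteq> T" "T \<subseteq> U" "2 * vol T \<le> vol U" for S T
    using that exp[of S] vol_mono[of S T] by auto
  have G: "\<phi>\<^sup>2 * (\<Sum>x\<in>U. d x * (g x)\<^sup>2) \<le> (\<Sum>x\<in>U. \<Sum>y\<in>N x. (g x - g y)\<^sup>2)"
    by (rule dirichlet_ge_of_small_support[of "{x\<in>U. F x > c}"])
      (use small[of _ "{x\<in>U. F x > c}"] c assms(2) in \<open>auto simp: g_def\<close>)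
  have H: "\<phi>\<^sup>2 * (\<Sum>x\<in>U. d x * (h x)\<^sup>2) \<le> (\<Sum>x\<in>U. \<Sum>y\<in>N x. (h x - h y)\<^sup>2)"
    by (rule dirichlet_ge_of_small_support[of "{x\<in>U. F x < c}"])
      (use small[of _ "{x\<in>U. F x < c}"] c assms(2) in \<open>auto simp: h_def\<close>)
  \<comment> \<open>As the weighted mean of \<open>F\<close> vanishes, a shift by \<open>c\<close>
    can only increase the weighted norm.\<close>
  have "(\<Sum>x\<in>U. d x * (F x)\<^sup>2) \<le> (\<Sum>x\<in>U. d x * (F x)\<^sup>2) + c\<^sup>2 * (\<Sum>x\<in>U. d x)"
    by (simp add: sum_nonneg)
  also have "\<dots> = (\<Sum>x\<in>U. d x * (F x)\<^sup>2) - 2 * c * (\<Sum>x\<in>U. d x * F x) + c\<^sup>2 * (\<Sum>x\<in>U. d x)"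
    by (simp add: mean)
  also have "\<dots> = (\<Sum>x\<in>U. d x * (F x - c)\<^sup>2)"
    by (simp add: sum_distrib_left sum_subtractf[symmetric] sum.distrib[symmetric]
        power2_eq_square algebra_simps)
  also have "\<dots> = (\<Sum>x\<in>U. d x * (g x)\<^sup>2) + (\<Sum>x\<in>U. d x * (h x)\<^sup>2)"
    unfolding sum.distrib[symmetric]
    by (intro sum.cong refl) (auto simp: g_def h_def max_def power2_eq_square algebra_simps)
  finally have "\<phi>\<^sup>2 * (\<Sum>x\<in>U. d x * (F x)\<^sup>2)
      \<le> \<phi>\<^sup>2 * ((\<Sum>x\<in>U. d x * (g x)\<^sup>2) + (\<Sum>x\<in>U. d x * (h x)\<^sup>2))"
    by (intro mult_left_mono) auto
  also have "\<dots> \<le> (\<Sum>x\<in>U. \<Sum>y\<in>N x. (g x - g y)\<^sup>2) + (\<Sum>x\<in>U. \<Sum>y\<in>N x. (h x - h y)\<^sup>2)"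
    using G H by (simp add: distrib_left)
  also have "\<dots> = (\<Sum>x\<in>U. \<Sum>y\<in>N x. (g x - g y)\<^sup>2 + (h x - h y)\<^sup>2)"
    by (simp add: sum.distrib)
  also have "\<dots> \<le> (\<Sum>x\<in>U. \<Sum>y\<in>N x. (F x - F y)\<^sup>2)"
  proof (intro sum_mono)
    fix x y assume "x \<in> U" "y \<in> N x"
    then have xy: "x \<in> U" "y \<in> U" using N_sub by auto
    \<comment> \<open>For values of opposite sign the left side lacks the cross term
      \<open>-2 a b\<close>, which is nonnegative.\<close>
    have key: "(max 0 a - max 0 b)\<^sup>2 + (max 0 (-a) - max 0 (-b))\<^sup>2 \<le> (a - b)\<^sup>2" for a b :: real
    proof (cases "a \<ge> 0"; cases "b \<ge> 0")
      assume "a \<ge> 0" "\<not> b \<ge> 0"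
      then have "a * b \<le> 0" by (intro mult_nonneg_nonpos) auto
      then show ?thesis using \<open>a \<ge> 0\<close> \<open>\<not> b \<ge> 0\<close> by (simp add: max_def power2_eq_square algebra_simps)
    next
      assume "\<not> a \<ge> 0" "b \<ge> 0"
      then have "a * b \<le> 0" by (intro mult_nonpos_nonneg) auto
      then show ?thesis using \<open>\<not> a \<ge> 0\<close> \<open>b \<ge> 0\<close> by (simp add: max_def power2_eq_square algebra_simps)
    qed (auto simp: max_def power2_eq_square algebra_simps)
    show "(g x - g y)\<^sup>2 + (h x - h y)\<^sup>2 \<le> (F x - F y)\<^sup>2"
      using key[of "F x - c" "F y - c"] xy by (simp add: g_def h_def)
  qed
  finally show ?thesis .
qed

end

section \<open>Mixing of random walks on bipartite expanders\<close>

locale bip_net = sym_net U N for U :: "'v set" and N +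
  fixes side :: "'v \<Rightarrow> bool" and \<phi> :: real
  assumes side_alt: "x \<in> U \<Longrightarrow> y \<in> N x \<Longrightarrow> side y \<longleftrightarrow> \<not> side x"
    and phi0: "0 \<le> \<phi>" and phi1: "\<phi> \<le> 1"
    and expansion: "S \<subseteq> U \<Longrightarrow> 2 * vol S \<le> vol U \<Longrightarrow> \<phi> * vol S \<le> cut S"
begin

lemma contraction_nonneg: "0 \<le> 1 - \<phi>\<^sup>2 / 2"
  using power_le_one[OF phi0 phi1, of 2] by simp

section \<open>Contraction of the averaging operator\<close>

definition Q :: "('v \<Rightarrow> real) \<Rightarrow> 'v \<Rightarrow> real" where
  "Q f x = (if x \<in> U then (\<Sum>y\<in>N x. f y) / d x else 0)"

lemma d_Q: "x \<in> U \<Longrightarrow> d x * Q f x = (\<Sum>y\<in>N x. f y)"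
  using d_pos[of x] by (simp add: Q_def)

text \<open>The spectrum of a bipartite graph is symmetric, so averaging contracts only away from
  the constants and from their copy with alternating signs; a function of mean zero on one side is
  orthogonal to both. As \<open>f\<close> and \<open>Q f\<close> live on opposite sides, Cheeger's
  inequality for \<open>F = f + Q f\<close> reads \<open>\<phi>^2 (A + B) \<le> 2 A - 2 B\<close>,
  where \<open>A\<close> and \<open>B\<close> are the squared norms of \<open>f\<close> and
  \<open>Q f\<close>.\<close>

lemma Q_contraction:
  assumes supp: "\<And>x. x \<in> U \<Longrightarrow> side x \<noteq> s \<Longrightarrow> f x = 0" and mean: "(\<Sum>x\<in>U. d x * f x) = 0"
  shows "(\<Sum>x\<in>U. d x * (Q f x)\<^sup>2) \<le> (1 - \<phi>\<^sup>2 / 2) * (\<Sum>x\<in>U. d x * (f x)\<^sup>2)"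
proof -
  define F where "F = (\<lambda>x. f x + Q f x)"
  have Qsupp: "Q f x = 0" if "x \<in> U" "side x = s" for x
  proof -
    have "(\<Sum>y\<in>N x. f y) = 0"
      using that side_alt[of x] supp N_sub[of x] by (intro sum.neutral) auto
    then show ?thesis by (simp add: Q_def)
  qed
  have prod0: "f x * Q f x = 0" if "x \<in> U" for x
    using Qsupp[of x] supp[of x] that by auto
  have "(\<Sum>x\<in>U. d x * Q f x) = (\<Sum>x\<in>U. \<Sum>y\<in>N x. f y)" by (intro sum.cong refl d_Q)
  then have Qmean: "(\<Sum>x\<in>U. d x * Q f x) = 0" using mean by (simp add: arc_sum_snd)
  have Fmean: "(\<Sum>x\<in>U. d x * F x) = 0"
    using mean Qmean by (simp add: F_def distrib_left sum.distrib)
  define A where "A = (\<Sum>x\<in>U. d x * (f x)\<^sup>2)"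
  define B where "B = (\<Sum>x\<in>U. d x * (Q f x)\<^sup>2)"
  have B0: "B \<ge> 0" unfolding B_def by (intro sum_nonneg) auto
  have FF: "(\<Sum>x\<in>U. d x * (F x)\<^sup>2) = A + B"
    unfolding A_def B_def sum.distrib[symmetric]
  proof (intro sum.cong refl)
    fix x assume "x \<in> U"
    then show "d x * (F x)\<^sup>2 = d x * (f x)\<^sup>2 + d x * (Q f x)\<^sup>2"
      using prod0[of x] by (auto simp: F_def power2_sum distrib_left)
  qed
  have fQ: "(\<Sum>x\<in>U. \<Sum>y\<in>N x. Q f x * f y) = B"
    unfolding B_def
    by (intro sum.cong refl) (simp add: sum_distrib_left[symmetric] d_Q[symmetric] power2_eq_square)
  have "(\<Sum>x\<in>U. \<Sum>y\<in>N x. F x * F y)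
      = (\<Sum>x\<in>U. \<Sum>y\<in>N x. Q f x * f y + Q f y * f x)"
  proof (intro sum.cong refl)
    fix x y assume x: "x \<in> U" "y \<in> N x"
    then have y: "y \<in> U" "side y \<noteq> side x" using N_sub side_alt by auto
    then show "F x * F y = Q f x * f y + Q f y * f x"
      using supp[of x] supp[of y] Qsupp[of x] Qsupp[of y] x
      by (cases "side x = s") (auto simp: F_def algebra_simps)
  qed
  also have "\<dots> = 2 * B"
    using fQ arc_sum_swap[of "\<lambda>x y. Q f x * f y"] by (simp add: sum.distrib)
  finally have cross: "(\<Sum>x\<in>U. \<Sum>y\<in>N x. F x * F y) = 2 * B" .
  have "(\<Sum>x\<in>U. \<Sum>y\<in>N x. (F x - F y)\<^sup>2)
     = (\<Sum>x\<in>U. \<Sum>y\<in>N x. (F x)\<^sup>2) + (\<Sum>x\<in>U. \<Sum>y\<in>N x. (F y)\<^sup>2) - 2 * (\<Sum>x\<in>U. \<Sum>y\<in>N x. F x * F y)"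
    unfolding sum_distrib_left sum.distrib[symmetric] sum_subtractf[symmetric]
    by (intro sum.cong refl) (simp add: power2_diff)
  also have "\<dots> = 2 * A - 2 * B"
    unfolding arc_sum_fst arc_sum_snd cross FF by simp
  finally have "(\<Sum>x\<in>U. \<Sum>y\<in>N x. (F x - F y)\<^sup>2) = 2 * A - 2 * B" .
  moreover have "\<phi>\<^sup>2 * (\<Sum>x\<in>U. d x * (F x)\<^sup>2) \<le> (\<Sum>x\<in>U. \<Sum>y\<in>N x. (F x - F y)\<^sup>2)"
    by (rule cheeger[OF expansion phi0 Fmean])
  ultimately have "\<phi>\<^sup>2 * (A + B) \<le> 2 * A - 2 * B" by (simp add: FF)
  moreover have "\<phi>\<^sup>2 * A \<le> \<phi>\<^sup>2 * (A + B)" using B0 by (intro mult_left_mono) auto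
  ultimately show ?thesis unfolding A_def[symmetric] B_def[symmetric] by (simp add: algebra_simps)
qed

text \<open>\<open>u k x y\<close> is the probability that the simple random walk from \<open>x\<close> is at \<open>y\<close> after
  \<open>k\<close> steps, divided by the degree of \<open>y\<close>; this normalisation makes it symmetric.\<close>

fun u :: "nat \<Rightarrow> 'v \<Rightarrow> 'v \<Rightarrow> real" where
  "u 0 x y = (if x = y then 1 / d y else 0)"
| "u (Suc k) x y = Q (\<lambda>z. u k z y) x"

section \<open>Transition densities and mixing\<close>

lemma u_nonneg [simp]: "u k x y \<ge> 0"
  by (induction k arbitrary: x) (auto simp: Q_def intro!: divide_nonneg_nonneg sum_nonneg)

text \<open>Chapman-Kolmogorov equation; the factor \<open>d v\<close> turns the density
  \<open>u a x v\<close> back into a probability.\<close>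

lemma u_add:
  assumes "x \<in> U" "y \<in> U"
  shows "u (a + b) x y = (\<Sum>v\<in>U. u a x v * d v * u b v y)"
  using assms(1)
proof (induction a arbitrary: x)
  case 0
  have "(\<Sum>v\<in>U. u 0 x v * d v * u b v y) = (\<Sum>v\<in>U. if x = v then u b v y else 0)"
    using d_pos by (intro sum.cong refl) (auto simp: less_imp_neq[symmetric] dual_order.strict_iff_order)
  then show ?case using 0 fin by simp
next
  case (Suc a)
  have "u (Suc a + b) x y = (\<Sum>z\<in>N x. u (a + b) z y) / d x"
    using Suc.prems by (simp add: Q_def)
  also have "(\<Sum>z\<in>N x. u (a + b) z y) = (\<Sum>z\<in>N x. \<Sum>v\<in>U. u a z v * d v * u b v y)"
    using Suc.IH N_sub[OF Suc.prems] by (intro sum.cong refl) auto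
  also have "\<dots> = (\<Sum>v\<in>U. (\<Sum>z\<in>N x. u a z v) * d v * u b v y)"
    by (subst sum.swap) (simp add: sum_distrib_right)
  finally have "u (Suc a + b) x y = (\<Sum>v\<in>U. (\<Sum>z\<in>N x. u a z v) * d v * u b v y) / d x" .
  also have "\<dots> = (\<Sum>v\<in>U. ((\<Sum>z\<in>N x. u a z v) / d x) * d v * u b v y)"
    unfolding sum_divide_distrib[of _ U] by (intro sum.cong refl) simp
  finally show ?case using Suc.prems by (simp add: Q_def)
qed

lemma u_1: "x \<in> U \<Longrightarrow> u 1 x y = (if y \<in> N x then 1 / (d x * d y) else 0)"
  by (simp add: Q_def)

lemma u_1_commute: "x \<in> U \<Longrightarrow> y \<in> U \<Longrightarrow> u 1 x y = u 1 y x"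
  using N_sym[of x y] N_sym[of y x] by (auto simp del: u.simps simp: u_1[simplified] u_1 mult.commute)

text \<open>Reversibility: by the symmetry of a single step, the first step of the walk from
  \<open>x\<close> becomes the last step of the walk from \<open>y\<close>.\<close>

lemma u_commute: "x \<in> U \<Longrightarrow> y \<in> U \<Longrightarrow> u k x y = u k y x"
proof (induction k arbitrary: x y)
  case 0
  then show ?case by simp
next
  case (Suc k)
  have "u (Suc k) x y = (\<Sum>v\<in>U. u 1 x v * d v * u k v y)"
    using u_add[of x y 1 k] Suc.prems by simp
  also have "\<dots> = (\<Sum>v\<in>U. u k y v * d v * u 1 v x)"
    using Suc u_1_commute[of x] by (intro sum.cong refl) (simp add: mult_ac del: u.simps)
  also have "\<dots> = u (Suc k) y x"
    using u_add[of y x k 1] Suc.prems by simp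
  finally show ?case .
qed

lemma u_total: "x \<in> U \<Longrightarrow> (\<Sum>v\<in>U. u k x v * d v) = 1"
proof (induction k arbitrary: x)
  case 0
  have "(\<Sum>v\<in>U. u 0 x v * d v) = (\<Sum>v\<in>U. if x = v then 1 else 0)"
    using d_pos by (intro sum.cong refl) (auto simp: less_imp_neq[symmetric] dual_order.strict_iff_order)
  then show ?case using 0 fin by simp
next
  case (Suc k)
  have "(\<Sum>v\<in>U. u (Suc k) x v * d v) = (\<Sum>z\<in>N x. \<Sum>v\<in>U. u k z v * d v) / d x"
    using Suc.prems by (subst sum.swap) (simp add: Q_def sum_divide_distrib sum_distrib_right)
  also have "(\<Sum>z\<in>N x. \<Sum>v\<in>U. u k z v * d v) = (\<Sum>z\<in>N x. 1)"
    using Suc.IH N_sub[OF Suc.prems] by (intro sum.cong refl) auto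
  finally show ?case using Suc.prems d_pos[of x] N_ne[of x] by (simp add: d_def)
qed

text \<open>By \<open>vol_side\<close> this is the volume of either side, so \<open>1 / M\<close> is
  the stationary density of the walk on the side permitted by parity.\<close>

definition M :: real where "M = vol {x\<in>U. side x}"

text \<open>Every arc joins the two sides, so reversing the arcs exchanges the two degree
  sums.\<close>

lemma vol_side: "vol {x\<in>U. side x = s} = M"
proof (cases s)
  case True
  then show ?thesis by (simp add: M_def)
next
  case False
  have *: "vol {x\<in>U. side x = s} = (\<Sum>x\<in>U. \<Sum>y\<in>N x. if side x = s then 1 else 0)" for s
    unfolding vol_def using fin by (simp add: sum.If_cases sum.inter_filter d_def if_distrib cong: if_cong)
  have "vol {x\<in>U. side x = True} = (\<Sum>x\<in>U. \<Sum>y\<in>N x. if side y = True then 1 else 0)"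
    unfolding * by (rule arc_sum_swap)
  also have "\<dots> = (\<Sum>x\<in>U. \<Sum>y\<in>N x. if side x = False then 1 else 0)"
    using side_alt by (intro sum.cong refl) auto
  also have "\<dots> = vol {x\<in>U. side x = False}" unfolding * ..
  finally show ?thesis using False by (simp add: M_def)
qed

lemma M_ge1: assumes "x \<in> U" shows "M \<ge> 1"
proof -
  have "1 \<le> d x" using d_ge1 assms by auto
  also have "d x = vol {x}" by (simp add: vol_def)
  also have "\<dots> \<le> vol {y\<in>U. side y = side x}" using assms by (intro vol_mono) auto
  finally show ?thesis by (simp add: vol_side)
qed

text \<open>The deviation from the stationary density has mean zero, lives on one side and evolves
  by \<open>Q\<close>, so \<open>Q_contraction\<close> applies at every step. The squared norm
  starts at no more than 1, and it bounds each single value because degrees are at least 1.\<close>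

lemma mixing:
  assumes y: "y \<in> U" and x: "x \<in> U"
  shows "\<bar>u k x y - (if side x = (side y = even k) then 1 / M else 0)\<bar> \<le> sqrt ((1 - \<phi>\<^sup>2 / 2) ^ k)"
proof -
  define h where "h = (\<lambda>k x. u k x y - (if side x = (side y = even k) then 1 / M else 0))"
  have M1: "M \<ge> 1" by (rule M_ge1[OF y])
  have props: "(\<forall>x\<in>U. side x \<noteq> (side y = even k) \<longrightarrow> h k x = 0) \<and> (\<Sum>x\<in>U. d x * h k x) = 0
     \<and> (\<Sum>x\<in>U. d x * (h k x)\<^sup>2) \<le> (1 - \<phi>\<^sup>2 / 2) ^ k" for k
  proof (induction k)
    case 0
    have a: "h 0 x = 0" if "x \<in> U" "side x \<noteq> side y" for x
      using that by (auto simp: h_def)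
    have s1: "(\<Sum>x\<in>U. d x * (if x = y then 1 / d y else 0)) = 1"
      using y fin d_pos[of y] by (simp add: if_distrib cong: if_cong)
    have s2: "(\<Sum>x\<in>U. d x * (if side x = side y then 1 / M else 0)) = 1"
    proof -
      have "(\<Sum>x\<in>U. d x * (if side x = side y then 1 / M else 0))
          = (\<Sum>x\<in>{x\<in>U. side x = side y}. d x * (1 / M))"
        using fin by (intro sum.mono_neutral_cong_right) auto
      also have "\<dots> = M * (1 / M)"
        unfolding sum_distrib_right[symmetric] vol_def[symmetric] vol_side ..
      finally show ?thesis using M1 by simp
    qed
    have b: "(\<Sum>x\<in>U. d x * h 0 x) = 0"
      using s1 s2 by (simp add: h_def right_diff_distrib sum_subtractf)
    \<comment> \<open>One factor \<open>h 0 x\<close> is expanded into point mass minus constant.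
      The constant contributes nothing since the mean is zero, which leaves the single value
      \<open>h 0 y\<close>.\<close>
    have "(\<Sum>x\<in>U. d x * (h 0 x)\<^sup>2)
      = (\<Sum>x\<in>U. d x * h 0 x * (if x = y then 1 / d y else 0)) - (\<Sum>x\<in>U. d x * h 0 x) / M"
      unfolding sum_divide_distrib sum_subtractf[symmetric]
    proof (intro sum.cong refl)
      fix x assume x: "x \<in> U"
      define q where "q = (if x = y then 1 / d y else 0)"
      have "h 0 x = 0 \<or> h 0 x = q - 1 / M" using a[OF x] by (auto simp: h_def q_def)
      then have "h 0 x * h 0 x = h 0 x * (q - 1 / M)" by auto
      then have "d x * (h 0 x)\<^sup>2 = d x * (h 0 x * (q - 1 / M))" by (simp add: power2_eq_square)
      then show "d x * (h 0 x)\<^sup>2 = d x * h 0 x * (if x = y then 1 / d y else 0) - d x * h 0 x / M"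
        unfolding q_def[symmetric] by (simp add: algebra_simps)
    qed
    also have "\<dots> = h 0 y"
      using b y fin d_pos[of y] by (simp add: if_distrib cong: if_cong)
    also have "\<dots> \<le> 1"
    proof -
      have "1 / d y \<le> 1" using d_ge1[OF y] by simp
      moreover have "1 / M \<ge> 0" using M1 by simp
      moreover have "h 0 y = 1 / d y - 1 / M" by (simp add: h_def)
      ultimately show ?thesis by linarith
    qed
    finally show ?case using a b by simp
  next
    case (Suc k)
    have hQ: "h (Suc k) x = Q (h k) x" if "x \<in> U" for x
    proof -
      have "(\<Sum>z\<in>N x. (if side z = (side y = even k) then 1 / M else 0))
          = (\<Sum>z\<in>N x. (if side x = (side y = even (Suc k)) then 1 / M else 0))"
        using side_alt[OF that] by (intro sum.cong refl) auto
      also have "\<dots> = d x * (if side x = (side y = even (Suc k)) then 1 / M else 0)"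
        by (simp add: d_def)
      finally show ?thesis
        using that d_pos[OF that] by (simp add: h_def Q_def sum_subtractf diff_divide_distrib)
    qed
    have supp: "h k x = 0" if "x \<in> U" "side x \<noteq> (side y = even k)" for x
      using Suc that by auto
    have A: "h (Suc k) x = 0" if "x \<in> U" "side x \<noteq> (side y = even (Suc k))" for x
    proof -
      have "(\<Sum>z\<in>N x. h k z) = 0"
        using that side_alt[of x] N_sub[of x] by (intro sum.neutral ballI supp) auto
      then show ?thesis using that hQ by (simp add: Q_def)
    qed
    have "(\<Sum>x\<in>U. d x * h (Suc k) x) = (\<Sum>x\<in>U. \<Sum>z\<in>N x. h k z)"
      using hQ d_Q by (intro sum.cong refl) simp
    also have "\<dots> = 0" using Suc by (simp add: arc_sum_snd)
    finally have Bq: "(\<Sum>x\<in>U. d x * h (Suc k) x) = 0" .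
    have "(\<Sum>x\<in>U. d x * (h (Suc k) x)\<^sup>2) = (\<Sum>x\<in>U. d x * (Q (h k) x)\<^sup>2)"
      using hQ by (intro sum.cong refl) simp
    also have "\<dots> \<le> (1 - \<phi>\<^sup>2 / 2) * (\<Sum>x\<in>U. d x * (h k x)\<^sup>2)"
      using Suc by (intro Q_contraction[of "side y = even k"] supp) auto
    finally have C: "(\<Sum>x\<in>U. d x * (h (Suc k) x)\<^sup>2) \<le> (1 - \<phi>\<^sup>2 / 2) * (\<Sum>x\<in>U. d x * (h k x)\<^sup>2)" .
    have "(1 - \<phi>\<^sup>2 / 2) * (\<Sum>x\<in>U. d x * (h k x)\<^sup>2) \<le> (1 - \<phi>\<^sup>2 / 2) * (1 - \<phi>\<^sup>2 / 2) ^ k"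
      using Suc contraction_nonneg by (intro mult_left_mono) auto
    then show ?case using A Bq C by auto
  qed
  have "(h k x)\<^sup>2 \<le> d x * (h k x)\<^sup>2" using d_ge1[OF x] mult_right_mono[of 1 "d x" "(h k x)\<^sup>2"] by simp
  also have "\<dots> \<le> (\<Sum>x\<in>U. d x * (h k x)\<^sup>2)" using x fin by (intro member_le_sum) auto
  also have "\<dots> \<le> (1 - \<phi>\<^sup>2 / 2) ^ k" using props by auto
  finally have "sqrt ((h k x)\<^sup>2) \<le> sqrt ((1 - \<phi>\<^sup>2 / 2) ^ k)" by (rule real_sqrt_le_mono)
  then show ?thesis by (simp add: h_def)
qed

end

section \<open>Conflict-free walks\<close>

context bip_net
begin

text \<open>\<open>wsum k x \<psi>\<close> sums \<open>\<psi>\<close> over the walks with \<open>k\<close> steps starting at \<open>x\<close>, where a walk has as its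
  weight the product of the inverse degrees of all its vertices. As a positive linear functional it
  allows union bounds.\<close>

fun wsum :: "nat \<Rightarrow> 'v \<Rightarrow> ('v list \<Rightarrow> real) \<Rightarrow> real" where
  "wsum 0 x \<psi> = \<psi> [x] / d x"
| "wsum (Suc k) x \<psi> = (\<Sum>y\<in>N x. wsum k y (\<lambda>l. \<psi> (x # l))) / d x"

definition is_walk :: "nat \<Rightarrow> 'v \<Rightarrow> 'v list \<Rightarrow> bool" where
  "is_walk k x l \<longleftrightarrow> length l = Suc k \<and> hd l = x \<and> set l \<subseteq> U \<and> successively (\<lambda>v w. w \<in> N v) l"

lemma is_walk_Cons:
  assumes "x \<in> U" "y \<in> N x" "is_walk k y l"
  shows "is_walk (Suc k) x (x # l)"
  using assms by (cases l) (auto simp: is_walk_def)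

lemma wsum_mono:
  assumes "x \<in> U" "\<And>l. is_walk k x l \<Longrightarrow> \<psi> l \<le> \<chi> l"
  shows "wsum k x \<psi> \<le> wsum k x \<chi>"
  using assms
proof (induction k arbitrary: x \<psi> \<chi>)
  case 0
  then have "\<psi> [x] \<le> \<chi> [x]" by (simp add: is_walk_def)
  then show ?case by (simp add: divide_right_mono)
next
  case (Suc k)
  have "wsum k y (\<lambda>l. \<psi> (x # l)) \<le> wsum k y (\<lambda>l. \<chi> (x # l))" if y: "y \<in> N x" for y
    using N_sub[OF Suc.prems(1)] y is_walk_Cons[OF Suc.prems(1) y]
    by (intro Suc.IH Suc.prems(2)) auto
  then show ?case by (auto intro!: divide_right_mono sum_mono)
qed

lemma wsum_cong:
  assumes "x \<in> U" "\<And>l. is_walk k x l \<Longrightarrow> \<psi> l = \<chi> l"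
  shows "wsum k x \<psi> = wsum k x \<chi>"
  using wsum_mono[OF assms(1), of k \<psi> \<chi>] wsum_mono[OF assms(1), of k \<chi> \<psi>] assms(2) by force

lemma wsum_add: "wsum k x (\<lambda>l. \<psi> l + \<chi> l) = wsum k x \<psi> + wsum k x \<chi>"
  by (induction k arbitrary: x \<psi> \<chi>) (simp_all add: add_divide_distrib sum.distrib)

lemma wsum_zero: "wsum k x (\<lambda>l. 0) = 0"
  by (induction k arbitrary: x) simp_all

lemma wsum_sum: "wsum k x (\<lambda>l. \<Sum>i\<in>I. \<psi> i l) = (\<Sum>i\<in>I. wsum k x (\<psi> i))"
  by (induction I rule: infinite_finite_induct) (simp_all add: wsum_zero wsum_add)

lemma wsum_last: "x \<in> U \<Longrightarrow> wsum k x (\<lambda>l. if last l = y then c else 0) = c * u k x y"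
proof (induction k arbitrary: x)
  case 0
  then show ?case by auto
next
  case (Suc k)
  have "wsum k z (\<lambda>l. if last (x # l) = y then c else 0) = c * u k z y" if "z \<in> N x" for z
  proof -
    have z: "z \<in> U" using that Suc.prems N_sub by auto
    have "wsum k z (\<lambda>l. if last (x # l) = y then c else 0) = wsum k z (\<lambda>l. if last l = y then c else 0)"
      by (rule wsum_cong[OF z]) (auto simp: is_walk_def)
    then show ?thesis using Suc.IH[OF z] by simp
  qed
  then show ?case using Suc.prems by (simp add: Q_def sum_distrib_left)
qed

text \<open>Markov property at time \<open>a\<close>. Both \<open>u a x v\<close> and
  \<open>wsum k v\<close> contain a factor \<open>1 / d v\<close> for the common vertex, which
  \<open>d v\<close> corrects.\<close>

lemma wsum_drop:
  "x \<in> U \<Longrightarrow> wsum (a + k) x (\<lambda>l. G (drop a l)) = (\<Sum>v\<in>U. u a x v * d v * wsum k v G)"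
proof (induction a arbitrary: x)
  case 0
  have "(\<Sum>v\<in>U. u 0 x v * d v * wsum k v G) = (\<Sum>v\<in>U. if x = v then wsum k v G else 0)"
    using d_pos by (intro sum.cong refl) (auto simp: less_imp_neq[symmetric] dual_order.strict_iff_order)
  then show ?case using 0 fin by simp
next
  case (Suc a)
  have "wsum (Suc a + k) x (\<lambda>l. G (drop (Suc a) l)) = (\<Sum>z\<in>N x. \<Sum>v\<in>U. u a z v * d v * wsum k v G) / d x"
    using Suc.IH N_sub[OF Suc.prems] by (auto intro!: arg_cong[where f = "\<lambda>t. t / d x"] sum.cong)
  also have "\<dots> = (\<Sum>v\<in>U. ((\<Sum>z\<in>N x. u a z v) / d x) * d v * wsum k v G)"
    by (subst sum.swap, unfold sum_divide_distrib[of _ U], intro sum.cong refl)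
      (simp add: sum_distrib_right)
  finally show ?case using Suc.prems by (simp add: Q_def)
qed

text \<open>The Markov property at both times factors the weight into three transition densities, so
  that each segment can be bounded separately.\<close>

lemma wsum_pair:
  assumes "x \<in> U"
  shows "wsum (a + c + e) x (\<lambda>l. if C (l ! a) (l ! (a + c)) \<and> last l = y then 1 else 0)
    = (\<Sum>v\<in>U. u a x v * d v * (\<Sum>z | z \<in> U \<and> C v z. u c v z * d z * u e z y))"
proof -
  have inner: "wsum (c + e) v (\<lambda>l. if C (l ! 0) (l ! c) \<and> last l = y then 1 else 0)
      = (\<Sum>z | z \<in> U \<and> C v z. u c v z * d z * u e z y)" if v: "v \<in> U" for v
  proof -
    have "wsum (c + e) v (\<lambda>l. if C (l ! 0) (l ! c) \<and> last l = y then 1 else 0)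
        = wsum (c + e) v (\<lambda>l. (\<lambda>l. if C v (hd l) \<and> last l = y then 1 else 0) (drop c l))"
    proof (rule wsum_cong[OF v])
      fix l assume "is_walk (c + e) v l"
      then have l: "length l = Suc (c + e)" "hd l = v" by (auto simp: is_walk_def)
      then have "l ! 0 = v" by (metis hd_conv_nth length_0_conv nat.distinct(1))
      then show "(if C (l ! 0) (l ! c) \<and> last l = y then 1 else 0)
          = (\<lambda>l. if C v (hd l) \<and> last l = y then 1 else 0) (drop c l)"
        using l by (simp add: hd_drop_conv_nth)
    qed
    also have "\<dots> = (\<Sum>z\<in>U. u c v z * d z * wsum e z (\<lambda>l. if C v (hd l) \<and> last l = y then 1 else 0))"
      by (rule wsum_drop[OF v])
    also have "\<dots> = (\<Sum>z\<in>U. u c v z * d z * (if C v z then u e z y else 0))"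
    proof (intro sum.cong refl)
      fix z assume z: "z \<in> U"
      have "wsum e z (\<lambda>l. if C v (hd l) \<and> last l = y then 1 else 0)
          = wsum e z (\<lambda>l. if last l = y then (if C v z then 1 else 0) else 0)"
        by (rule wsum_cong[OF z]) (auto simp: is_walk_def)
      also have "\<dots> = (if C v z then u e z y else 0)"
        by (subst wsum_last[OF z]) simp
      finally show "u c v z * d z * wsum e z (\<lambda>l. if C v (hd l) \<and> last l = y then 1 else 0)
          = u c v z * d z * (if C v z then u e z y else 0)" by simp
    qed
    also have "\<dots> = (\<Sum>z | z \<in> U \<and> C v z. u c v z * d z * u e z y)"
      using fin by (intro sum.mono_neutral_cong_right) auto
    finally show ?thesis .
  qed
  have "wsum (a + c + e) x (\<lambda>l. if C (l ! a) (l ! (a + c)) \<and> last l = y then 1 else 0)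
      = wsum (a + (c + e)) x (\<lambda>l. (\<lambda>l. if C (l ! 0) (l ! c) \<and> last l = y then 1 else 0) (drop a l))"
    unfolding add.assoc by (rule wsum_cong[OF assms]) (auto simp: is_walk_def)
  also have "\<dots> = (\<Sum>v\<in>U. u a x v * d v * wsum (c + e) v (\<lambda>l. if C (l ! 0) (l ! c) \<and> last l = y then 1 else 0))"
    by (rule wsum_drop[OF assms])
  also have "\<dots> = (\<Sum>v\<in>U. u a x v * d v * (\<Sum>z | z \<in> U \<and> C v z. u c v z * d z * u e z y))"
    using inner by (intro sum.cong refl) simp
  finally show ?thesis .
qed

text \<open>Given the vertex just before time \<open>k\<close>, the last step hits \<open>P\<close>
  with probability at most \<open>\<tau>\<close>, whatever that vertex is. At time 0 there is no
  such step.\<close>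

lemma hitting_bound:
  assumes x: "x \<in> U" and "k \<ge> 1"
    and hit: "\<And>v. v \<in> U \<Longrightarrow> real (card {z \<in> N v. P z}) \<le> \<tau> * d v"
  shows "(\<Sum>z | z \<in> U \<and> P z. u k x z * d z) \<le> \<tau>"
proof -
  obtain j where k: "k = j + 1" using assms(2) by (metis add.commute le_Suc_ex)
  have one: "(\<Sum>z | z \<in> U \<and> P z. d v * u 1 v z * d z) \<le> \<tau> * d v" if v: "v \<in> U" for v
  proof -
    have "(\<Sum>z | z \<in> U \<and> P z. d v * u 1 v z * d z) = (\<Sum>z\<in>{z\<in>U. P z}. if z \<in> N v then 1 else 0)"
      using v by (intro sum.cong refl) (auto simp: u_1 less_imp_neq[OF d_pos, symmetric] simp del: u.simps One_nat_def)
    also have "\<dots> = (\<Sum>z\<in>{z\<in>N v. P z}. 1)"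
      using fin N_sub[OF v] by (intro sum.mono_neutral_cong_right) auto
    finally show ?thesis using hit[OF v] by simp
  qed
  have "(\<Sum>z | z \<in> U \<and> P z. u k x z * d z)
      = (\<Sum>z | z \<in> U \<and> P z. \<Sum>v\<in>U. u j x v * (d v * u 1 v z * d z))"
    unfolding k using u_add[OF x, of _ j 1]
    by (intro sum.cong refl) (simp add: sum_distrib_right mult.assoc del: u.simps)
  also have "\<dots> = (\<Sum>v\<in>U. u j x v * (\<Sum>z | z \<in> U \<and> P z. d v * u 1 v z * d z))"
    by (subst sum.swap) (simp add: sum_distrib_left del: u.simps)
  also have "\<dots> \<le> (\<Sum>v\<in>U. u j x v * (\<tau> * d v))"
    using one by (intro sum_mono mult_left_mono) auto
  also have "\<dots> = \<tau> * (\<Sum>v\<in>U. u j x v * d v)" by (simp add: sum_distrib_left mult_ac)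
  finally show ?thesis using u_total[OF x] by simp
qed

text \<open>Last segment mixed: its density is replaced by the constant \<open>B\<close>, the step
  into \<open>z\<close> costs \<open>\<tau>\<close>, and the first segment sums to 1.\<close>

lemma pair_bound_last:
  assumes x: "x \<in> U" and y: "y \<in> U" and c: "c \<ge> 1" and B: "B \<ge> 0" "\<And>z. z \<in> U \<Longrightarrow> u e z y \<le> B"
    and hit: "\<And>v w. v \<in> U \<Longrightarrow> w \<in> U \<Longrightarrow> real (card {z \<in> N v. C w z}) \<le> \<tau> * d v"
  shows "(\<Sum>v\<in>U. u a x v * d v * (\<Sum>z | z \<in> U \<and> C v z. u c v z * d z * u e z y)) \<le> B * \<tau>"
proof -
  have "(\<Sum>z | z \<in> U \<and> C v z. u c v z * d z * u e z y) \<le> B * \<tau>" if v: "v \<in> U" for v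
  proof -
    have "(\<Sum>z | z \<in> U \<and> C v z. u c v z * d z * u e z y) \<le> (\<Sum>z | z \<in> U \<and> C v z. u c v z * d z * B)"
      using B by (intro sum_mono mult_left_mono) auto
    also have "\<dots> = B * (\<Sum>z | z \<in> U \<and> C v z. u c v z * d z)" by (simp add: sum_distrib_left mult_ac)
    also have "\<dots> \<le> B * \<tau>" using B hit v c by (intro mult_left_mono hitting_bound) auto
    finally show ?thesis .
  qed
  then have "(\<Sum>v\<in>U. u a x v * d v * (\<Sum>z | z \<in> U \<and> C v z. u c v z * d z * u e z y))
      \<le> (\<Sum>v\<in>U. u a x v * d v * (B * \<tau>))"
    by (intro sum_mono mult_left_mono) auto
  also have "\<dots> = B * \<tau>" using u_total[OF x, of a] by (simp add: sum_distrib_right[symmetric])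
  finally show ?thesis .
qed

text \<open>Time reversal, which turns a mixed first segment into a mixed last one.\<close>

lemma pair_sum_reverse:
  assumes x: "x \<in> U" and y: "y \<in> U" and sym: "\<And>v w. C v w \<longleftrightarrow> C w v"
  shows "(\<Sum>v\<in>U. u a x v * d v * (\<Sum>z | z \<in> U \<and> C v z. u c v z * d z * u e z y))
    = (\<Sum>v\<in>U. u e y v * d v * (\<Sum>z | z \<in> U \<and> C v z. u c v z * d z * u a z x))"
proof -
  have *: "(\<Sum>v\<in>U. u a x v * d v * (\<Sum>z | z \<in> U \<and> C v z. u c v z * d z * u e z y))
      = (\<Sum>v\<in>U. \<Sum>z\<in>U. if C v z then u a x v * d v * (u c v z * d z * u e z y) else 0)" for a x e y
    unfolding sum_distrib_left
    using fin by (intro sum.cong refl sum.mono_neutral_cong_left) auto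
  show ?thesis
    unfolding * by (subst sum.swap, intro sum.cong refl)
      (use sym u_commute x y in \<open>auto simp: mult_ac\<close>)
qed

text \<open>Middle segment mixed: once its density is replaced by \<open>B\<close>, the outer
  segments decouple. For fixed \<open>v\<close>, the vertex \<open>z\<close> is then the end of a
  walk of \<open>e\<close> steps from \<open>y\<close>, whose last step meets a conflict with
  probability at most \<open>\<tau>\<close>.\<close>

lemma pair_bound_middle:
  assumes x: "x \<in> U" and y: "y \<in> U" and e: "e \<ge> 1"
    and B: "B \<ge> 0" "\<And>v z. v \<in> U \<Longrightarrow> z \<in> U \<Longrightarrow> u c v z \<le> B"
    and hit: "\<And>v w. v \<in> U \<Longrightarrow> w \<in> U \<Longrightarrow> real (card {z \<in> N v. C w z}) \<le> \<tau> * d v"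
  shows "(\<Sum>v\<in>U. u a x v * d v * (\<Sum>z | z \<in> U \<and> C v z. u c v z * d z * u e z y)) \<le> B * \<tau>"
proof -
  have "(\<Sum>z | z \<in> U \<and> C v z. u c v z * d z * u e z y) \<le> B * \<tau>" if v: "v \<in> U" for v
  proof -
    have "(\<Sum>z | z \<in> U \<and> C v z. u c v z * d z * u e z y) \<le> (\<Sum>z | z \<in> U \<and> C v z. B * d z * u e z y)"
      using B v by (intro sum_mono mult_right_mono) auto
    also have "\<dots> = B * (\<Sum>z | z \<in> U \<and> C v z. u e y z * d z)"
      unfolding sum_distrib_left by (intro sum.cong refl) (use u_commute[OF _ y] in auto)
    also have "\<dots> \<le> B * \<tau>" using B hit v y e by (intro mult_left_mono hitting_bound) auto
    finally show ?thesis .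
  qed
  then have "(\<Sum>v\<in>U. u a x v * d v * (\<Sum>z | z \<in> U \<and> C v z. u c v z * d z * u e z y))
      \<le> (\<Sum>v\<in>U. u a x v * d v * (B * \<tau>))"
    by (intro sum_mono mult_left_mono) auto
  also have "\<dots> = B * \<tau>" using u_total[OF x, of a] by (simp add: sum_distrib_right[symmetric])
  finally show ?thesis .
qed

text \<open>A conflict between the times \<open>a < a + c\<close> of a walk with \<open>a + c + e\<close> steps leaves one of the
  three segments long enough to be mixed.\<close>

lemma pair_bound:
  assumes x: "x \<in> U" and y: "y \<in> U" and c: "c \<ge> 1" and ae: "a \<ge> 1 \<or> e \<ge> 1"
    and len: "a + c + e = 3 * T"
    and B: "B \<ge> 0" "\<And>k v z. k \<ge> T \<Longrightarrow> v \<in> U \<Longrightarrow> z \<in> U \<Longrightarrow> u k v z \<le> B"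
    and sym: "\<And>v w. C v w \<longleftrightarrow> C w v"
    and hit: "\<And>v w. v \<in> U \<Longrightarrow> w \<in> U \<Longrightarrow> real (card {z \<in> N v. C w z}) \<le> \<tau> * d v"
  shows "wsum (3 * T) x (\<lambda>l. if C (l ! a) (l ! (a + c)) \<and> last l = y then 1 else 0) \<le> B * \<tau>"
proof -
  have "e \<ge> T \<or> a \<ge> T \<or> c \<ge> T" using len by linarith
  moreover have "(\<Sum>v\<in>U. u a x v * d v * (\<Sum>z | z \<in> U \<and> C v z. u c v z * d z * u e z y)) \<le> B * \<tau>"
    if "e \<ge> T" using that B y by (intro pair_bound_last x y c hit) auto
  moreover have "(\<Sum>v\<in>U. u a x v * d v * (\<Sum>z | z \<in> U \<and> C v z. u c v z * d z * u e z y)) \<le> B * \<tau>"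
    if "a \<ge> T" using that B x
    by (subst pair_sum_reverse[OF x y sym], intro pair_bound_last x y c hit) auto
  moreover have "(\<Sum>v\<in>U. u a x v * d v * (\<Sum>z | z \<in> U \<and> C v z. u c v z * d z * u e z y)) \<le> B * \<tau>"
    if "c \<ge> T"
  proof (cases "e \<ge> 1")
    case True
    then show ?thesis using that B by (intro pair_bound_middle x y hit) auto
  next
    case False
    \<comment> \<open>For \<open>e = 0\<close> the later vertex is the fixed endpoint
      \<open>y\<close>; after reversal the randomness of the earlier vertex is used instead.\<close>
    then have "a \<ge> 1" using ae by simp
    then show ?thesis using that B
      by (subst pair_sum_reverse[OF x y sym], intro pair_bound_middle x y hit) auto
  qed
  ultimately show ?thesis unfolding len[symmetric] wsum_pair[OF x] by blast
qed

text \<open>A conflict predicate that ignores its first argument reduces this to a pair of times of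
  which the first is 0. Two segments remain, and one of them has length at least
  \<open>T\<close>.\<close>

lemma point_bound:
  assumes x: "x \<in> U" and y: "y \<in> U" and c: "c \<ge> 1" and e: "e \<ge> 1"
    and len: "c + e = 3 * T"
    and B: "B \<ge> 0" "\<And>k v z. k \<ge> T \<Longrightarrow> v \<in> U \<Longrightarrow> z \<in> U \<Longrightarrow> u k v z \<le> B"
    and hit: "\<And>v. v \<in> U \<Longrightarrow> real (card {z \<in> N v. P z}) \<le> \<tau> * d v"
  shows "wsum (3 * T) x (\<lambda>l. if P (l ! c) \<and> last l = y then 1 else 0) \<le> B * \<tau>"
proof -
  have "wsum (0 + c + e) x (\<lambda>l. if P (l ! (0 + c)) \<and> last l = y then 1 else 0)
    = (\<Sum>v\<in>U. u 0 x v * d v * (\<Sum>z | z \<in> U \<and> P z. u c v z * d z * u e z y))"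
    by (rule wsum_pair[OF x, where C = "\<lambda>v. P"])
  moreover have "\<dots> \<le> B * \<tau>"
  proof (cases "e \<ge> T")
    case True
    then show ?thesis using B y by (intro pair_bound_last[where C = "\<lambda>v. P"] x y c hit) auto
  next
    case False
    then have "c \<ge> T" using len by linarith
    then show ?thesis using B by (intro pair_bound_middle[where C = "\<lambda>v. P"] x y e hit) auto
  qed
  ultimately show ?thesis using len by simp
qed

text \<open>As \<open>3 * T\<close> is even and \<open>x\<close>, \<open>y\<close> lie on one side,
  the walks from \<open>x\<close> to \<open>y\<close> have total weight at least
  \<open>1 / (2 * M)\<close>. Each bad event has weight at most \<open>2 / M\<close> times its
  one-step probability, and the quotient of the two bounds is the factor 4 in the last assumption.
  There are at most \<open>(3 * T + 1)^2\<close> pairs of times, each with one-step probability at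
  most \<open>r * \<sigma>\<close>, and fewer than \<open>3 * T + 1\<close> times at which
  \<open>W\<close> could be met.\<close>

theorem connect:
  fixes g :: "'v \<Rightarrow> 'b set"
  assumes gfin: "\<And>v. v \<in> U \<Longrightarrow> finite (g v)" and gcard: "\<And>v. v \<in> U \<Longrightarrow> card (g v) \<le> r"
    and conf: "\<And>v b. v \<in> U \<Longrightarrow> real (card {w \<in> N v. b \<in> g w}) \<le> \<sigma> * d v"
    and mix: "\<And>k. k \<ge> T \<Longrightarrow> sqrt ((1 - \<phi>\<^sup>2 / 2) ^ k) \<le> 1 / (2 * M)"
    and T: "even T"
    and x: "x \<in> U" and y: "y \<in> U" and xy: "side x = side y" "g x \<inter> g y = {}"
    and W: "finite W"
    and small: "4 * ((real (3 * T + 1))\<^sup>2 * real r + real (3 * T + 1) * real (card W)) * \<sigma> < 1"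
  shows "\<exists>l. length l = 3 * T + 1 \<and> hd l = x \<and> last l = y \<and> set l \<subseteq> U \<and>
     successively (\<lambda>v w. w \<in> N v) l \<and>
     (\<forall>j<length l. \<forall>i<j. g (l ! i) \<inter> g (l ! j) = {}) \<and>
     (\<forall>i<3 * T. 0 < i \<longrightarrow> g (l ! i) \<inter> W = {})"
proof (rule ccontr)
  assume none: "\<not> ?thesis"
  define n where "n = 3 * T"
  have M1: "M \<ge> 1" by (rule M_ge1[OF x])
  define B where "B = 2 / M"
  have B0: "B \<ge> 0" using M1 by (simp add: B_def)
  have ub: "u k v z \<le> B" if "k \<ge> T" "v \<in> U" "z \<in> U" for k v z
  proof -
    have "\<bar>u k v z - (if side v = (side z = even k) then 1 / M else 0)\<bar> \<le> 1 / (2 * M)"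
      using mixing[OF that(3,2), of k] mix[OF that(1)] by linarith
    moreover have "(if side v = (side z = even k) then 1 / M else 0) \<le> 1 / M" using M1 by auto
    ultimately have "u k v z \<le> 1 / M + 1 / (2 * M)" by linarith
    also have "\<dots> \<le> B" using M1 by (simp add: B_def field_simps)
    finally show ?thesis .
  qed
  have lb: "1 / (2 * M) \<le> u n x y"
  proof -
    have "even n" "n \<ge> T" using T by (auto simp: n_def)
    then have "\<bar>u n x y - 1 / M\<bar> \<le> 1 / (2 * M)"
      using mixing[OF y x, of n] mix[of n] xy(1) by simp
    then have "u n x y \<ge> 1 / M - 1 / (2 * M)" by linarith
    also have "1 / M - 1 / (2 * M) = 1 / (2 * M)" using M1 by (simp add: field_simps)
    finally show ?thesis .
  qed
  have sig: "\<sigma> \<ge> 0"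
  proof -
    have "0 \<le> \<sigma> * d x" using conf[OF x] by (rule order_trans[rotated]) simp
    then show ?thesis using d_pos[OF x] by (simp add: zero_le_mult_iff)
  qed
  have hitS: "real (card {z \<in> N v. g z \<inter> S \<noteq> {}}) \<le> real (card S) * \<sigma> * d v"
    if v: "v \<in> U" and S: "finite S" for v S
  proof -
    have "{z \<in> N v. g z \<inter> S \<noteq> {}} = (\<Union>b\<in>S. {z \<in> N v. b \<in> g z})" by auto
    then have "real (card {z \<in> N v. g z \<inter> S \<noteq> {}}) \<le> real (\<Sum>b\<in>S. card {z \<in> N v. b \<in> g z})"
      by (simp only: of_nat_le_iff card_UN_le[OF S])
    also have "\<dots> \<le> (\<Sum>b\<in>S. \<sigma> * d v)"
      unfolding of_nat_sum by (intro sum_mono conf[OF v])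
    finally show ?thesis by (simp add: mult_ac)
  qed
  define C where "C = (\<lambda>v z. g v \<inter> g z \<noteq> {})"
  have Csym: "C v w \<longleftrightarrow> C w v" for v w by (auto simp: C_def)
  have hitC: "real (card {z \<in> N v. C w z}) \<le> (real r * \<sigma>) * d v" if "v \<in> U" "w \<in> U" for v w
  proof -
    have "real (card {z \<in> N v. C w z}) \<le> real (card (g w)) * \<sigma> * d v"
      using hitS[OF that(1) gfin[OF that(2)]] by (simp add: C_def Int_commute)
    also have "\<dots> \<le> real r * \<sigma> * d v"
      using gcard[OF that(2)] sig by (intro mult_right_mono) auto
    finally show ?thesis .
  qed
  \<comment> \<open>The pair \<open>(0, n)\<close> is left out: neither of its ends is random, and
    their sets are disjoint by assumption.\<close>
  define I where "I = {(a, b). a < b \<and> b \<le> n \<and> (a \<noteq> 0 \<or> b \<noteq> n)}"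
  have Isub: "I \<subseteq> {..n} \<times> {..n}" by (auto simp: I_def)
  then have finI: "finite I" by (rule finite_subset) auto
  have cardI: "card I \<le> (n + 1)\<^sup>2"
    using card_mono[OF _ Isub] by (simp add: power2_eq_square)
  define E1 where "E1 = (\<lambda>p l. if C (l ! fst p) (l ! snd p) \<and> last l = y then 1 else 0 :: real)"
  define E2 where "E2 = (\<lambda>i l. if g (l ! i) \<inter> W \<noteq> {} \<and> last l = y then 1 else 0 :: real)"
  have E1_0: "E1 p l \<ge> 0" and E2_0: "E2 i l \<ge> 0" for p i l by (auto simp: E1_def E2_def)
  have "u n x y = wsum n x (\<lambda>l. if last l = y then 1 else 0)"
    using wsum_last[OF x, of n y 1] by simp
  \<comment> \<open>Under the assumption to be refuted, every walk that ends in \<open>y\<close> has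
    a bad event, so the indicator of the end is dominated by the number of such events.\<close>
  also have "\<dots> \<le> wsum n x (\<lambda>l. (\<Sum>p\<in>I. E1 p l) + (\<Sum>i\<in>{1..<n}. E2 i l))"
  proof (rule wsum_mono[OF x])
    fix l assume w: "is_walk n x l"
    show "(if last l = y then 1 else 0) \<le> (\<Sum>p\<in>I. E1 p l) + (\<Sum>i\<in>{1..<n}. E2 i l)"
    proof (cases "last l = y")
      case False
      then show ?thesis using E1_0 E2_0 by (simp add: sum_nonneg add_nonneg_nonneg)
    next
      case True
      have len: "length l = n + 1" using w by (simp add: is_walk_def)
      then have "l \<noteq> []" by auto
      then have ends: "l ! 0 = x" "l ! n = y"
        using w True len hd_conv_nth[of l] last_conv_nth[of l] by (auto simp: is_walk_def)
      have "\<not> ((\<forall>j<length l. \<forall>i<j. g (l ! i) \<inter> g (l ! j) = {}) \<and> (\<forall>i<n. 0 < i \<longrightarrow> g (l ! i) \<inter> W = {}))"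
        using none w True unfolding n_def is_walk_def by auto
      then consider (pair) a b where "a < b" "b \<le> n" "C (l ! a) (l ! b)"
        | (pt) i where "0 < i" "i < n" "g (l ! i) \<inter> W \<noteq> {}"
        by (auto simp: C_def len less_Suc_eq_le)
      then show ?thesis
      proof cases
        case pair
        then have "(a, b) \<in> I" using ends xy(2) by (auto simp: I_def C_def)
        moreover have "E1 (a, b) l = 1" using pair True by (simp add: E1_def)
        ultimately have "1 \<le> (\<Sum>p\<in>I. E1 p l)"
          using member_le_sum[of "(a, b)" I "\<lambda>p. E1 p l"] finI E1_0 by simp
        moreover have "0 \<le> (\<Sum>i\<in>{1..<n}. E2 i l)" using E2_0 by (simp add: sum_nonneg)
        ultimately show ?thesis using True by simp
      next
        case pt
        then have "1 \<le> (\<Sum>i\<in>{1..<n}. E2 i l)"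
          using member_le_sum[of i "{1..<n}" "\<lambda>i. E2 i l"] E2_0 True by (simp add: E2_def)
        moreover have "0 \<le> (\<Sum>p\<in>I. E1 p l)" using E1_0 by (simp add: sum_nonneg)
        ultimately show ?thesis using True by simp
      qed
    qed
  qed
  also have "\<dots> = (\<Sum>p\<in>I. wsum n x (E1 p)) + (\<Sum>i\<in>{1..<n}. wsum n x (E2 i))"
    by (simp add: wsum_add wsum_sum)
  also have "\<dots> \<le> (\<Sum>p\<in>I. B * (real r * \<sigma>)) + (\<Sum>i\<in>{1..<n}. B * (real (card W) * \<sigma>))"
  proof (intro add_mono sum_mono)
    fix p assume p: "p \<in> I"
    obtain a b where ab: "p = (a, b)" "a < b" "b \<le> n" "a \<noteq> 0 \<or> b \<noteq> n"
      using p by (auto simp: I_def)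
    show "wsum n x (E1 p) \<le> B * (real r * \<sigma>)"
    proof -
      have "b - a \<ge> 1" "a \<ge> 1 \<or> n - b \<ge> 1" "a + (b - a) + (n - b) = 3 * T"
        using ab by (auto simp: n_def)
      from pair_bound[OF x y this B0 ub Csym hitC] ab show ?thesis
        unfolding E1_def n_def by simp
    qed
  next
    fix i assume i: "i \<in> {1..<n}"
    show "wsum n x (E2 i) \<le> B * (real (card W) * \<sigma>)"
    proof -
      have "i \<ge> 1" "n - i \<ge> 1" "i + (n - i) = 3 * T" using i by (auto simp: n_def)
      from point_bound[OF x y this B0 ub hitS[OF _ W]] show ?thesis
        unfolding E2_def n_def by simp
    qed
  qed
  also have "\<dots> = B * \<sigma> * (real (card I) * real r + real (n - 1) * real (card W))"
    by (simp add: algebra_simps)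
  also have "\<dots> \<le> B * \<sigma> * ((real (n + 1))\<^sup>2 * real r + real (n + 1) * real (card W))"
  proof (intro mult_left_mono add_mono mult_right_mono)
    show "real (card I) \<le> (real (n + 1))\<^sup>2" using cardI by (metis of_nat_le_iff of_nat_power)
  qed (use B0 sig in auto)
  also have "\<dots> = (4 * ((real (3 * T + 1))\<^sup>2 * real r + real (3 * T + 1) * real (card W)) * \<sigma>) / (2 * M)"
    unfolding B_def n_def using M1 by (simp add: field_simps)
  also have "\<dots> < 1 / (2 * M)" using small M1 by (intro divide_strict_right_mono) auto
  finally show False using lb by simp
qed

end

section \<open>Extraction of an expander\<close>

text \<open>The smaller part is at most half of the sum, so its binary logarithm grows by at least 1
  on passing to the sum; this is the surplus.\<close>

lemma entropy_superadditive:
  fixes a b :: real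
  assumes "a > 0" "b > 0" "\<beta> \<ge> 0"
  shows "a * (\<gamma> + \<beta> * log 2 a) + b * (\<gamma> + \<beta> * log 2 b) + \<beta> * min a b
    \<le> (a + b) * (\<gamma> + \<beta> * log 2 (a + b))"
proof -
  have key: "min a b \<le> a * (log 2 (a + b) - log 2 a) + b * (log 2 (a + b) - log 2 b)"
    if "a > 0" "b > 0" "a \<le> b" for a b :: real
  proof -
    have "log 2 (2 * a) \<le> log 2 (a + b)" using that by simp
    then have "1 \<le> log 2 (a + b) - log 2 a" using that by (simp add: log_mult)
    then have "a * 1 \<le> a * (log 2 (a + b) - log 2 a)" using that by (intro mult_left_mono) auto
    moreover have "0 \<le> b * (log 2 (a + b) - log 2 b)" using that by simp
    ultimately show ?thesis using that(3) by linarith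
  qed
  have "min a b \<le> a * (log 2 (a + b) - log 2 a) + b * (log 2 (a + b) - log 2 b)"
    using key[of a b] key[of b a] assms by (cases "a \<le> b") (auto simp: add.commute min.commute)
  then have "\<beta> * min a b \<le> \<beta> * (a * (log 2 (a + b) - log 2 a) + b * (log 2 (a + b) - log 2 b))"
    using assms by (intro mult_left_mono) auto
  then show ?thesis by (simp add: algebra_simps)
qed

text \<open>A nonempty set that is minimal with \<open>e \<ge> \<mu> (\<gamma> + \<beta> log \<mu>)\<close> expands, because the right-hand side
  is superadditive with a surplus.\<close>

lemma expander_extraction:
  fixes N :: "'v \<Rightarrow> 'v set" and \<mu> :: "'v \<Rightarrow> real"
  assumes fin: "finite V" and "V \<noteq> {}"
    and N_sub: "\<And>x. x \<in> V \<Longrightarrow> N x \<subseteq> V" and N_irrefl: "\<And>x. x \<in> V \<Longrightarrow> x \<notin> N x"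
    and N_sym: "\<And>x y. x \<in> V \<Longrightarrow> y \<in> N x \<Longrightarrow> x \<in> N y"
    and mu: "\<And>x. x \<in> V \<Longrightarrow> \<mu> x \<ge> 1" and gam: "\<gamma> > 0" and bet: "\<beta> \<ge> 0"
    and dense: "sum \<mu> V * (\<gamma> + \<beta> * log 2 (sum \<mu> V)) \<le> (\<Sum>x\<in>V. real (card (N x)))"
  obtains U where "U \<subseteq> V" "U \<noteq> {}" "\<And>v. v \<in> U \<Longrightarrow> \<gamma> * \<mu> v \<le> 2 * real (card (N v \<inter> U))"
    "\<And>S. S \<subseteq> U \<Longrightarrow> \<beta> * min (sum \<mu> S) (sum \<mu> (U - S)) \<le> 2 * (\<Sum>x\<in>S. real (card (N x \<inter> U - S)))"
proof -
  define e where "e = (\<lambda>S T. \<Sum>x\<in>S. real (card (N x \<inter> T)))"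
  define h where "h = (\<lambda>S. sum \<mu> S * (\<gamma> + \<beta> * log 2 (sum \<mu> S)))"
  define good where "good = (\<lambda>U. U \<subseteq> V \<and> U \<noteq> {} \<and> h U \<le> e U U)"
  have mu0: "\<mu> x \<ge> 0" if "x \<in> V" for x using mu[OF that] by simp
  have mu1: "sum \<mu> S \<ge> 1" if S: "S \<subseteq> V" "S \<noteq> {}" for S
  proof -
    obtain x where "x \<in> S" using S by blast
    then have "\<mu> x \<le> sum \<mu> S"
      using S finite_subset[OF S(1) fin] by (intro member_le_sum mu0) auto
    then show ?thesis using mu[of x] \<open>x \<in> S\<close> S by auto
  qed
  have "good V" unfolding good_def h_def e_def
    using assms(2) dense N_sub by (auto simp: Int_absorb2 cong: sum.cong)
  then obtain U where U: "good U" and min: "\<And>S. good S \<Longrightarrow> card U \<le> card S"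
    using ex_has_least_nat[of good V card] by blast
  have UV: "U \<subseteq> V" and Une: "U \<noteq> {}" and hU: "h U \<le> e U U" using U by (auto simp: good_def)
  have finU: "finite U" using UV fin finite_subset by auto
  have small: "e S S < h S" if "S \<subset> U" "S \<noteq> {}" for S
    using min[of S] that UV psubset_card_mono[OF finU that(1)] by (force simp: good_def)
  have e_indicator: "e S T = (\<Sum>x\<in>S. \<Sum>y\<in>T. if y \<in> N x then 1 else 0)" if "finite T" for S T
    unfolding e_def using that by (intro sum.cong refl) (simp add: sum.If_cases Int_commute)
  have e_sym: "e S T = e T S" if "S \<subseteq> U" "T \<subseteq> U" for S T
  proof -
    have "finite S" "finite T" using that finU finite_subset by auto
    then show ?thesis using that UV N_sym
      by (subst (1 2) e_indicator, simp, simp, subst sum.swap) (intro sum.cong refl if_cong, auto)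
  qed
  have split: "e U U = e S S + e (U - S) (U - S) + 2 * e S (U - S)" if S: "S \<subseteq> U" for S
  proof -
    have finS: "finite S" using S finU finite_subset by auto
    have Ssplit: "sum f U = sum f S + sum f (U - S)" for f :: "'v \<Rightarrow> real"
      using sum.subset_diff[OF S finU, of f] by simp
    have right: "e A U = e A S + e A (U - S)" for A
      using finU finS unfolding e_indicator[OF finU]
      by (simp add: e_indicator sum.distrib Ssplit)
    have "e U U = e S U + e (U - S) U"
      unfolding e_def by (rule Ssplit)
    then show ?thesis using right[of S] right[of "U - S"] e_sym[of "U - S" S] S by auto
  qed
  have mu_split: "sum \<mu> U = sum \<mu> S + sum \<mu> (U - S)" if "S \<subseteq> U" for S
    using sum.subset_diff[OF that finU, of \<mu>] by simp
  have hpos: "h S > 0" if "S \<subseteq> U" "S \<noteq> {}" for S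
  proof -
    have "sum \<mu> S \<ge> 1" using mu1 that UV by auto
    then show ?thesis unfolding h_def using gam bet by (intro mult_pos_pos add_pos_nonneg) auto
  qed
  \<comment> \<open>Removing \<open>v\<close> lowers \<open>h\<close> by at least
    \<open>\<gamma> * \<mu> v\<close> and the number of arcs by twice the degree of
    \<open>v\<close>. Since \<open>U - {v}\<close> is too sparse to be good, the second loss is the
    larger one.\<close>
  have deg: "\<gamma> * \<mu> v \<le> 2 * real (card (N v \<inter> U))" if v: "v \<in> U" for v
  proof -
    have vV: "v \<in> V" using v UV by auto
    have s: "e U U = e (U - {v}) (U - {v}) + 2 * real (card (N v \<inter> U))"
    proof -
      have "N v \<inter> {v} = {}" "N v \<inter> (U - {v}) = N v \<inter> U" using N_irrefl[OF vV] by auto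
      then show ?thesis using split[of "{v}"] v by (simp add: e_def)
    qed
    show ?thesis
    proof (cases "U - {v} = {}")
      case True
      \<comment> \<open>Without loops a single vertex spans no arcs, although \<open>h U\<close> is
        positive.\<close>
      then have "N v \<inter> U = {}" using v N_irrefl[OF vV] by auto
      then have "e U U = 0" using s True by (simp add: e_def)
      then show ?thesis using hU hpos[of U] Une by auto
    next
      case False
      then have 1: "e (U - {v}) (U - {v}) < h (U - {v})" using v by (intro small) auto
      have m1: "sum \<mu> (U - {v}) \<ge> 1" using mu1[of "U - {v}"] False UV by auto
      have m: "sum \<mu> U = \<mu> v + sum \<mu> (U - {v})" using mu_split[of "{v}"] v by simp
      have "log 2 (sum \<mu> (U - {v})) \<le> log 2 (sum \<mu> U)" using m m1 mu[OF vV] by simp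
      then have "\<gamma> + \<beta> * log 2 (sum \<mu> (U - {v})) \<le> \<gamma> + \<beta> * log 2 (sum \<mu> U)"
        using bet by (simp add: mult_left_mono)
      then have "h (U - {v}) \<le> sum \<mu> (U - {v}) * (\<gamma> + \<beta> * log 2 (sum \<mu> U))"
        unfolding h_def using m1 by (intro mult_left_mono) auto
      moreover have "h U = \<mu> v * (\<gamma> + \<beta> * log 2 (sum \<mu> U)) + sum \<mu> (U - {v}) * (\<gamma> + \<beta> * log 2 (sum \<mu> U))"
        unfolding h_def m by (simp add: algebra_simps)
      moreover have "\<mu> v * \<gamma> \<le> \<mu> v * (\<gamma> + \<beta> * log 2 (sum \<mu> U))"
        using mu[OF vV] m1 m bet by (intro mult_left_mono) auto
      ultimately show ?thesis using 1 s hU by (simp add: mult.commute)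
    qed
  qed
  have exp: "\<beta> * min (sum \<mu> S) (sum \<mu> (U - S)) \<le> 2 * (\<Sum>x\<in>S. real (card (N x \<inter> U - S)))" if S: "S \<subseteq> U" for S
  proof (cases "S = {} \<or> U - S = {}")
    case True
    have nn: "sum \<mu> T \<ge> 0" if "T \<subseteq> U" for T
      using that UV by (intro sum_nonneg mu0) auto
    have "sum \<mu> S \<ge> 0" "sum \<mu> (U - S) \<ge> 0" "sum \<mu> S = 0 \<or> sum \<mu> (U - S) = 0"
      using nn[of S] nn[of "U - S"] S True by (auto simp del: Diff_eq_empty_iff)
    then have "min (sum \<mu> S) (sum \<mu> (U - S)) = 0" by linarith
    then show ?thesis by (simp add: sum_nonneg)
  next
    case False
    have "e S S < h S" "e (U - S) (U - S) < h (U - S)" using S False by (auto intro!: small)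
    moreover have "h S + h (U - S) + \<beta> * min (sum \<mu> S) (sum \<mu> (U - S)) \<le> h U"
    proof -
      have "sum \<mu> S \<ge> 1" "sum \<mu> (U - S) \<ge> 1" using mu1[of S] mu1[of "U - S"] S UV False by auto
      then show ?thesis unfolding h_def mu_split[OF S] by (intro entropy_superadditive bet) auto
    qed
    moreover have "e S (U - S) = (\<Sum>x\<in>S. real (card (N x \<inter> U - S)))"
      unfolding e_def by (simp add: Int_Diff)
    ultimately show ?thesis using split[OF S] hU by linarith
  qed
  show ?thesis using that[OF UV Une] deg exp by blast
qed

text \<open>Choosing \<open>i\<close> first, as the class with the largest degree sum, and then \<open>j\<close> makes the arcs
  between the two classes a large part of the degree sums of both of them.\<close>

lemma heavy_class_pair:
  fixes D :: "'v \<Rightarrow> 'v set" and cl :: "'v \<Rightarrow> nat"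
  assumes fin: "finite X" and D_sub: "\<And>x. x \<in> X \<Longrightarrow> D x \<subseteq> X"
    and cl: "\<And>x. x \<in> X \<Longrightarrow> cl x < k"
    and k: "k > 0"
  obtains i j where "i < k" "j < k"
    "(\<Sum>x\<in>X. card (D x)) \<le> k * (\<Sum>x | x \<in> X \<and> cl x = i. card (D x))"
    "(\<Sum>x | x \<in> X \<and> cl x = i. card (D x)) \<le> k * (\<Sum>x | x \<in> X \<and> cl x = i. card {y \<in> D x. cl y = j})"
    "(\<Sum>x | x \<in> X \<and> cl x = j. card (D x)) \<le> k * (\<Sum>x | x \<in> X \<and> cl x = i. card {y \<in> D x. cl y = j})"
proof -
  define R where "R = (\<lambda>i. \<Sum>x | x \<in> X \<and> cl x = i. card (D x))"
  have total: "(\<Sum>x\<in>X. card (D x)) = (\<Sum>i<k. R i)"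
    unfolding R_def using fin cl by (intro sum.group[symmetric]) auto
  have maxex: "\<exists>i<k. \<forall>j<k. f j \<le> f i" for f :: "nat \<Rightarrow> nat"
  proof -
    have "finite (f ` {..<k})" "f ` {..<k} \<noteq> {}" using k by auto
    then have "Max (f ` {..<k}) \<in> f ` {..<k}" and "\<forall>j<k. f j \<le> Max (f ` {..<k})"
      using Max_in by auto
    then show ?thesis by (metis imageE lessThan_iff)
  qed
  have avg: "(\<Sum>j<k. f j) \<le> k * f i" if "\<forall>j<k. f j \<le> f i" for f :: "nat \<Rightarrow> nat" and i
    using sum_bounded_above[of "{..<k}" f "f i"] that by simp
  obtain i where i: "i < k" "\<forall>j<k. R j \<le> R i" using maxex[of R] by auto
  define E where "E = (\<lambda>j. \<Sum>x | x \<in> X \<and> cl x = i. card {y \<in> D x. cl y = j})"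
  have Ri: "R i = (\<Sum>j<k. E j)"
  proof -
    have "card (D x) = (\<Sum>j<k. card {y \<in> D x. cl y = j})" if x: "x \<in> X" for x
    proof -
      have "finite (D x)" using D_sub[OF x] fin finite_subset by auto
      then have "(\<Sum>j<k. \<Sum>y | y \<in> D x \<and> cl y = j. 1) = (\<Sum>y\<in>D x. 1::nat)"
        using cl D_sub[OF x] by (intro sum.group) auto
      then show ?thesis by simp
    qed
    then show ?thesis unfolding R_def E_def by (subst sum.swap) (intro sum.cong refl, auto)
  qed
  obtain j where j: "j < k" "\<forall>j'<k. E j' \<le> E j" using maxex[of E] by auto
  have "R i \<le> k * E j" using avg[OF j(2)] Ri by simp
  moreover have "R j \<le> R i" using i j by auto
  moreover have "(\<Sum>x\<in>X. card (D x)) \<le> k * R i" using avg[OF i(2)] total by simp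
  ultimately show ?thesis using that[of i j] i j unfolding R_def E_def by auto
qed

section \<open>Expanders with controlled degrees\<close>

lemma dyadic_class:
  fixes c :: nat
  assumes "c > 0"
  obtains k where "2 ^ k \<le> c" "c < 2 ^ Suc k"
proof -
  obtain k where "2 ^ k \<le> c \<and> c < 2 ^ (k + 1)" using ex_power_ivl1[of 2 c] assms by auto
  then show ?thesis using that[of k] by simp
qed

text \<open>The two degree classes may coincide, so the sides are kept apart by a Boolean tag. The
  conflict estimate rests on the last two conclusions: no vertex of \<open>U\<close> loses more than
  a factor \<open>16 * k\<close> of its degree, and its degree in \<open>D\<close> is at least the
  average divided by \<open>2 * k^2\<close>.\<close>

lemma double_cover_expander:
  fixes X :: "'v set" and D :: "'v \<Rightarrow> 'v set" and k :: nat and \<Lambda> :: real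
  assumes fin: "finite X" and Xne: "X \<noteq> {}"
    and D_sub: "\<And>x. x \<in> X \<Longrightarrow> D x \<subseteq> X" and D_ne: "\<And>x. x \<in> X \<Longrightarrow> D x \<noteq> {}"
    and D_sym: "\<And>x y. x \<in> X \<Longrightarrow> y \<in> D x \<Longrightarrow> x \<in> D y"
    and k: "\<And>x. x \<in> X \<Longrightarrow> card (D x) < 2 ^ k"
    and Lam: "\<Lambda> \<ge> 1" "log 2 (4 * real (\<Sum>x\<in>X. card (D x))) \<le> \<Lambda>"
  obtains U where "U \<subseteq> X \<times> UNIV" "U \<noteq> {}"
    "bip_net U (\<lambda>v. {w \<in> U. snd w \<noteq> snd v \<and> fst w \<in> D (fst v)}) snd (1 / (16 * real k * \<Lambda>))"
    "\<And>v. v \<in> U \<Longrightarrow> card (D (fst v)) \<le> 16 * k * card {w \<in> U. snd w \<noteq> snd v \<and> fst w \<in> D (fst v)}"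
    "\<And>v. v \<in> U \<Longrightarrow> (\<Sum>x\<in>X. card (D x)) \<le> 2 * k\<^sup>2 * card X * card (D (fst v))"
proof -
  have Dfin: "finite (D x)" if "x \<in> X" for x using D_sub[OF that] fin finite_subset by auto
  have Dpos: "card (D x) > 0" if "x \<in> X" for x using D_ne[OF that] Dfin[OF that] by (simp add: card_gt_0_iff)
  have "\<exists>c. \<forall>x\<in>X. 2 ^ c x \<le> card (D x) \<and> card (D x) < 2 ^ Suc (c x)"
    by (rule bchoice) (meson Dpos dyadic_class)
  then obtain cl where cl: "\<And>x. x \<in> X \<Longrightarrow> 2 ^ cl x \<le> card (D x)"
    "\<And>x. x \<in> X \<Longrightarrow> card (D x) < 2 ^ Suc (cl x)" by blast
  have cl_k: "cl x < k" if x: "x \<in> X" for x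
  proof -
    have "(2::nat) ^ cl x < 2 ^ k" using cl(1)[OF x] k[OF x] by linarith
    then show ?thesis by simp
  qed
  then have kpos: "k > 0" using Xne by auto
  obtain i j where ij: "i < k" "j < k"
    "(\<Sum>x\<in>X. card (D x)) \<le> k * (\<Sum>x | x \<in> X \<and> cl x = i. card (D x))"
    "(\<Sum>x | x \<in> X \<and> cl x = i. card (D x)) \<le> k * (\<Sum>x | x \<in> X \<and> cl x = i. card {y \<in> D x. cl y = j})"
    "(\<Sum>x | x \<in> X \<and> cl x = j. card (D x)) \<le> k * (\<Sum>x | x \<in> X \<and> cl x = i. card {y \<in> D x. cl y = j})"
    by (rule heavy_class_pair[of X D cl k]) (use fin D_sub cl_k kpos in auto)
  define tot where "tot = (\<Sum>x\<in>X. card (D x))"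
  define cls where "cls = (\<lambda>b. if b then j else i)"
  define Xc where "Xc = (\<lambda>b. {x \<in> X. cl x = cls b})"
  define R where "R = (\<lambda>b. \<Sum>x\<in>Xc b. card (D x))"
  define E where "E = (\<lambda>b. \<Sum>x\<in>Xc b. card {y \<in> D x. cl y = cls (\<not> b)})"
  have finXc: "finite (Xc b)" for b using fin by (simp add: Xc_def)
  have XcX: "Xc b \<subseteq> X" for b by (auto simp: Xc_def)
  have "E b = (\<Sum>x\<in>Xc b. \<Sum>y\<in>Xc (\<not> b). if y \<in> D x then 1 else 0)" for b
  proof -
    have "{y \<in> D x. cl y = cls (\<not> b)} = {y \<in> Xc (\<not> b). y \<in> D x}" if "x \<in> Xc b" for x
      using that D_sub by (auto simp: Xc_def)
    then show ?thesis unfolding E_def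
      using finXc by (intro sum.cong refl) (auto simp: sum.If_cases Int_def)
  qed
  note E_eq = this
  have Esym: "E True = E False"
  proof -
    have "y \<in> D x \<longleftrightarrow> x \<in> D y" if "x \<in> Xc b" "y \<in> Xc c" for x y b c
      using that XcX D_sym by blast
    then show ?thesis unfolding E_eq by (subst sum.swap) (auto intro!: sum.cong)
  qed
  have ER: "E b \<le> R b" for b
    unfolding E_def R_def by (intro sum_mono card_mono) (use Dfin XcX in auto)
  have R_E: "R b \<le> k * E False" for b
    using ij(4,5) by (cases b) (auto simp: R_def E_def Xc_def cls_def)
  \<comment> \<open>The class \<open>j\<close> also carries a \<open>1 / k^2\<close> share of all
    degrees, because the arcs between the two classes can be counted from either side.\<close>
  have tot_R: "tot \<le> k\<^sup>2 * R b" for b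
  proof -
    have "tot \<le> k * R False" using ij(3) by (simp add: tot_def R_def Xc_def cls_def)
    also have "R False \<le> k * E False" by (rule R_E)
    also have "E False = E b" using Esym by (cases b) auto
    also have "E b \<le> R b" by (rule ER)
    finally show ?thesis by (simp add: power2_eq_square mult.assoc)
  qed
  have R_tot: "R b \<le> tot" for b
    unfolding R_def tot_def using fin XcX by (intro sum_mono2) auto
  define V where "V = Sigma UNIV (\<lambda>b. Xc b)"
  define V' where "V' = {v. fst v \<in> Xc (snd v)}"
  have V'_eq: "V' = (\<lambda>(b, x). (x, b)) ` V" by (force simp: V_def V'_def)
  have finV': "finite V'" unfolding V'_eq V_def using finXc by auto
  have sumV': "(\<Sum>v\<in>V'. f v) = (\<Sum>x\<in>Xc False. f (x, False)) + (\<Sum>x\<in>Xc True. f (x, True))"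
    for f :: "'v \<times> bool \<Rightarrow> real"
  proof -
    have "(\<Sum>v\<in>V'. f v) = (\<Sum>(b, x)\<in>V. f (x, b))"
      unfolding V'_eq by (subst sum.reindex) (auto simp: inj_on_def case_prod_beta)
    also have "\<dots> = (\<Sum>b\<in>UNIV. \<Sum>x\<in>Xc b. f (x, b))"
      unfolding V_def using finXc by (subst sum.Sigma) auto
    finally show ?thesis by (simp add: UNIV_bool)
  qed
  define N0 where "N0 = (\<lambda>v. {w \<in> V'. snd w \<noteq> snd v \<and> fst w \<in> D (fst v)})"
  \<comment> \<open>The weight is the upper end of the dyadic class. It dominates the degree, so
    volumes are at most weights, and it is at most twice the degree, which bounds the total
    weight.\<close>
  define \<mu> where "\<mu> = (\<lambda>v :: 'v \<times> bool. 2 ^ Suc (cl (fst v)) :: real)"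
  have N0_card: "card (N0 (x, b)) = card {y \<in> D x. cl y = cls (\<not> b)}" if "x \<in> Xc b" for x b
  proof -
    have "N0 (x, b) = (\<lambda>y. (y, \<not> b)) ` {y \<in> D x. cl y = cls (\<not> b)}"
      using that D_sub XcX by (force simp: N0_def V'_def Xc_def)
    then show ?thesis by (simp add: card_image inj_on_def)
  qed
  have N0_sum: "(\<Sum>v\<in>V'. real (card (N0 v))) = 2 * real (E False)"
  proof -
    have "(\<Sum>x\<in>Xc b. real (card (N0 (x, b)))) = real (E b)" for b
      unfolding E_def of_nat_sum using N0_card by (intro sum.cong refl) simp
    then show ?thesis unfolding sumV' by (simp add: Esym)
  qed
  have mu_sum: "(\<Sum>v\<in>V'. \<mu> v) \<le> 2 * real (R False) + 2 * real (R True)"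
  proof -
    have "(\<Sum>x\<in>Xc b. \<mu> (x, b)) \<le> 2 * real (R b)" for b
      unfolding R_def of_nat_sum sum_distrib_left
    proof (intro sum_mono)
      fix x assume "x \<in> Xc b"
      then have "2 ^ cl x \<le> card (D x)" using cl(1) XcX by auto
      then have "real (2 ^ cl x) \<le> real (card (D x))" by (simp only: of_nat_le_iff)
      then show "\<mu> (x, b) \<le> 2 * real (card (D x))" by (simp add: \<mu>_def)
    qed
    from this[of False] this[of True] show ?thesis unfolding sumV' by simp
  qed
  have tot_pos: "tot > 0" unfolding tot_def using Dpos fin Xne by (intro sum_pos) auto
  have Epos: "E False > 0"
  proof (rule ccontr)
    assume "\<not> ?thesis"
    then have "R True = 0" using R_E[of True] by simp
    then show False using tot_R[of True] tot_pos by simp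
  qed
  have V'ne: "V' \<noteq> {}"
  proof
    assume "V' = {}"
    then have "E False = 0" using N0_sum by simp
    then show False using Epos by simp
  qed
  have mu1: "\<mu> v \<ge> 1" for v by (simp add: \<mu>_def del: power_Suc)
  have muV1: "sum \<mu> V' \<ge> 1"
  proof -
    obtain v where "v \<in> V'" using V'ne by auto
    then have "\<mu> v \<le> sum \<mu> V'" using finV' by (intro member_le_sum) (auto simp: \<mu>_def)
    then show ?thesis using mu1[of v] by simp
  qed
  \<comment> \<open>\<open>\<Lambda>\<close> bounds the logarithm of the total weight, so this
    \<beta> keeps the entropy term below \<gamma>. The total weight is at most \<open>4 k E\<close>
    with \<open>E = E False\<close>, so a density of \<open>2 \<gamma>\<close> demands at most
    \<open>E\<close> arcs, and \<open>2 E\<close> are available.\<close>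
  define \<gamma> where "\<gamma> = 1 / (8 * real k)"
  define \<beta> where "\<beta> = 1 / (8 * real k * \<Lambda>)"
  have gam: "\<gamma> > 0" and bet: "\<beta> \<ge> 0" using kpos Lam by (auto simp: \<gamma>_def \<beta>_def)
  have dense: "sum \<mu> V' * (\<gamma> + \<beta> * log 2 (sum \<mu> V')) \<le> (\<Sum>v\<in>V'. real (card (N0 v)))"
  proof -
    have "sum \<mu> V' \<le> 4 * real tot" using mu_sum R_tot[of False] R_tot[of True] by simp
    then have "log 2 (sum \<mu> V') \<le> log 2 (4 * real tot)" using muV1 tot_pos by simp
    then have "log 2 (sum \<mu> V') \<le> \<Lambda>" using Lam(2) by (simp add: tot_def)
    then have "\<beta> * log 2 (sum \<mu> V') \<le> \<beta> * \<Lambda>" using bet by (intro mult_left_mono)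
    also have "\<beta> * \<Lambda> = \<gamma>" using Lam by (simp add: \<beta>_def \<gamma>_def)
    finally have "\<gamma> + \<beta> * log 2 (sum \<mu> V') \<le> 2 * \<gamma>" by simp
    then have "sum \<mu> V' * (\<gamma> + \<beta> * log 2 (sum \<mu> V')) \<le> sum \<mu> V' * (2 * \<gamma>)"
      using muV1 by (intro mult_left_mono) auto
    also have "sum \<mu> V' \<le> 4 * (real k * real (E False))"
    proof -
      have "real (R b) \<le> real k * real (E False)" for b
        using R_E[of b] by (metis of_nat_le_iff of_nat_mult)
      from this[of False] this[of True] show ?thesis using mu_sum by simp
    qed
    then have "sum \<mu> V' * (2 * \<gamma>) \<le> 4 * (real k * real (E False)) * (2 * \<gamma>)"
      using gam by (intro mult_right_mono) auto
    also have "\<dots> = real (E False)" using kpos by (simp add: \<gamma>_def)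
    also have "\<dots> \<le> (\<Sum>v\<in>V'. real (card (N0 v)))" using N0_sum by simp
    finally show ?thesis .
  qed
  have N0_sym: "x \<in> N0 y" if "x \<in> V'" "y \<in> N0 x" for x y
    using that D_sym[of "fst x" "fst y"] XcX by (auto simp: N0_def V'_def Xc_def)
  obtain U where U: "U \<subseteq> V'" "U \<noteq> {}" "\<And>v. v \<in> U \<Longrightarrow> \<gamma> * \<mu> v \<le> 2 * real (card (N0 v \<inter> U))"
    "\<And>S. S \<subseteq> U \<Longrightarrow> \<beta> * min (sum \<mu> S) (sum \<mu> (U - S)) \<le> 2 * (\<Sum>x\<in>S. real (card (N0 x \<inter> U - S)))"
    by (rule expander_extraction[of V' N0 \<mu> \<gamma> \<beta>])
      (use finV' V'ne N0_sym mu1 gam bet dense in \<open>auto simp: N0_def\<close>)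
  define N where "N = (\<lambda>v. {w \<in> U. snd w \<noteq> snd v \<and> fst w \<in> D (fst v)})"
  have N_eq: "N v = N0 v \<inter> U" for v using U(1) by (auto simp: N_def N0_def)
  have finU: "finite U" using U(1) finV' finite_subset by auto
  have UX: "fst v \<in> X" if "v \<in> U" for v using that U(1) XcX by (auto simp: V'_def)
  have card_mu: "real (card (D (fst v))) \<le> \<mu> v" if "v \<in> U" for v
  proof -
    have "card (D (fst v)) \<le> 2 ^ Suc (cl (fst v))" using cl(2)[OF UX[OF that]] by (rule less_imp_le)
    then have "real (card (D (fst v))) \<le> real (2 ^ Suc (cl (fst v)))" by (simp only: of_nat_le_iff)
    then show ?thesis by (simp add: \<mu>_def)
  qed
  have deg: "real (card (D (fst v))) \<le> 16 * real k * real (card (N v))" if v: "v \<in> U" for v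
  proof -
    have "real (card (D (fst v))) \<le> \<mu> v" by (rule card_mu[OF v])
    also have "\<dots> = 8 * real k * (\<gamma> * \<mu> v)" using kpos by (simp add: \<gamma>_def)
    also have "\<dots> \<le> 8 * real k * (2 * real (card (N v)))"
      using U(3)[OF v] by (intro mult_left_mono) (auto simp: N_eq)
    finally show ?thesis by simp
  qed
  have sn: "sym_net U N"
  proof
    show "finite U" by (rule finU)
    show "N x \<subseteq> U" for x by (auto simp: N_def)
    show "x \<in> N y" if "x \<in> U" "y \<in> N x" for x y
      using that N0_sym[of x y] U(1) by (auto simp: N_eq)
    show "N x \<noteq> {}" if "x \<in> U" for x
      using deg[OF that] Dpos[OF UX[OF that]] by auto
  qed
  interpret sym_net U N by (rule sn)
  have d_mu: "d v \<le> \<mu> v" if v: "v \<in> U" for v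
  proof -
    have "fst ` N v \<subseteq> D (fst v)" "inj_on fst (N v)" by (auto simp: N_def inj_on_def)
    then have "card (N v) \<le> card (D (fst v))"
      using Dfin[OF UX[OF v]] by (metis card_image card_mono)
    then show ?thesis using card_mu[OF v] by (simp add: d_def)
  qed
  have vol_mu: "vol S \<le> sum \<mu> S" if "S \<subseteq> U" for S
    unfolding vol_def using that d_mu by (intro sum_mono) auto
  have "bip_net U N snd (\<beta> / 2)"
  proof
    show "snd y = (\<not> snd x)" if "x \<in> U" "y \<in> N x" for x y using that by (auto simp: N_def)
    show "0 \<le> \<beta> / 2" using bet by simp
    have "1 \<le> real k * \<Lambda>" using kpos Lam(1) mult_mono[of 1 "real k" 1 \<Lambda>] by simp
    then show "\<beta> / 2 \<le> 1" by (simp add: \<beta>_def field_simps)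
    show "\<beta> / 2 * vol S \<le> cut S" if S: "S \<subseteq> U" "2 * vol S \<le> vol U" for S
    proof -
      \<comment> \<open>At most half of the volume need not mean at most half of the weight. But
        \<open>S\<close> and its complement both have weight at least \<open>vol S\<close>, which
        suffices for the minimum.\<close>
      have "vol S \<le> vol (U - S)" using S vol_Diff by simp
      then have "vol S \<le> min (sum \<mu> S) (sum \<mu> (U - S))" using vol_mu[of S] vol_mu[of "U - S"] S by simp
      then have "\<beta> * vol S \<le> \<beta> * min (sum \<mu> S) (sum \<mu> (U - S))" using bet by (intro mult_left_mono)
      also have "\<dots> \<le> 2 * cut S" using U(4)[OF S(1)] by (simp add: cut_def N_eq)
      finally show ?thesis by simp
    qed
  qed
  moreover have "\<beta> / 2 = 1 / (16 * real k * \<Lambda>)" by (simp add: \<beta>_def)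
  ultimately have bn: "bip_net U N snd (1 / (16 * real k * \<Lambda>))" by simp
  have tot_D: "tot \<le> 2 * k\<^sup>2 * card X * card (D (fst v))" if v: "v \<in> U" for v
  proof -
    obtain x b where vb: "v = (x, b)" by (cases v)
    then have x: "x \<in> Xc b" using v U(1) by (auto simp: V'_def)
    \<comment> \<open>Degrees within one class differ by a factor of less than 2, so
      \<open>R b\<close> can be compared with the single degree \<open>card (D x)\<close>.\<close>
    have "R b \<le> (\<Sum>y\<in>Xc b. 2 * card (D x))"
      unfolding R_def
    proof (intro sum_mono)
      fix y assume y: "y \<in> Xc b"
      have "card (D y) < 2 ^ Suc (cl y)" using cl(2) y XcX by auto
      also have "cl y = cl x" using x y by (simp add: Xc_def)
      also have "2 ^ Suc (cl x) \<le> 2 * card (D x)" using cl(1)[of x] x XcX by auto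
      finally show "card (D y) \<le> 2 * card (D x)" by simp
    qed
    also have "\<dots> = card (Xc b) * (2 * card (D x))" by simp
    also have "\<dots> \<le> card X * (2 * card (D x))"
      using XcX assms(1) by (intro mult_right_mono card_mono) auto
    finally have "R b \<le> card X * (2 * card (D x))" .
    then have "k\<^sup>2 * R b \<le> k\<^sup>2 * (card X * (2 * card (D x)))" by (rule mult_left_mono) simp
    then have "tot \<le> k\<^sup>2 * (card X * (2 * card (D x)))" using tot_R[of b] by (rule order_trans[rotated])
    then show ?thesis by (simp add: vb mult_ac)
  qed
  have deg': "card (D (fst v)) \<le> 16 * k * card (N v)" if v: "v \<in> U" for v
  proof -
    have "real (card (D (fst v))) \<le> real (16 * k * card (N v))" using deg[OF v] by simp
    then show ?thesis by (simp only: of_nat_le_iff)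
  qed
  have UX': "U \<subseteq> X \<times> UNIV" using UX by (auto simp: mem_Times_iff)
  show ?thesis
    by (rule that[OF UX' U(2)]) (use bn deg' tot_D in \<open>auto simp: N_def tot_def\<close>)
qed

section \<open>Subdivisions from conflict-free walks\<close>

lemma internal_verts_nth:
  assumes "length l = n + 1" "v \<in> internal_verts l"
  obtains i where "0 < i" "i < n" "v = l ! i"
proof -
  obtain k where "k < length (butlast (tl l))" "v = butlast (tl l) ! k"
    using assms(2) unfolding internal_verts_def by (metis in_set_conv_nth)
  then have "Suc k < n" "v = l ! Suc k" using assms(1) by (auto simp: nth_butlast nth_tl)
  then show ?thesis using that by blast
qed

lemma set_eq_ends_internal:
  assumes "length l \<ge> 2"
  shows "set l = {hd l, last l} \<union> internal_verts l"
proof -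
  from assms obtain a l' where l: "l = a # l'" "l' \<noteq> []" by (cases l) fastforce+
  then have "set l' = insert (last l') (set (butlast l'))"
    by (metis append_butlast_last_id list.set(1) list.set(2) set_append Un_insert_right Un_empty_right)
  then show ?thesis using l by (auto simp: internal_verts_def)
qed

lemma path_edges_successively:
  assumes "successively R l" "e \<in> path_edges l"
  obtains v w where "e = {v, w}" "v \<in> set l" "w \<in> set l" "R v w"
proof -
  obtain i where i: "e = {l ! i, l ! Suc i}" "Suc i < length l"
    using assms(2) by (auto simp: path_edges_def)
  then have "R (l ! i) (l ! Suc i)" using assms(1) by (simp add: successively_conv_nth)
  then show ?thesis using that[of "l ! i" "l ! Suc i"] i by auto
qed

context bip_net
begin

text \<open>Greedy choice: the sets chosen so far have at most \<open>m * r\<close> elements, each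
  of which excludes at most a \<open>\<sigma>\<close> fraction of the neighbours of
  \<open>v\<close>. Taking all branch vertices next to one vertex puts them on the same side, as
  \<open>connect\<close> requires.\<close>

lemma exists_disjoint_neighbours:
  fixes g :: "'v \<Rightarrow> 'b set"
  assumes gfin: "\<And>v. v \<in> U \<Longrightarrow> finite (g v)" and gcard: "\<And>v. v \<in> U \<Longrightarrow> card (g v) \<le> r"
    and conf: "\<And>v b. v \<in> U \<Longrightarrow> real (card {w \<in> N v. b \<in> g w}) \<le> \<sigma> * d v"
    and v: "v \<in> U" and small: "real (m * r) * \<sigma> < 1" and sig: "\<sigma> \<ge> 0"
  shows "\<exists>b. (\<forall>i<m. b i \<in> N v) \<and> (\<forall>j<m. \<forall>i<j. g (b i) \<inter> g (b j) = {})"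
  using small
proof (induction m)
  case 0
  then show ?case by simp
next
  case (Suc m)
  have "real (m * r) * \<sigma> \<le> real (Suc m * r) * \<sigma>"
    using sig by (intro mult_right_mono) auto
  then have "real (m * r) * \<sigma> < 1" using Suc.prems by linarith
  then obtain b where b: "\<And>i. i < m \<Longrightarrow> b i \<in> N v" "\<And>i j. i < j \<Longrightarrow> j < m \<Longrightarrow> g (b i) \<inter> g (b j) = {}"
    using Suc.IH by blast
  define S where "S = (\<Union>i<m. g (b i))"
  have bU: "b i \<in> U" if "i < m" for i using b(1)[OF that] N_sub[OF v] by auto
  have finS: "finite S" unfolding S_def using gfin bU by auto
  have "card S \<le> (\<Sum>i<m. card (g (b i)))" unfolding S_def by (rule card_UN_le) simp
  also have "\<dots> \<le> (\<Sum>i<m. r)" using gcard bU by (intro sum_mono) auto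
  finally have cS: "card S \<le> m * r" by simp
  have "{w \<in> N v. g w \<inter> S \<noteq> {}} = (\<Union>a\<in>S. {w \<in> N v. a \<in> g w})" by auto
  then have "real (card {w \<in> N v. g w \<inter> S \<noteq> {}}) \<le> real (\<Sum>a\<in>S. card {w \<in> N v. a \<in> g w})"
    by (simp only: of_nat_le_iff card_UN_le[OF finS])
  also have "\<dots> \<le> (\<Sum>a\<in>S. \<sigma> * d v)"
    unfolding of_nat_sum by (intro sum_mono conf[OF v])
  also have "\<dots> = real (card S) * \<sigma> * d v" by simp
  also have "\<dots> \<le> real (Suc m * r) * \<sigma> * d v"
  proof (intro mult_right_mono sig)
    have "card S \<le> Suc m * r" using cS by simp
    then show "real (card S) \<le> real (Suc m * r)" by (simp only: of_nat_le_iff)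
  qed simp
  also have "\<dots> < 1 * d v" using Suc.prems d_pos[OF v] by (intro mult_strict_right_mono)
  finally have "{w \<in> N v. g w \<inter> S \<noteq> {}} \<noteq> N v" by (auto simp: d_def)
  then obtain w where w: "w \<in> N v" "g w \<inter> S = {}" by auto
  define b' where "b' = b(m := w)"
  have "b' i \<in> N v" if "i < Suc m" for i
    using that b(1)[of i] w by (auto simp: b'_def less_Suc_eq)
  moreover have "g (b' i) \<inter> g (b' j) = {}" if "i < j" "j < Suc m" for i j
    using that b(2)[of i j] w by (auto simp: b'_def S_def less_Suc_eq)
  ultimately show ?case by blast
qed

text \<open>The assumption \<open>small\<close> is that of \<open>connect\<close> for the largest
  set to be avoided: at most \<open>m * r\<close> elements in the branch sets, and at most
  \<open>m^2\<close> earlier paths with \<open>3 * T + 1\<close> sets of size at most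
  \<open>r\<close> each.\<close>

theorem find_subdivision:
  fixes g :: "'v \<Rightarrow> 'b set"
  assumes Une: "U \<noteq> {}"
    and gfin: "\<And>v. v \<in> U \<Longrightarrow> finite (g v)" and gcard: "\<And>v. v \<in> U \<Longrightarrow> card (g v) \<le> r"
    and gne: "\<And>v. v \<in> U \<Longrightarrow> g v \<noteq> {}"
    and conf: "\<And>v b. v \<in> U \<Longrightarrow> real (card {w \<in> N v. b \<in> g w}) \<le> \<sigma> * d v"
    and mix: "\<And>k. k \<ge> T \<Longrightarrow> sqrt ((1 - \<phi>\<^sup>2 / 2) ^ k) \<le> 1 / (2 * M)"
    and T: "even T" "T > 0"
    and small: "4 * ((real (3 * T + 1))\<^sup>2 * real r + real (3 * T + 1) * real (m * r + m\<^sup>2 * (3 * T + 1) * r)) * \<sigma> < 1"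
    and t: "real (3 * T) \<le> t"
  obtains H :: "'v graph" where "is_subdivision (complete_graph m) t H" "verts H \<subseteq> U"
    "finite (verts H)"
    "\<And>v w. v \<in> verts H \<Longrightarrow> w \<in> verts H \<Longrightarrow> v \<noteq> w \<Longrightarrow> g v \<inter> g w = {}"
    "\<And>v w. {v, w} \<in> edges H \<Longrightarrow> w \<in> N v"
proof -
  define n where "n = 3 * T"
  have n2: "n \<ge> 2" using T by (auto simp: n_def)
  obtain v0 where v0: "v0 \<in> U" using Une by auto
  have sig: "\<sigma> \<ge> 0"
  proof -
    have "0 \<le> \<sigma> * d v0" using conf[OF v0] by (rule order_trans[rotated]) simp
    then show ?thesis using d_pos[OF v0] by (simp add: zero_le_mult_iff)
  qed
  have "real (m * r) * \<sigma> \<le> 4 * ((real (3 * T + 1))\<^sup>2 * real r + real (3 * T + 1) * real (m * r + m\<^sup>2 * (3 * T + 1) * r)) * \<sigma>"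
  proof (intro mult_right_mono sig)
    have "1 * real (m * r) \<le> real (3 * T + 1) * real (m * r + m\<^sup>2 * (3 * T + 1) * r)"
    proof (intro mult_mono)
      show "real (m * r) \<le> real (m * r + m\<^sup>2 * (3 * T + 1) * r)" by (simp only: of_nat_le_iff le_add1)
    qed auto
    also have "\<dots> \<le> 4 * ((real (3 * T + 1))\<^sup>2 * real r + real (3 * T + 1) * real (m * r + m\<^sup>2 * (3 * T + 1) * r))"
    proof -
      have "a \<le> 4 * (b + a)" if "0 \<le> a" "0 \<le> b" for a b :: real using that by simp
      then show ?thesis by simp
    qed
    finally show "real (m * r) \<le> 4 * ((real (3 * T + 1))\<^sup>2 * real r + real (3 * T + 1) * real (m * r + m\<^sup>2 * (3 * T + 1) * r))"
      by simp
  qed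
  then have "real (m * r) * \<sigma> < 1" using small by linarith
  then have "\<exists>b. (\<forall>i<m. b i \<in> N v0) \<and> (\<forall>j<m. \<forall>i<j. g (b i) \<inter> g (b j) = {})"
    by (intro exists_disjoint_neighbours[of g r \<sigma> v0 m] gfin gcard conf v0 sig)
  then obtain b where b0: "\<forall>i<m. b i \<in> N v0" "\<forall>j<m. \<forall>i<j. g (b i) \<inter> g (b j) = {}"
    by (elim exE conjE) (rule that)
  have bN: "b i \<in> N v0" if "i < m" for i using b0(1) that by simp
  have bdisj: "g (b i) \<inter> g (b j) = {}" if "i < j" "j < m" for i j using b0(2) that by simp
  have bU: "b i \<in> U" if "i < m" for i using bN[OF that] N_sub[OF v0] by auto
  have bside: "side (b i) = side (b j)" if "i < m" "j < m" for i j
    using side_alt[OF v0 bN[OF that(1)]] side_alt[OF v0 bN[OF that(2)]] by simp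
  have bdisj': "g (b i) \<inter> g (b j) = {}" if "i < m" "j < m" "i \<noteq> j" for i j
    using bdisj[of i j] bdisj[of j i] that by (cases i j rule: linorder_cases) auto
  \<comment> \<open>Nonempty sets \<open>g v\<close> turn disjointness into distinctness, here and
    for the paths below.\<close>
  have binj: "inj_on b {..<m}"
  proof (rule inj_onI)
    fix i j assume *: "i \<in> {..<m}" "j \<in> {..<m}" "b i = b j"
    show "i = j"
    proof (rule ccontr)
      assume "i \<noteq> j"
      then have "g (b i) \<inter> g (b j) = {}" using bdisj'[of i j] *(1,2) by simp
      then show False using *(3) gne[OF bU[of i]] *(1) by simp
    qed
  qed
  define K where "K = edges (complete_graph m)"
  have K_eq: "K = {e. e \<subseteq> {..<m} \<and> card e = 2}" by (simp add: K_def complete_graph_def)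
  have finK: "finite K" unfolding K_eq by (rule finite_subset[of _ "Pow {..<m}"]) auto
  have cardK: "card K \<le> m\<^sup>2"
  proof -
    have "K \<subseteq> (\<lambda>(i, j). {i, j}) ` ({..<m} \<times> {..<m})"
    proof
      fix e assume "e \<in> K"
      then obtain i j where "e = {i, j}" "i < m" "j < m" unfolding K_eq by (auto simp: card_2_iff)
      then show "e \<in> (\<lambda>(i, j). {i, j}) ` ({..<m} \<times> {..<m})" by force
    qed
    then have "card K \<le> card ((\<lambda>(i, j). {i, j}) ` ({..<m} \<times> {..<m}))" by (intro card_mono) auto
    also have "\<dots> \<le> card ({..<m} \<times> {..<m})" by (rule card_image_le) auto
    finally show ?thesis by (simp add: power2_eq_square)
  qed
  \<comment> \<open>The ends are recorded as an unordered pair because either direction of the path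
    may serve the edge \<open>e\<close>. Internal sets avoid all branch sets, not only the two of
    \<open>e\<close>.\<close>
  define good where "good = (\<lambda>e l. length l = n + 1 \<and> {hd l, last l} = b ` e \<and> set l \<subseteq> U \<and>
      successively (\<lambda>v w. w \<in> N v) l \<and>
      (\<forall>j<length l. \<forall>i<j. g (l ! i) \<inter> g (l ! j) = {}) \<and>
      (\<forall>v\<in>internal_verts l. \<forall>i<m. g v \<inter> g (b i) = {}))"
  have ex: "\<exists>P. (\<forall>e\<in>F. good e (P e)) \<and> (\<forall>e\<in>F. \<forall>e'\<in>F. e \<noteq> e' \<longrightarrow>
      (\<forall>v\<in>internal_verts (P e). \<forall>v'\<in>internal_verts (P e'). g v \<inter> g v' = {}))" if "F \<subseteq> K" for F
    using finite_subset[OF that finK] that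
  proof (induction F rule: finite_induct)
    case empty
    then show ?case by simp
  next
    case (insert e F)
    then have "\<exists>P. (\<forall>e\<in>F. good e (P e)) \<and> (\<forall>e\<in>F. \<forall>e'\<in>F. e \<noteq> e' \<longrightarrow>
      (\<forall>v\<in>internal_verts (P e). \<forall>v'\<in>internal_verts (P e'). g v \<inter> g v' = {}))" by simp
    then obtain P where P0: "\<forall>e\<in>F. good e (P e)" "\<forall>e\<in>F. \<forall>e'\<in>F. e \<noteq> e' \<longrightarrow>
      (\<forall>v\<in>internal_verts (P e). \<forall>v'\<in>internal_verts (P e'). g v \<inter> g v' = {})"
      by (elim exE conjE) (rule that)
    have P: "\<And>e. e \<in> F \<Longrightarrow> good e (P e)"
      "\<And>e e' v v'. e \<in> F \<Longrightarrow> e' \<in> F \<Longrightarrow> e \<noteq> e' \<Longrightarrow> v \<in> internal_verts (P e) \<Longrightarrow>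
         v' \<in> internal_verts (P e') \<Longrightarrow> g v \<inter> g v' = {}"
      using P0 by auto
    \<comment> \<open>The sets at both ends of the new walk are part of \<open>W1\<close>. This does
      no harm, since \<open>connect\<close> keeps only the interior times away from the avoided
      set.\<close>
    define W1 where "W1 = (\<Union>i<m. g (b i))"
    define W2 where "W2 = (\<Union>e\<in>F. \<Union>v\<in>set (P e). g v)"
    have PU: "set (P e) \<subseteq> U" "length (P e) = n + 1" if "e \<in> F" for e using P(1)[OF that] by (auto simp: good_def)
    have finW: "finite (W1 \<union> W2)" unfolding W1_def W2_def using insert.hyps(1) gfin bU PU by blast
    have "card W1 \<le> (\<Sum>i<m. card (g (b i)))" unfolding W1_def by (rule card_UN_le) simp
    also have "\<dots> \<le> (\<Sum>i<m. r)" using gcard bU by (intro sum_mono) auto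
    finally have cW1: "card W1 \<le> m * r" by simp
    have "card W2 \<le> (\<Sum>e\<in>F. card (\<Union>v\<in>set (P e). g v))" unfolding W2_def by (rule card_UN_le) (rule insert.hyps)
    also have "\<dots> \<le> (\<Sum>e\<in>F. (n + 1) * r)"
    proof (intro sum_mono)
      fix e assume e: "e \<in> F"
      have "card (\<Union>v\<in>set (P e). g v) \<le> (\<Sum>v\<in>set (P e). card (g v))" by (rule card_UN_le) simp
      also have "\<dots> \<le> (\<Sum>v\<in>set (P e). r)" using gcard PU[OF e] by (intro sum_mono) auto
      also have "\<dots> = card (set (P e)) * r" by simp
      also have "\<dots> \<le> (n + 1) * r"
        using card_length[of "P e"] PU[OF e] by (intro mult_right_mono) auto
      finally show "card (\<Union>v\<in>set (P e). g v) \<le> (n + 1) * r" .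
    qed
    also have "\<dots> = card F * ((n + 1) * r)" by simp
    also have "\<dots> \<le> m\<^sup>2 * ((n + 1) * r)"
      using cardK card_mono[OF finK, of F] insert.prems by (intro mult_right_mono) auto
    finally have cW2: "card W2 \<le> m\<^sup>2 * (n + 1) * r" by (simp only: mult.assoc)
    have cW: "real (card (W1 \<union> W2)) \<le> real (m * r + m\<^sup>2 * (3 * T + 1) * r)"
      using card_Un_le[of W1 W2] cW1 cW2 unfolding n_def of_nat_le_iff by linarith
    obtain i j where ij: "e = {i, j}" "i < m" "j < m" "i \<noteq> j"
      using insert.prems by (auto simp: K_eq card_2_iff)
    have small': "4 * ((real (3 * T + 1))\<^sup>2 * real r + real (3 * T + 1) * real (card (W1 \<union> W2))) * \<sigma> < 1"
    proof -
      have "4 * ((real (3 * T + 1))\<^sup>2 * real r + real (3 * T + 1) * real (card (W1 \<union> W2))) * \<sigma>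
        \<le> 4 * ((real (3 * T + 1))\<^sup>2 * real r + real (3 * T + 1) * real (m * r + m\<^sup>2 * (3 * T + 1) * r)) * \<sigma>"
        using cW sig by (intro mult_right_mono mult_left_mono add_left_mono) auto
      then show ?thesis using small by linarith
    qed
    have "\<exists>l. length l = 3 * T + 1 \<and> hd l = b i \<and> last l = b j \<and> set l \<subseteq> U \<and>
      successively (\<lambda>v w. w \<in> N v) l \<and>
      (\<forall>j<length l. \<forall>i<j. g (l ! i) \<inter> g (l ! j) = {}) \<and>
      (\<forall>i<3 * T. 0 < i \<longrightarrow> g (l ! i) \<inter> (W1 \<union> W2) = {})"
      by (intro connect[of g r \<sigma> T "b i" "b j" "W1 \<union> W2"] gfin gcard conf mix T(1)
          bU[OF ij(2)] bU[OF ij(3)] bside[OF ij(2,3)] bdisj'[OF ij(2,3,4)] finW small')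
    then obtain l where "length l = 3 * T + 1 \<and> hd l = b i \<and> last l = b j \<and> set l \<subseteq> U \<and>
      successively (\<lambda>v w. w \<in> N v) l \<and>
      (\<forall>j<length l. \<forall>i<j. g (l ! i) \<inter> g (l ! j) = {}) \<and>
      (\<forall>i<3 * T. 0 < i \<longrightarrow> g (l ! i) \<inter> (W1 \<union> W2) = {})"
      by (elim exE) (rule that)
    then have l: "length l = n + 1" "hd l = b i" "last l = b j" "set l \<subseteq> U"
      "successively (\<lambda>v w. w \<in> N v) l"
      "\<forall>j<length l. \<forall>i<j. g (l ! i) \<inter> g (l ! j) = {}"
      "\<And>i. i < n \<Longrightarrow> 0 < i \<Longrightarrow> g (l ! i) \<inter> (W1 \<union> W2) = {}"
      by (simp_all add: n_def)
    have int: "g v \<inter> (W1 \<union> W2) = {}" if "v \<in> internal_verts l" for v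
    proof -
      obtain k where "0 < k" "k < n" "v = l ! k" using internal_verts_nth[OF l(1) \<open>v \<in> internal_verts l\<close>] .
      then show ?thesis using l(7)[of k] by simp
    qed
    have gl: "good e l"
    proof -
      have "g v \<inter> g (b i') = {}" if "v \<in> internal_verts l" "i' < m" for v i'
        using int[OF that(1)] that(2) by (auto simp: W1_def)
      then show ?thesis unfolding good_def using l(1-6) ij(1) by simp
    qed
    have new: "g v \<inter> g v' = {}" if "e' \<in> F" "v \<in> internal_verts l" "v' \<in> internal_verts (P e')" for e' v v'
    proof -
      have "internal_verts (P e') \<subseteq> set (P e')"
        using set_eq_ends_internal[of "P e'"] PU[OF that(1)] n2 by auto
      then have "g v' \<subseteq> W2" using that by (auto simp: W2_def)
      then show ?thesis using int[OF that(2)] by auto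
    qed
    show ?case
    proof (intro exI[of _ "P(e := l)"] conjI ballI impI)
      fix e' assume "e' \<in> insert e F"
      then show "good e' ((P(e := l)) e')" using gl P(1) by auto
    next
      fix e1 e2 v1 v2
      assume a: "e1 \<in> insert e F" "e2 \<in> insert e F" "e1 \<noteq> e2"
        "v1 \<in> internal_verts ((P(e := l)) e1)" "v2 \<in> internal_verts ((P(e := l)) e2)"
      consider "e1 = e" "e2 \<in> F" "e2 \<noteq> e" | "e2 = e" "e1 \<in> F" "e1 \<noteq> e" | "e1 \<in> F" "e2 \<in> F" "e1 \<noteq> e" "e2 \<noteq> e"
        using a by auto
      then show "g v1 \<inter> g v2 = {}"
      proof cases
        case 1
        then show ?thesis using a new[of e2 v1 v2] by simp
      next
        case 2
        then show ?thesis using a new[of e1 v2 v1] by (simp add: Int_commute)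
      next
        case 3
        then show ?thesis using a P(2)[of e1 e2 v1 v2] by simp
      qed
    qed
  qed
  obtain P where P0: "\<forall>e\<in>K. good e (P e)" "\<forall>e\<in>K. \<forall>e'\<in>K. e \<noteq> e' \<longrightarrow>
      (\<forall>v\<in>internal_verts (P e). \<forall>v'\<in>internal_verts (P e'). g v \<inter> g v' = {})"
    using ex[OF order_refl] by (elim exE conjE) (rule that)
  have P: "\<And>e. e \<in> K \<Longrightarrow> good e (P e)"
    "\<And>e e' v v'. e \<in> K \<Longrightarrow> e' \<in> K \<Longrightarrow> e \<noteq> e' \<Longrightarrow> v \<in> internal_verts (P e) \<Longrightarrow>
       v' \<in> internal_verts (P e') \<Longrightarrow> g v \<inter> g v' = {}"
    using P0 by auto
  have len: "length (P e) = n + 1" and ends: "{hd (P e), last (P e)} = b ` e" and PU: "set (P e) \<subseteq> U"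
    and succ: "successively (\<lambda>v w. w \<in> N v) (P e)"
    and pdisj: "\<And>i j. j < length (P e) \<Longrightarrow> i < j \<Longrightarrow> g (P e ! i) \<inter> g (P e ! j) = {}"
    and pint: "\<And>v i. v \<in> internal_verts (P e) \<Longrightarrow> i < m \<Longrightarrow> g v \<inter> g (b i) = {}"
    if "e \<in> K" for e
    using P(1)[OF that] unfolding good_def by auto
  have dist: "distinct (P e)" if e: "e \<in> K" for e
  proof (rule ccontr)
    assume "\<not> distinct (P e)"
    then obtain i j where ij: "i < j" "j < length (P e)" "P e ! i = P e ! j"
      by (metis distinct_conv_nth linorder_neqE_nat)
    then have "g (P e ! j) = {}" using pdisj[OF e ij(2,1)] by simp
    moreover have "P e ! j \<in> U" using PU[OF e] ij(2) nth_mem by blast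
    ultimately show False using gne by blast
  qed
  have intsub: "internal_verts (P e) \<subseteq> U" if "e \<in> K" for e
    using set_eq_ends_internal[of "P e"] len[OF that] PU[OF that] n2 by auto
  have setP: "set (P e) = b ` e \<union> internal_verts (P e)" if "e \<in> K" for e
    using set_eq_ends_internal[of "P e"] len[OF that] ends[OF that] n2 by auto
  define H where "H = (b ` {..<m} \<union> (\<Union>e\<in>K. set (P e)), \<Union>e\<in>K. path_edges (P e))"
  have KV: "b ` e \<subseteq> b ` {..<m}" if "e \<in> K" for e using that by (auto simp: K_eq)
  have vH: "verts H = b ` {..<m} \<union> (\<Union>e\<in>K. internal_verts (P e))"
  proof -
    have "(\<Union>e\<in>K. set (P e)) = (\<Union>e\<in>K. b ` e) \<union> (\<Union>e\<in>K. internal_verts (P e))"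
      using setP by auto
    moreover have "b ` {..<m} \<union> (\<Union>e\<in>K. b ` e) = b ` {..<m}" using KV by (intro Un_absorb2 UN_least)
    ultimately show ?thesis unfolding H_def fst_conv by (simp only: Un_assoc[symmetric])
  qed
  have sub: "is_subdivision (complete_graph m) t H"
    unfolding is_subdivision_def
  proof (intro exI[of _ b] exI[of _ P] conjI ballI impI)
    show "inj_on b (verts (complete_graph m))" using binj by (simp add: complete_graph_def)
    show "verts H = b ` verts (complete_graph m) \<union> (\<Union>e\<in>edges (complete_graph m). set (P e))"
      by (simp add: H_def K_def[symmetric]) (simp add: complete_graph_def)
    show "edges H = (\<Union>e\<in>edges (complete_graph m). path_edges (P e))"
      by (simp add: H_def K_def)
  next
    fix e assume "e \<in> edges (complete_graph m)"
    then have e: "e \<in> K" by (simp add: K_def)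
    show "P e \<noteq> []" using len[OF e] by auto
    show "distinct (P e)" by (rule dist[OF e])
    show "{hd (P e), last (P e)} = b ` e" by (rule ends[OF e])
    show "internal_verts (P e) \<inter> b ` verts (complete_graph m) = {}"
    proof -
      have "b i \<notin> internal_verts (P e)" if "i < m" for i
        using pint[OF e _ that, of "b i"] gne[OF bU[OF that]] by auto
      then show ?thesis by (auto simp: complete_graph_def)
    qed
    have "card (internal_verts (P e)) \<le> length (butlast (tl (P e)))"
      unfolding internal_verts_def by (rule card_length)
    also have "\<dots> \<le> n" using len[OF e] by simp
    finally have "real (card (internal_verts (P e))) \<le> real n" by simp
    then show "real (card (internal_verts (P e))) \<le> t" using t by (simp add: n_def)
  next
    fix e e' assume "e \<in> edges (complete_graph m)" "e' \<in> edges (complete_graph m)" and ne: "e \<noteq> e'"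
    then have e: "e \<in> K" "e' \<in> K" by (auto simp: K_def)
    show "internal_verts (P e) \<inter> internal_verts (P e') = {}"
    proof (rule ccontr)
      assume "\<not> ?thesis"
      then obtain v where v: "v \<in> internal_verts (P e)" "v \<in> internal_verts (P e')" by auto
      then have "g v = {}" using P(2)[OF e ne v] by simp
      then show False using gne intsub[OF e(1)] v by auto
    qed
  qed
  have HU: "verts H \<subseteq> U" unfolding vH using bU intsub by auto
  have Hdisj: "g v \<inter> g w = {}" if vw: "v \<in> verts H" "w \<in> verts H" "v \<noteq> w" for v w
  proof -
    \<comment> \<open>Within one path the walk is free of conflicts by itself; different paths are
      disjoint because each new one avoids its predecessors.\<close>
    have int_int: "g v \<inter> g w = {}" if vw: "v \<in> internal_verts (P e)" "w \<in> internal_verts (P e')" "e \<in> K" "e' \<in> K" "v \<noteq> w" for v w e e'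
    proof (cases "e = e'")
      case False
      then show ?thesis using P(2) vw by blast
    next
      case True
      obtain i where i: "i < n" "v = P e ! i" using internal_verts_nth[OF len[OF vw(3)] vw(1)] by blast
      obtain j where j: "j < n" "w = P e ! j" using internal_verts_nth[OF len[OF vw(3)]] vw(2) True by blast
      have "i \<noteq> j" using i j vw(5) by auto
      then show ?thesis
        using pdisj[OF vw(3), of i j] pdisj[OF vw(3), of j i] i j len[OF vw(3)]
        by (cases i j rule: linorder_cases) auto
    qed
    consider (bb) i j where "i < m" "j < m" "v = b i" "w = b j"
      | (bi) i e where "i < m" "e \<in> K" "v = b i" "w \<in> internal_verts (P e)"
      | (ib) i e where "i < m" "e \<in> K" "w = b i" "v \<in> internal_verts (P e)"
      | (ii) e e' where "e \<in> K" "e' \<in> K" "v \<in> internal_verts (P e)" "w \<in> internal_verts (P e')"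
      using vw(1,2) unfolding vH by blast
    then show ?thesis
    proof cases
      case bb
      then show ?thesis using bdisj'[of i j] vw(3) by auto
    next
      case bi
      then show ?thesis using pint[of e w i] by auto
    next
      case ib
      then show ?thesis using pint[of e v i] by auto
    next
      case ii
      then show ?thesis using int_int vw(3) by blast
    qed
  qed
  have Hfin: "finite (verts H)" using HU fin finite_subset by auto
  have Hadj: "w \<in> N v" if vw: "{v, w} \<in> edges H" for v w
  proof -
    obtain e where e: "e \<in> K" "{v, w} \<in> path_edges (P e)" using vw by (auto simp: H_def)
    obtain v' w' where *: "{v, w} = {v', w'}" "v' \<in> set (P e)" "w' \<in> N v'"
      using path_edges_successively[OF succ[OF e(1)] e(2)] by metis
    then have "v' \<in> N w'" using N_sym PU[OF e(1)] by auto
    then show ?thesis using * by (auto simp: doubleton_eq_iff)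
  qed
  show ?thesis using that[OF sub HU Hfin Hdisj Hadj] .
qed

end

text \<open>The vertices of \<open>H\<close> are renamed to natural numbers to fit the required
  type. The copy of the blow-up sends the \<open>i\<close>-th clone of \<open>v\<close> to the
  \<open>i\<close>-th element of \<open>g v\<close>, for a fixed enumeration \<open>h v\<close> of
  that set.\<close>

lemma blow_up_embedding:
  fixes G :: "'a graph" and H :: "'v graph" and g :: "'v \<Rightarrow> 'a set"
  assumes sub: "is_subdivision F t H" and fin: "finite (verts H)" and "simple_graph F"
    and gV: "\<And>v. v \<in> verts H \<Longrightarrow> g v \<subseteq> verts G" and gcard: "\<And>v. v \<in> verts H \<Longrightarrow> finite (g v) \<and> card (g v) = r"
    and disj: "\<And>v w. v \<in> verts H \<Longrightarrow> w \<in> verts H \<Longrightarrow> v \<noteq> w \<Longrightarrow> g v \<inter> g w = {}"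
    and adj: "\<And>v w x y. {v, w} \<in> edges H \<Longrightarrow> x \<in> g v \<Longrightarrow> y \<in> g w \<Longrightarrow> {x, y} \<in> edges G"
  shows "\<exists>H' :: nat graph. is_subdivision F t H' \<and> contains_copy G (blow_up r H')"
proof -
  have sH: "simple_graph H" by (rule simple_graph_subdivision[OF assms(3) sub])
  obtain f :: "'v \<Rightarrow> nat" where f: "inj_on f (verts H)" using finite_imp_inj_to_nat_seg[OF fin] by blast
  define H' :: "nat graph" where "H' = (f ` verts H, (`) f ` edges H)"
  from sub obtain b P where bP: "inj_on b (verts F)"
    "\<forall>e\<in>edges F.
           P e \<noteq> [] \<and> distinct (P e) \<and> {hd (P e), last (P e)} = b ` e \<and>
           internal_verts (P e) \<inter> b ` verts F = {} \<and>
           real (card (internal_verts (P e))) \<le> t"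
    "\<forall>e\<in>edges F. \<forall>e'\<in>edges F.
           e \<noteq> e' \<longrightarrow> internal_verts (P e) \<inter> internal_verts (P e') = {}"
    "verts H = b ` verts F \<union> (\<Union>e\<in>edges F. set (P e))"
    "edges H = (\<Union>e\<in>edges F. path_edges (P e))"
    unfolding is_subdivision_def by (elim exE conjE) (rule that; simp)
  have imap: "internal_verts (map f p) = f ` internal_verts p" for p :: "'v list"
    by (simp add: internal_verts_def map_tl[symmetric] map_butlast[symmetric])
  have pmap: "path_edges (map f p) = (`) f ` path_edges p" for p :: "'v list"
  proof -
    have *: "path_edges p = (\<lambda>i. {p ! i, p ! Suc i}) ` {i. Suc i < length p}" for p :: "'w list"
      unfolding path_edges_def by auto
    show ?thesis unfolding * image_image by (auto intro!: image_cong)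
  qed
  have isub: "internal_verts p \<subseteq> set p" for p :: "'v list"
    unfolding internal_verts_def by (cases p) (auto dest: in_set_butlastD)
  have PH: "set (P e) \<subseteq> verts H" "internal_verts (P e) \<subseteq> verts H" if "e \<in> edges F" for e
    using that bP(4) isub[of "P e"] by auto
  have finj: "inj_on f A" if "A \<subseteq> verts H" for A using f that inj_on_subset by blast
  have fint: "f ` A \<inter> f ` B = f ` (A \<inter> B)" if "A \<subseteq> verts H" "B \<subseteq> verts H" for A B
    using inj_on_image_Int[OF f that] by simp
  have sub': "is_subdivision F t H'"
    unfolding is_subdivision_def
  proof (intro exI[of _ "f \<circ> b"] exI[of _ "\<lambda>e. map f (P e)"] conjI ballI impI)
    show "inj_on (f \<circ> b) (verts F)"
      using bP(1,4) by (intro comp_inj_on finj) auto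
    show "verts H' = (f \<circ> b) ` verts F \<union> (\<Union>e\<in>edges F. set (map f (P e)))"
      unfolding H'_def using bP(4) by (auto simp: image_Un image_comp)
    show "edges H' = (\<Union>e\<in>edges F. path_edges (map f (P e)))"
      unfolding H'_def using bP(5) by (auto simp: pmap)
  next
    fix e assume e: "e \<in> edges F"
    have PN: "P e \<noteq> []" using bP(2) e by auto
    then show "map f (P e) \<noteq> []" by simp
    show "distinct (map f (P e))" using bP(2) e finj[OF PH(1)[OF e]] by (auto simp: distinct_map)
    have "{hd (map f (P e)), last (map f (P e))} = f ` {hd (P e), last (P e)}"
      using PN by (simp add: hd_map last_map)
    then show "{hd (map f (P e)), last (map f (P e))} = (f \<circ> b) ` e"
      using bP(2) e by (simp add: image_comp)
    have "b ` verts F \<subseteq> verts H" using bP(4) by auto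
    then have "f ` internal_verts (P e) \<inter> f ` (b ` verts F) = f ` (internal_verts (P e) \<inter> b ` verts F)"
      using fint PH(2)[OF e] by blast
    then show "internal_verts (map f (P e)) \<inter> (f \<circ> b) ` verts F = {}"
      using bP(2) e by (simp add: imap image_comp)
    show "real (card (internal_verts (map f (P e)))) \<le> t"
      using bP(2) e card_image[OF finj[OF PH(2)[OF e]]] by (simp add: imap)
  next
    fix e e' assume e: "e \<in> edges F" "e' \<in> edges F" "e \<noteq> e'"
    then show "internal_verts (map f (P e)) \<inter> internal_verts (map f (P e')) = {}"
      using bP(3) fint[OF PH(2)[OF e(1)] PH(2)[OF e(2)]] by (simp add: imap)
  qed
  have "\<forall>v\<in>verts H. \<exists>h. bij_betw h {..<r} (g v)"
    using gcard ex_bij_betw_nat_finite by (metis lessThan_atLeast0)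
  then obtain h where h: "\<And>v. v \<in> verts H \<Longrightarrow> bij_betw (h v) {..<r} (g v)" by metis
  define f' where "f' = inv_into (verts H) f"
  have f': "f' (f v) = v" if "v \<in> verts H" for v unfolding f'_def using f that by simp
  define q where "q = (\<lambda>(k, i). h (f' k) i)"
  have q: "q (f v, i) = h v i" if "v \<in> verts H" for v i using f'[OF that] by (simp add: q_def)
  have hin: "h v i \<in> g v" if "v \<in> verts H" "i < r" for v i
    using h[OF that(1)] that(2) by (auto simp: bij_betw_def)
  have "contains_copy G (blow_up r H')"
    unfolding contains_copy_def
  proof (intro exI[of _ q] conjI ballI)
    show "inj_on q (verts (blow_up r H'))"
    proof (rule inj_onI)
      fix s s' assume s: "s \<in> verts (blow_up r H')" "s' \<in> verts (blow_up r H')" "q s = q s'"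
      obtain v i v' i' where vi: "s = (f v, i)" "s' = (f v', i')" "v \<in> verts H" "v' \<in> verts H" "i < r" "i' < r"
        using s(1,2) by (auto simp: blow_up_def H'_def)
      have eq: "h v i = h v' i'" using s(3) vi q by simp
      have "v = v'"
      proof (rule ccontr)
        assume "v \<noteq> v'"
        then have "g v \<inter> g v' = {}" using disj vi by auto
        then show False using hin[of v i] hin[of v' i'] vi eq by auto
      qed
      moreover have "i = i'"
        using eq vi h[of v] \<open>v = v'\<close> by (auto simp: bij_betw_def inj_on_def)
      ultimately show "s = s'" using vi by simp
    qed
    show "q ` verts (blow_up r H') \<subseteq> verts G"
      using subsetD[OF gV hin] by (auto simp: blow_up_def H'_def q)
  next
    fix e assume "e \<in> edges (blow_up r H')"
    then obtain k l i j where e: "e = {(k, i), (l, j)}" "{k, l} \<in> edges H'" "i < r" "j < r"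
      by (auto simp: blow_up_def)
    then obtain c where c: "c \<in> edges H" "{k, l} = f ` c" by (auto simp: H'_def)
    then have cH: "c \<subseteq> verts H" and c2: "card c = 2" using sH by (auto simp: simple_graph_def)
    obtain v w where vw: "k = f v" "l = f w" "c = {v, w}"
    proof -
      obtain v w where "c = {v, w}" using c2 by (auto simp: card_2_iff)
      then show ?thesis using c(2) that[of v w] that[of w v] by (auto simp: doubleton_eq_iff)
    qed
    have "v \<in> verts H" "w \<in> verts H" using cH vw by auto
    then have "q ` e = {h v i, h w j}" using e vw q by simp
    also have "\<dots> \<in> edges G"
      using adj[of v w] c vw hin e \<open>v \<in> verts H\<close> \<open>w \<in> verts H\<close> by auto
    finally show "q ` e \<in> edges G" .
  qed
  with sub' show ?thesis by blast
qed

section \<open>Counting complete bipartite subgraphs\<close>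

text \<open>Bernoulli's inequality is the tangent line at the mean; its linear terms cancel in the
  sum.\<close>

lemma power_mean:
  fixes x :: "'i \<Rightarrow> real"
  assumes "finite I" "I \<noteq> {}" "\<And>i. i \<in> I \<Longrightarrow> x i \<ge> 0" "r \<ge> 1"
  shows "real (card I) * (sum x I / real (card I)) ^ r \<le> (\<Sum>i\<in>I. x i ^ r)"
proof -
  define a where "a = sum x I / real (card I)"
  have cI: "real (card I) > 0" using assms by (simp add: card_gt_0_iff)
  have a0: "a \<ge> 0" unfolding a_def using assms by (intro divide_nonneg_nonneg sum_nonneg) auto
  show ?thesis
  proof (cases "a = 0")
    case True
    then have z: "(sum x I / real (card I)) ^ r = 0" using assms(4) unfolding a_def by (simp add: power_0_left)
    show ?thesis unfolding z mult_zero_right using assms(3) by (simp add: sum_nonneg)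
  next
    case False
    then have ap: "a > 0" using a0 by simp
    have "1 + real r * (x i / a - 1) \<le> (x i / a) ^ r" if "i \<in> I" for i
    proof -
      have "-1 \<le> x i / a - 1" using assms(3)[OF that] ap by simp
      from Bernoulli_inequality[OF this, of r] show ?thesis by simp
    qed
    then have "(\<Sum>i\<in>I. 1 + real r * (x i / a - 1)) \<le> (\<Sum>i\<in>I. (x i / a) ^ r)" by (rule sum_mono)
    also have "(\<Sum>i\<in>I. 1 + real r * (x i / a - 1)) = real (card I) + real r * (sum x I / a - real (card I))"
      by (simp add: sum.distrib sum_distrib_left[symmetric] sum_subtractf sum_divide_distrib[symmetric])
    also have "sum x I / a = real (card I)"
    proof -
      have "sum x I = a * real (card I)" using cI by (simp add: a_def)
      then show ?thesis using ap by simp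
    qed
    finally have "real (card I) \<le> (\<Sum>i\<in>I. x i ^ r) / a ^ r" by (simp add: power_divide sum_divide_distrib)
    then have "real (card I) * a ^ r \<le> (\<Sum>i\<in>I. x i ^ r)" using ap by (simp add: pos_le_divide_eq)
    then show ?thesis by (simp add: a_def)
  qed
qed

text \<open>The subtracted 1 covers \<open>x < r\<close>, where the binomial coefficient vanishes
  while the power is at most 1.\<close>

lemma power_le_binomial:
  assumes "r \<ge> 1"
  shows "(real x / real r) ^ r - 1 \<le> real (x choose r)"
proof (cases "r \<le> x")
  case True
  then show ?thesis using binomial_ge_n_over_k_pow_k[OF True, where 'a = real] by simp
next
  case False
  then have "(real x / real r) ^ r \<le> 1" by (intro power_le_one) (auto simp: divide_le_eq_1)
  then show ?thesis by simp
qed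

text \<open>Used twice: for vertex degrees, to find many stars, and for the sizes of common
  neighbourhoods, to find many complete bipartite graphs.\<close>

lemma sum_binomial_ge:
  assumes "finite I" "I \<noteq> {}" "r \<ge> 1"
  shows "real (card I) * ((real (\<Sum>i\<in>I. f i) / (real (card I) * real r)) ^ r - 1)
    \<le> real (\<Sum>i\<in>I. f i choose r)"
proof -
  have cI: "real (card I) > 0" using assms by (simp add: card_gt_0_iff)
  have "(real (\<Sum>i\<in>I. f i) / (real (card I) * real r)) = (\<Sum>i\<in>I. real (f i) / real r) / real (card I)"
    by (simp add: sum_divide_distrib[symmetric] mult.commute)
  then have "real (card I) * (real (\<Sum>i\<in>I. f i) / (real (card I) * real r)) ^ r \<le> (\<Sum>i\<in>I. (real (f i) / real r) ^ r)"
    using power_mean[OF assms(1,2), of "\<lambda>i. real (f i) / real r" r] assms(3) by simp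
  then have "real (card I) * ((real (\<Sum>i\<in>I. f i) / (real (card I) * real r)) ^ r - 1)
      \<le> (\<Sum>i\<in>I. (real (f i) / real r) ^ r - 1)"
    by (simp add: right_diff_distrib sum_subtractf)
  also have "\<dots> \<le> real (\<Sum>i\<in>I. f i choose r)"
    unfolding of_nat_sum by (intro sum_mono power_le_binomial assms(3))
  finally show ?thesis .
qed

section \<open>The auxiliary graph on \<open>r\<close>-sets\<close>

definition rsubsets :: "'a graph \<Rightarrow> nat \<Rightarrow> 'a set set" where
  "rsubsets G r = {A. A \<subseteq> verts G \<and> card A = r}"

definition common_nbrs :: "'a graph \<Rightarrow> 'a set \<Rightarrow> 'a set" where
  "common_nbrs G A = {y \<in> verts G. \<forall>x\<in>A. {x, y} \<in> edges G}"

lemma degree_sum: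
  assumes "simple_graph G"
  shows "(\<Sum>y\<in>verts G. card {x \<in> verts G. {x, y} \<in> edges G}) = 2 * card (edges G)"
proof -
  have finV: "finite (verts G)" and E: "\<And>e. e \<in> edges G \<Longrightarrow> e \<subseteq> verts G \<and> card e = 2"
    using assms by (auto simp: simple_graph_def)
  have finE: "finite (edges G)"
    using E finV by (intro finite_subset[of "edges G" "Pow (verts G)"]) auto
  have "card {x \<in> verts G. {x, y} \<in> edges G} = card {e \<in> edges G. y \<in> e}" if "y \<in> verts G" for y
  proof (rule bij_betw_same_card[of "\<lambda>x. {x, y}"])
    have "inj_on (\<lambda>x. {x, y}) {x \<in> verts G. {x, y} \<in> edges G}"
      by (auto simp: inj_on_def doubleton_eq_iff)
    moreover have "e \<in> (\<lambda>x. {x, y}) ` {x \<in> verts G. {x, y} \<in> edges G}" if e: "e \<in> edges G" "y \<in> e" for e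
    proof -
      obtain a b where "e = {a, b}" using E[OF e(1)] by (auto simp: card_2_iff)
      then obtain x where "e = {x, y}" using e(2) by auto
      then show ?thesis using e E[OF e(1)] by auto
    qed
    ultimately show "bij_betw (\<lambda>x. {x, y}) {x \<in> verts G. {x, y} \<in> edges G} {e \<in> edges G. y \<in> e}"
      unfolding bij_betw_def by auto
  qed
  then have "(\<Sum>y\<in>verts G. card {x \<in> verts G. {x, y} \<in> edges G}) = (\<Sum>y\<in>verts G. \<Sum>e\<in>edges G. if y \<in> e then 1 else 0)"
    using finE by (intro sum.cong refl) (simp add: sum.If_cases Int_def)
  also have "\<dots> = (\<Sum>e\<in>edges G. \<Sum>y\<in>verts G. if y \<in> e then 1 else 0)" by (rule sum.swap)
  also have "\<dots> = (\<Sum>e\<in>edges G. 2)"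
  proof (intro sum.cong refl)
    fix e assume "e \<in> edges G"
    then have "verts G \<inter> e = e" "card e = 2" using E by auto
    then show "(\<Sum>y\<in>verts G. if y \<in> e then 1 else 0) = (2::nat)"
      using finV by (simp add: sum.If_cases)
  qed
  finally show ?thesis by simp
qed

text \<open>Double counting of the stars with \<open>r\<close> leaves, by leaf set and by
  centre.\<close>

lemma sum_common_nbrs:
  assumes "simple_graph G"
  shows "(\<Sum>A\<in>rsubsets G r. card (common_nbrs G A))
    = (\<Sum>y\<in>verts G. card {x \<in> verts G. {x, y} \<in> edges G} choose r)"
proof -
  have finV: "finite (verts G)" using assms by (simp add: simple_graph_def)
  then have finK: "finite (rsubsets G r)"
    by (auto simp: rsubsets_def)
  have "(\<Sum>A\<in>rsubsets G r. card (common_nbrs G A))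
      = (\<Sum>A\<in>rsubsets G r. \<Sum>y\<in>verts G. if \<forall>x\<in>A. {x, y} \<in> edges G then 1 else 0)"
    using finV by (intro sum.cong refl) (simp add: common_nbrs_def sum.If_cases Int_def)
  also have "\<dots> = (\<Sum>y\<in>verts G. \<Sum>A\<in>rsubsets G r. if \<forall>x\<in>A. {x, y} \<in> edges G then 1 else 0)"
    by (rule sum.swap)
  also have "\<dots> = (\<Sum>y\<in>verts G. card {x \<in> verts G. {x, y} \<in> edges G} choose r)"
  proof (intro sum.cong refl)
    fix y
    have "(\<Sum>A\<in>rsubsets G r. if \<forall>x\<in>A. {x, y} \<in> edges G then 1 else 0)
        = card {A \<in> rsubsets G r. \<forall>x\<in>A. {x, y} \<in> edges G}"
      using finK by (simp add: sum.If_cases Int_def)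
    also have "{A \<in> rsubsets G r. \<forall>x\<in>A. {x, y} \<in> edges G}
        = {A. A \<subseteq> {x \<in> verts G. {x, y} \<in> edges G} \<and> card A = r}"
      by (auto simp: rsubsets_def)
    also have "card \<dots> = card {x \<in> verts G. {x, y} \<in> edges G} choose r"
      using finV by (intro n_subsets) auto
    finally show "(\<Sum>A\<in>rsubsets G r. if \<forall>x\<in>A. {x, y} \<in> edges G then 1 else 0)
        = card {x \<in> verts G. {x, y} \<in> edges G} choose r" .
  qed
  finally show ?thesis .
qed

text \<open>By the absorption identity, \<open>b\<close> lies in at most an
  \<open>r / card S\<close> fraction of the \<open>r\<close>-subsets; the product form stays within
  the natural numbers. This is why large common neighbourhoods make conflicts rare.\<close>

lemma card_subsets_containing:
  assumes "finite S" "r \<ge> 1"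
  shows "card S * card {A. A \<subseteq> S \<and> card A = r \<and> b \<in> A} \<le> r * (card S choose r)"
proof (cases "b \<in> S")
  case False
  then have none: "{A. A \<subseteq> S \<and> card A = r \<and> b \<in> A} = {}" by auto
  show ?thesis unfolding none by simp
next
  case True
  have "card {A. A \<subseteq> S \<and> card A = r \<and> b \<in> A} \<le> card {A. A \<subseteq> S - {b} \<and> card A = r - 1}"
  proof (rule card_inj_on_le[where f = "\<lambda>A. A - {b}"])
    show "inj_on (\<lambda>A. A - {b}) {A. A \<subseteq> S \<and> card A = r \<and> b \<in> A}"
    proof (rule inj_onI)
      fix A B assume *: "A \<in> {A. A \<subseteq> S \<and> card A = r \<and> b \<in> A}" "B \<in> {A. A \<subseteq> S \<and> card A = r \<and> b \<in> A}"
        "A - {b} = B - {b}"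
      then have "insert b (A - {b}) = A" "insert b (B - {b}) = B" by auto
      then show "A = B" using *(3) by simp
    qed
    show "finite {A. A \<subseteq> S - {b} \<and> card A = r - 1}"
      using assms(1) by auto
    show "(\<lambda>A. A - {b}) ` {A. A \<subseteq> S \<and> card A = r \<and> b \<in> A} \<subseteq> {A. A \<subseteq> S - {b} \<and> card A = r - 1}"
      by auto
  qed
  also have "\<dots> = (card S - 1) choose (r - 1)"
    using assms(1) True n_subsets[of "S - {b}" "r - 1"] by simp
  finally have "card S * card {A. A \<subseteq> S \<and> card A = r \<and> b \<in> A} \<le> card S * ((card S - 1) choose (r - 1))"
    by (rule mult_left_mono) simp
  also have "\<dots> = r * (card S choose r)"
    using binomial_absorption[of "r - 1" "card S"] assms(2) by simp
  finally show ?thesis .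
qed


text \<open>With \<open>e\<close> edges, convexity gives at least
  \<open>n * (2 * e / (n * r))^r - n\<close> stars. The \<open>r\<close>-th power of the edge bound
  is \<open>n^(2 r - 1) * L^60\<close>, so the factor \<open>n^r\<close> remains; the exponents
  \<open>2 - 1/r\<close> and \<open>60/r\<close> are made for this. The constant
  \<open>(2/r)^r\<close> and the subtracted \<open>n\<close> are absorbed by the spare powers of
  \<open>L\<close>.\<close>

lemma rsubset_density:
  fixes G :: "'a graph" and r :: nat
  assumes G: "simple_graph G" and n: "card (verts G) = n" "n \<ge> 1" and r: "r \<ge> 1"
    and edges: "real (card (edges G)) \<ge> real n powr (2 - 1 / real r) * L powr (60 / real r)"
    and L: "L \<ge> 2" "2 * real r * (real r / 2) ^ r \<le> L"
  shows "real r * L ^ 50 * real n ^ r \<le> real (\<Sum>A\<in>rsubsets G r. card (common_nbrs G A))"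
proof -
  define e where "e = real (card (edges G))"
  define S where "S = real (\<Sum>A\<in>rsubsets G r. card (common_nbrs G A))"
  have finV: "finite (verts G)" and Vne: "verts G \<noteq> {}" using G n by (auto simp: simple_graph_def)
  have n0: "real n > 0" using n by simp
  have "real n * ((2 * e / (real n * real r)) ^ r - 1) \<le> S"
    using sum_binomial_ge[OF finV Vne r, of "\<lambda>y. card {x \<in> verts G. {x, y} \<in> edges G}"]
    unfolding sum_common_nbrs[OF G, symmetric] degree_sum[OF G] n S_def e_def by simp
  moreover have "real n * (2 * e / (real n * real r)) ^ r \<ge> (2 / real r) ^ r * (real n ^ r * L ^ 60)"
  proof -
    have 1: "(real n powr (2 - 1 / real r) * L powr (60 / real r)) ^ r \<le> e ^ r"
      using edges unfolding e_def by (intro power_mono) auto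
    have 2: "(real n powr (2 - 1 / real r)) ^ r = real n powr (2 * real r - 1)"
      using r n0 by (simp add: powr_realpow[symmetric] powr_powr left_diff_distrib)
    have 3: "(L powr (60 / real r)) ^ r = L ^ 60"
    proof -
      have "(L powr (60 / real r)) ^ r = L powr (60 / real r * real r)"
        using L by (simp add: powr_realpow[symmetric] powr_powr)
      also have "\<dots> = L powr real 60" using r by simp
      also have "\<dots> = L ^ 60" using L by (intro powr_realpow) simp
      finally show ?thesis .
    qed
    have 4: "real n powr (2 * real r - 1) * real n = real n ^ r * real n ^ r"
    proof -
      have "real n powr (2 * real r - 1) * real n powr 1 = real n powr (2 * real r)"
        unfolding powr_add[symmetric] by simp
      also have "\<dots> = real n powr real (r + r)" by simp
      also have "\<dots> = real n ^ (r + r)" using n0 by (rule powr_realpow)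
      finally show ?thesis using n0 by (simp add: power_add)
    qed
    have "real n powr (2 * real r - 1) * L ^ 60 * real n \<le> e ^ r * real n"
      using 1 unfolding power_mult_distrib 2 3 by (rule mult_right_mono) simp
    then have "real n ^ r * real n ^ r * L ^ 60 \<le> e ^ r * real n"
      unfolding 4[symmetric] by (simp add: mult_ac)
    then have "(2 / real r) ^ r * (real n ^ r * real n ^ r * L ^ 60) / real n ^ r \<le> (2 / real r) ^ r * (e ^ r * real n) / real n ^ r"
      using n0 by (intro divide_right_mono mult_left_mono) auto
    moreover have "(2 / real r) ^ r * (e ^ r * real n) / real n ^ r = real n * (2 * e / (real n * real r)) ^ r"
      by (simp add: power_divide power_mult_distrib mult_ac)
    ultimately show ?thesis using n0 by simp
  qed
  ultimately have S: "(2 / real r) ^ r * L ^ 60 * real n ^ r - real n \<le> S"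
    by (simp add: right_diff_distrib mult_ac)
  have "2 * real r \<le> (2 / real r) ^ r * L"
  proof -
    have "(2 / real r) ^ r * (2 * real r * (real r / 2) ^ r) \<le> (2 / real r) ^ r * L"
      using L by (intro mult_left_mono) auto
    moreover have "(2 / real r) ^ r * (2 * real r * (real r / 2) ^ r) = 2 * real r"
      using r by (simp add: power_divide)
    ultimately show ?thesis by simp
  qed
  then have "2 * real r * L ^ 59 \<le> (2 / real r) ^ r * L * L ^ 59"
    using L by (intro mult_right_mono) auto
  also have "\<dots> = (2 / real r) ^ r * L ^ 60" by (simp add: power_Suc[symmetric] mult.assoc del: power_Suc)
  finally have a: "2 * real r * L ^ 59 \<le> (2 / real r) ^ r * L ^ 60" .
  have "real r * L ^ 50 \<le> real r * L ^ 59" using L by (intro mult_left_mono power_increasing) auto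
  moreover have "1 * 1 \<le> real r * L ^ 59" using L r by (intro mult_mono) auto
  ultimately have "real r * L ^ 50 + 1 \<le> (2 / real r) ^ r * L ^ 60" using a by linarith
  then have "(real r * L ^ 50 + 1) * real n ^ r \<le> (2 / real r) ^ r * L ^ 60 * real n ^ r"
    by (intro mult_right_mono) auto
  moreover have "real n \<le> real n ^ r"
    using n r power_increasing[of 1 r "real n"] by simp
  ultimately show ?thesis using S unfolding S_def[symmetric] distrib_right mult_1_left by linarith
qed

text \<open>The walk length \<open>3 T\<close> is at most a constant times \<open>r^5 L^5\<close>, hence at most \<open>L^6\<close> for large \<open>L\<close>.\<close>

lemma blow_up_of_subdivision:
  fixes G :: "'a graph" and r m n :: nat
  assumes G: "simple_graph G" and n: "card (verts G) = n" and r: "r \<ge> 1"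
  defines "L \<equiv> log 2 (real n)"
  assumes edges: "real (card (edges G)) \<ge> real n powr (2 - 1 / real r) * L powr (60 / real r)"
    and L1: "3000000 * real r ^ 5 \<le> L" and L2: "512 * real r ^ 3 * real (1 + m + m\<^sup>2) < L"
    and L3: "2 * real r * (real r / 2) ^ r \<le> L"
  shows "\<exists>H :: nat graph. is_subdivision (complete_graph m) (L ^ 6) H \<and> contains_copy G (blow_up r H)"
proof -
  have r5: "1 \<le> real r ^ 5" and r2: "real r ^ 2 \<le> real r ^ 5"
    using r by (auto intro!: power_increasing one_le_power)
  have Lbig: "L \<ge> 3000000" using L1 r5 by linarith
  \<comment> \<open>\<open>log 2 0\<close> has the value 0, which a large \<open>L\<close>
    excludes.\<close>
  have n1: "n \<ge> 1"
  proof (rule ccontr)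
    assume "\<not> n \<ge> 1"
    then have "n = 0" by simp
    then have "L = 0" by (simp add: L_def log_def)
    then show False using Lbig by simp
  qed
  then have nL: "real n = 2 powr L" by (simp add: L_def)
  have npow: "real n ^ j = 2 powr (L * real j)" for j
    by (simp add: nL powr_realpow[symmetric] powr_powr)
  define Ks where "Ks = rsubsets G r"
  define cn where "cn = (\<lambda>A. card (common_nbrs G A))"
  define D where "D = (\<lambda>A. {B \<in> Ks. B \<subseteq> common_nbrs G A})"
  have finV: "finite (verts G)" using G by (simp add: simple_graph_def)
  have KsP: "Ks \<subseteq> Pow (verts G)" by (auto simp: Ks_def rsubsets_def)
  have finK: "finite Ks" using KsP finV by (meson finite_Pow_iff finite_subset)
  have cardK: "card Ks = n choose r"
    unfolding Ks_def rsubsets_def using n_subsets[OF finV, of r] n by simp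
  have cardKn: "real (card Ks) \<le> real n ^ r"
  proof -
    have "(n choose r) * 1 \<le> (n choose r) * fact r" by (intro mult_left_mono) auto
    also have "\<dots> \<le> n ^ r" by (rule binomial_fact_pow)
    finally show ?thesis unfolding cardK by (metis mult.right_neutral of_nat_le_iff of_nat_power)
  qed
  have cnsub: "common_nbrs G A \<subseteq> verts G" for A by (auto simp: common_nbrs_def)
  have fincn: "finite (common_nbrs G A)" for A using cnsub finV finite_subset by blast
  have D_eq: "D A = {B. B \<subseteq> common_nbrs G A \<and> card B = r}" for A
    using cnsub by (auto simp: D_def Ks_def rsubsets_def)
  have cardD: "card (D A) = cn A choose r" for A
    unfolding D_eq cn_def by (rule n_subsets[OF fincn])
  define S where "S = (\<Sum>A\<in>Ks. cn A)"
  have S: "real r * L ^ 50 * real n ^ r \<le> real S"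
    using rsubset_density[OF G n n1 r edges _ L3] Lbig unfolding S_def Ks_def cn_def by simp
  have "0 < real r * L ^ 50 * real n ^ r" using r n1 Lbig by simp
  then have "S > 0" using S by linarith
  then have Kne: "Ks \<noteq> {}" by (auto simp: S_def)
  then have cK0: "real (card Ks) > 0" using finK by (simp add: card_gt_0_iff)
  define tot where "tot = (\<Sum>A\<in>Ks. card (D A))"
  \<comment> \<open>Second use of convexity: a common neighbourhood has on average at least
    \<open>r * L^50\<close> elements, and the factor \<open>r\<close> cancels against the one in
    \<open>sum_binomial_ge\<close>.\<close>
  have "L ^ 50 \<le> real S / (real (card Ks) * real r)"
  proof -
    have "L ^ 50 * (real (card Ks) * real r) \<le> L ^ 50 * (real n ^ r * real r)"
      using cardKn Lbig by (intro mult_left_mono mult_right_mono) auto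
    also have "\<dots> \<le> real S" using S by (simp add: mult_ac)
    finally show ?thesis using cK0 r by (simp add: pos_le_divide_eq)
  qed
  then have "(L ^ 50) ^ r \<le> (real S / (real (card Ks) * real r)) ^ r" using Lbig by (intro power_mono) auto
  then have "real (card Ks) * ((L ^ 50) ^ r - 1) \<le> real (card Ks) * ((real S / (real (card Ks) * real r)) ^ r - 1)"
    using cK0 by (intro mult_left_mono) auto
  also have "\<dots> \<le> real tot"
    using sum_binomial_ge[OF finK Kne r, of cn] by (simp add: S_def tot_def cardD)
  finally have tot_lb: "real (card Ks) * ((L ^ 50) ^ r - 1) \<le> real tot" .
  have L50: "(L ^ 50) ^ r \<ge> 2"
  proof -
    have "2 \<le> L ^ 1" using Lbig by simp
    also have "\<dots> \<le> L ^ (50 * r)" using Lbig r by (intro power_increasing) auto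
    finally show ?thesis by (simp add: power_mult)
  qed
  have tot_ub: "real tot \<le> real n ^ (2 * r)"
  proof -
    have "tot \<le> (\<Sum>A\<in>Ks. card Ks)"
      unfolding tot_def using finK by (intro sum_mono card_mono) (auto simp: D_def)
    then have "real tot \<le> real (card Ks * card Ks)" by (simp only: of_nat_le_iff) simp
    also have "\<dots> \<le> real n ^ r * real n ^ r" using cardKn by (simp add: mult_mono)
    finally show ?thesis by (simp add: mult_2 power_add)
  qed
  have tot_pos: "real tot > 0"
  proof -
    have "0 < real (card Ks) * ((L ^ 50) ^ r - 1)" using cK0 L50 by simp
    then show ?thesis using tot_lb by linarith
  qed
  define X where "X = {A \<in> Ks. D A \<noteq> {}}"
  have totX: "(\<Sum>A\<in>X. card (D A)) = tot"
    unfolding tot_def X_def using finK by (intro sum.mono_neutral_left) auto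
  have XK: "X \<subseteq> Ks" by (auto simp: X_def)
  have finX: "finite X" using XK finK finite_subset by auto
  have Xne: "X \<noteq> {}" using totX tot_pos by auto
  have Dsym: "A \<in> D B" if "A \<in> Ks" "B \<in> D A" for A B
  proof -
    have "B \<in> Ks" and B: "B \<subseteq> common_nbrs G A" using that(2) by (auto simp: D_def)
    have "{y, x} \<in> edges G" if "x \<in> A" "y \<in> B" for x y
      using subsetD[OF B that(2)] that(1) by (simp add: common_nbrs_def insert_commute)
    then show ?thesis using that(1) by (auto simp: D_def common_nbrs_def Ks_def rsubsets_def)
  qed
  have DX: "D A \<subseteq> X" if "A \<in> X" for A
    using that Dsym[of A] by (auto simp: X_def D_def)
  \<comment> \<open>All degrees are at most \<open>n^r = 2^(r L)\<close>, so \<open>k\<close> dyadic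
    classes suffice.\<close>
  define k where "k = nat \<lfloor>real r * L\<rfloor> + 1"
  have kub: "real k \<le> 2 * real r * L"
  proof -
    have "1 * 1 \<le> real r * L" using r Lbig by (intro mult_mono) auto
    then show ?thesis unfolding k_def by linarith
  qed
  have k1: "k \<ge> 1" by (simp add: k_def)
  have kD: "card (D A) < 2 ^ k" for A
  proof -
    have "card (D A) \<le> card Ks" using finK by (intro card_mono) (auto simp: D_def)
    then have "real (card (D A)) \<le> real n ^ r" using cardKn by linarith
    also have "\<dots> = 2 powr (L * real r)" by (rule npow)
    also have "\<dots> < 2 powr real k"
    proof -
      have "L * real r < real k" unfolding k_def mult.commute[of L] by linarith
      then show ?thesis by simp
    qed
    also have "\<dots> = real (2 ^ k)" by (simp add: powr_realpow)
    finally show ?thesis by (simp only: of_nat_less_iff)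
  qed
  \<comment> \<open>Twice the exponent in \<open>n^(2 r) = 2^(2 r L)\<close>, which leaves room for
    the factor 4 in front of the degree sum.\<close>
  define \<Lambda> where "\<Lambda> = 4 * real r * L"
  have rL: "1 * 3000000 \<le> real r * L" using r Lbig by (intro mult_mono) auto
  have Lam1: "\<Lambda> \<ge> 1" using rL by (simp add: \<Lambda>_def)
  have Lam2: "log 2 (4 * real (\<Sum>A\<in>X. card (D A))) \<le> \<Lambda>"
  proof -
    have "4 * real tot \<le> 2 powr 2 * 2 powr (L * real (2 * r))"
      using tot_ub unfolding npow by simp
    also have "\<dots> \<le> 2 powr \<Lambda>"
      unfolding powr_add[symmetric] using rL by (simp add: \<Lambda>_def algebra_simps)
    finally have "log 2 (4 * real tot) \<le> log 2 (2 powr \<Lambda>)" using tot_pos by (intro log_mono) auto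
    then have "log 2 (4 * real tot) \<le> \<Lambda>" by simp
    then show ?thesis by (simp add: totX)
  qed
  define \<phi> where "\<phi> = 1 / (16 * real k * \<Lambda>)"
  obtain U where U: "U \<subseteq> X \<times> UNIV" "U \<noteq> {}"
    "bip_net U (\<lambda>v. {w \<in> U. snd w \<noteq> snd v \<and> fst w \<in> D (fst v)}) snd \<phi>"
    "\<And>v. v \<in> U \<Longrightarrow> card (D (fst v)) \<le> 16 * k * card {w \<in> U. snd w \<noteq> snd v \<and> fst w \<in> D (fst v)}"
    "\<And>v. v \<in> U \<Longrightarrow> (\<Sum>A\<in>X. card (D A)) \<le> 2 * k\<^sup>2 * card X * card (D (fst v))"
    unfolding \<phi>_def
    by (rule double_cover_expander[of X D k \<Lambda>])
      (use finX Xne DX Dsym XK kD Lam1 Lam2 in \<open>auto simp: X_def\<close>)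
  define N where "N = (\<lambda>v. {w \<in> U. snd w \<noteq> snd v \<and> fst w \<in> D (fst v)})"
  interpret bip_net U N snd \<phi> using U(3) by (simp add: N_def)
  have UX: "fst v \<in> X" if "v \<in> U" for v using that U(1) by auto
  \<comment> \<open>The comparison with the average degree loses \<open>16 (r L)^2\<close>, which is
    at most \<open>L^3\<close> and so at most \<open>L^(36 r)\<close>; this is the gap between the
    exponents 50 and 14.\<close>
  have cn_lb: "L ^ 14 \<le> real (cn (fst v))" if v: "v \<in> U" for v
  proof -
    have "real tot \<le> real (2 * k\<^sup>2 * card X * card (D (fst v)))"
      using U(5)[OF v] unfolding totX of_nat_le_iff .
    also have "\<dots> \<le> 2 * (2 * real r * L)\<^sup>2 * real (card Ks) * real (cn (fst v)) ^ r"
    proof -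
      have "real (card (D (fst v))) \<le> real (cn (fst v)) ^ r"
      proof -
        have "(cn (fst v) choose r) * 1 \<le> (cn (fst v) choose r) * fact r" by (intro mult_left_mono) auto
        also have "\<dots> \<le> cn (fst v) ^ r" by (rule binomial_fact_pow)
        finally show ?thesis unfolding cardD by (metis mult.right_neutral of_nat_le_iff of_nat_power)
      qed
      moreover have "(real k)\<^sup>2 \<le> (2 * real r * L)\<^sup>2" using kub by (intro power_mono) auto
      moreover have "real (card X) \<le> real (card Ks)" using XK finK by (simp add: card_mono)
      ultimately show ?thesis unfolding of_nat_mult of_nat_power of_nat_numeral
        by (intro mult_mono) auto
    qed
    finally have "real tot \<le> real (card Ks) * (8 * (real r * L)\<^sup>2 * real (cn (fst v)) ^ r)"
      by (simp add: power_mult_distrib mult_ac)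
    then have "real (card Ks) * ((L ^ 50) ^ r - 1) \<le> real (card Ks) * (8 * (real r * L)\<^sup>2 * real (cn (fst v)) ^ r)"
      using tot_lb by linarith
    then have "(L ^ 50) ^ r - 1 \<le> 8 * (real r * L)\<^sup>2 * real (cn (fst v)) ^ r"
      using cK0 by simp
    then have "(L ^ 50) ^ r \<le> 16 * (real r * L)\<^sup>2 * real (cn (fst v)) ^ r" using L50 by linarith
    moreover have "16 * (real r * L)\<^sup>2 * (L ^ 14) ^ r \<le> (L ^ 50) ^ r"
    proof -
      have "16 * (real r * L)\<^sup>2 \<le> L * L\<^sup>2"
        unfolding power_mult_distrib mult.assoc[symmetric]
        using L1 r2 r5 by (intro mult_right_mono) auto
      also have "\<dots> = L ^ 3" by (simp add: power2_eq_square power3_eq_cube)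
      also have "\<dots> \<le> L ^ (36 * r)" using Lbig r by (intro power_increasing) auto
      finally have "16 * (real r * L)\<^sup>2 * (L ^ 14) ^ r \<le> L ^ (36 * r) * (L ^ 14) ^ r"
        using Lbig by (intro mult_right_mono) auto
      also have "\<dots> = (L ^ 50) ^ r" by (simp add: power_mult[symmetric] power_add[symmetric])
      finally show ?thesis .
    qed
    ultimately have "16 * (real r * L)\<^sup>2 * (L ^ 14) ^ r \<le> 16 * (real r * L)\<^sup>2 * real (cn (fst v)) ^ r"
      by linarith
    then have "(L ^ 14) ^ r \<le> real (cn (fst v)) ^ r" using r Lbig by simp
    then show ?thesis using r by (simp add: power_mono_iff Lbig)
  qed
  \<comment> \<open>A vertex of \<open>G\<close> lies in at most an \<open>r / L^14\<close> fraction
    of the sets in \<open>D (fst v)\<close>; the factor \<open>16 * k\<close> is the loss of degree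
    inside \<open>U\<close>.\<close>
  define \<sigma> where "\<sigma> = 16 * real k * real r / L ^ 14"
  have conf: "real (card {w \<in> N v. b \<in> fst w}) \<le> \<sigma> * d v" if v: "v \<in> U" for v b
  proof -
    define A where "A = fst v"
    have "card {w \<in> N v. b \<in> fst w} \<le> card {B. B \<subseteq> common_nbrs G A \<and> card B = r \<and> b \<in> B}"
    proof (rule card_inj_on_le[where f = fst])
      show "inj_on fst {w \<in> N v. b \<in> fst w}" by (auto simp: N_def inj_on_def)
      show "fst ` {w \<in> N v. b \<in> fst w} \<subseteq> {B. B \<subseteq> common_nbrs G A \<and> card B = r \<and> b \<in> B}"
        by (auto simp: N_def D_eq A_def)
      show "finite {B. B \<subseteq> common_nbrs G A \<and> card B = r \<and> b \<in> B}"
        using fincn[of A] by auto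
    qed
    then have "cn A * card {w \<in> N v. b \<in> fst w} \<le> cn A * card {B. B \<subseteq> common_nbrs G A \<and> card B = r \<and> b \<in> B}"
      by (rule mult_left_mono) simp
    also have "\<dots> \<le> r * card (D A)"
      unfolding cardD unfolding cn_def by (rule card_subsets_containing[OF fincn r])
    also have "\<dots> \<le> r * (16 * k * card (N v))"
      using U(4)[OF v] by (intro mult_left_mono) (auto simp: N_def A_def)
    finally have "real (cn A * card {w \<in> N v. b \<in> fst w}) \<le> real (r * (16 * k * card (N v)))"
      by (simp only: of_nat_le_iff)
    then have "real (cn A) * real (card {w \<in> N v. b \<in> fst w}) \<le> 16 * real k * real r * d v"
      by (simp add: d_def mult_ac)
    moreover have "L ^ 14 * real (card {w \<in> N v. b \<in> fst w}) \<le> real (cn A) * real (card {w \<in> N v. b \<in> fst w})"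
      using cn_lb[OF v] by (intro mult_right_mono) (auto simp: A_def)
    ultimately have "real (card {w \<in> N v. b \<in> fst w}) * L ^ 14 \<le> 16 * real k * real r * d v"
      by (simp add: mult.commute)
    then show ?thesis using Lbig by (simp add: \<sigma>_def pos_le_divide_eq)
  qed
  \<comment> \<open>\<open>196608 = 12 * 128^2\<close>: as \<phi> is at least
    \<open>1 / (128 (r L)^2)\<close>, this makes \<open>\<phi>^2 * c\<close> at least
    \<open>12 r L\<close>, four times the bound \<open>3 r L\<close> for
    \<open>ln (2 * M)\<close>.\<close>
  define c where "c = 196608 * real r ^ 5 * L ^ 5"
  define T where "T = 2 * nat \<lceil>c\<rceil>"
  have c1: "c \<ge> 1"
  proof -
    have "1 * 1 \<le> real r ^ 5 * L ^ 5" using r Lbig by (intro mult_mono one_le_power) auto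
    then show ?thesis unfolding c_def by linarith
  qed
  have Tlb: "real T \<ge> c" and Tub: "real T \<le> 4 * c" using c1 unfolding T_def by linarith+
  have T0: "T > 0" using Tlb c1 by linarith
  have Tev: "even T" by (simp add: T_def)
  \<comment> \<open>Rounding to an even number costs at most a factor 4, and
    \<open>12 * 196608 = 2359296\<close> is below the 3000000 in the assumption on
    \<open>L\<close>.\<close>
  have T6: "real (3 * T) \<le> L ^ 6"
  proof -
    have "real (3 * T) \<le> 12 * c" using Tub by simp
    also have "\<dots> = (2359296 * real r ^ 5) * L ^ 5" by (simp add: c_def)
    also have "\<dots> \<le> L * L ^ 5" using L1 Lbig r5 by (intro mult_right_mono) auto
    finally show ?thesis by (simp add: power_Suc[symmetric] del: power_Suc)
  qed
  have mix: "sqrt ((1 - \<phi>\<^sup>2 / 2) ^ j) \<le> 1 / (2 * M)" if j: "j \<ge> T" for j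
  proof -
    obtain v0 where v0: "v0 \<in> U" using U(2) by auto
    have M1: "M \<ge> 1" by (rule M_ge1[OF v0])
    \<comment> \<open>One side contains each \<open>r\<close>-set at most once, so its volume is at
      most the degree sum of the auxiliary graph.\<close>
    have Mtot: "M \<le> real tot"
    proof -
      define V where "V = {v \<in> U. snd v = True}"
      have dD: "d v \<le> real (card (D (fst v)))" if "v \<in> U" for v
      proof -
        have "card (N v) \<le> card (D (fst v))"
        proof (rule card_inj_on_le[where f = fst])
          show "inj_on fst (N v)" by (auto simp: N_def inj_on_def)
          show "fst ` N v \<subseteq> D (fst v)" by (auto simp: N_def)
          show "finite (D (fst v))" using finK by (simp add: D_def)
        qed
        then show ?thesis by (simp add: d_def)
      qed
      have "M = (\<Sum>v\<in>V. d v)" using vol_side[of True] by (simp add: vol_def V_def)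
      also have "\<dots> \<le> (\<Sum>v\<in>V. real (card (D (fst v))))" using dD by (intro sum_mono) (auto simp: V_def)
      also have "\<dots> = (\<Sum>A\<in>fst ` V. real (card (D A)))"
        by (subst sum.reindex) (auto simp: V_def inj_on_def)
      also have "\<dots> \<le> (\<Sum>A\<in>X. real (card (D A)))"
        using finX UX by (intro sum_mono2) (auto simp: V_def)
      finally show ?thesis by (simp add: totX[symmetric])
    qed
    have lnM: "ln (2 * M) \<le> 3 * real r * L"
    proof -
      have "2 * M \<le> 2 powr 1 * 2 powr (L * real (2 * r))"
        using Mtot tot_ub unfolding npow by simp
      also have "\<dots> \<le> 2 powr (3 * real r * L)"
        unfolding powr_add[symmetric] using rL by (simp add: algebra_simps)
      finally have "ln (2 * M) \<le> ln (2 powr (3 * real r * L))"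
        using M1 by (subst ln_le_cancel_iff) auto
      also have "\<dots> = 3 * real r * L * ln 2" by (simp add: ln_powr)
      also have "\<dots> \<le> 3 * real r * L * 1" using ln_2_less_1 Lbig by (intro mult_left_mono) auto
      finally show ?thesis by simp
    qed
    have phi_lb: "1 / (128 * (real r * L)\<^sup>2) \<le> \<phi>"
    proof -
      have "16 * real k * \<Lambda> \<le> 16 * (2 * real r * L) * (4 * real r * L)"
        unfolding \<Lambda>_def using kub Lbig by (intro mult_mono) auto
      also have "\<dots> = 128 * (real r * L)\<^sup>2" by (simp add: power2_eq_square)
      finally have "16 * real k * \<Lambda> \<le> 128 * (real r * L)\<^sup>2" .
      moreover have "16 * real k * \<Lambda> > 0" using k1 Lam1 by simp
      ultimately show ?thesis unfolding \<phi>_def by (intro frac_le) auto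
    qed
    have "12 * real r * L \<le> \<phi>\<^sup>2 * real j"
    proof -
      have "12 * real r * L = (1 / (128 * (real r * L)\<^sup>2))\<^sup>2 * c"
        using r Lbig by (simp add: c_def field_simps power2_eq_square eval_nat_numeral)
      also have "\<dots> \<le> \<phi>\<^sup>2 * real j"
        using phi_lb Tlb j c1 by (intro mult_mono power_mono) auto
      finally show ?thesis .
    qed
    \<comment> \<open>The square root halves the decay rate \<open>\<phi>^2 / 2\<close>; hence the
      4.\<close>
    then have *: "ln (2 * M) \<le> \<phi>\<^sup>2 / 4 * real j" using lnM by linarith
    have "(1 - \<phi>\<^sup>2 / 2) ^ j \<le> exp (- \<phi>\<^sup>2 / 2) ^ j"
      using contraction_nonneg exp_ge_add_one_self[of "- \<phi>\<^sup>2 / 2"] by (intro power_mono) auto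
    also have "\<dots> = (exp (- (\<phi>\<^sup>2 / 4 * real j)))\<^sup>2"
      by (simp add: exp_of_nat_mult[symmetric] exp_double[symmetric] mult_ac)
    also have "\<dots> \<le> (exp (- ln (2 * M)))\<^sup>2" using * by (intro power_mono) auto
    also have "\<dots> = (1 / (2 * M))\<^sup>2" using M1 by (simp add: exp_minus field_simps)
    finally show ?thesis using M1 by (intro real_le_lsqrt) auto
  qed
  \<comment> \<open>\<open>q^2\<close> is at most \<open>4 L^12\<close> and \<open>\<sigma>\<close>
    at most \<open>32 r^2 L / L^14\<close>, so all but a factor \<open>1 / L\<close> is the constant
    \<open>512 r^3 (1 + m + m^2)\<close>, with \<open>512 = 4 * 4 * 32\<close>.\<close>
  have small: "4 * ((real (3 * T + 1))\<^sup>2 * real r + real (3 * T + 1) * real (m * r + m\<^sup>2 * (3 * T + 1) * r)) * \<sigma> < 1"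
  proof -
    define q where "q = real (3 * T + 1)"
    have q1: "q \<ge> 1" by (simp add: q_def)
    have "1 \<le> L ^ 6" using Lbig by (intro one_le_power) simp
    then have qub: "q \<le> 2 * L ^ 6" using T6 by (simp add: q_def)
    have sig0: "\<sigma> \<ge> 0" using Lbig by (simp add: \<sigma>_def)
    have sigub: "\<sigma> \<le> 32 * real r ^ 2 * L / L ^ 14"
    proof -
      have "16 * real k * real r \<le> 16 * (2 * real r * L) * real r"
        using kub by (intro mult_right_mono mult_left_mono) auto
      then show ?thesis unfolding \<sigma>_def using Lbig
        by (intro divide_right_mono) (auto simp: power2_eq_square mult_ac)
    qed
    have "4 * ((real (3 * T + 1))\<^sup>2 * real r + real (3 * T + 1) * real (m * r + m\<^sup>2 * (3 * T + 1) * r))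
        = 4 * (q\<^sup>2 * real r + (q * 1) * (real m * real r) + q\<^sup>2 * (real m ^ 2 * real r))"
      unfolding of_nat_add[of "m * r"] of_nat_mult of_nat_power q_def[symmetric]
      by (simp add: power2_eq_square algebra_simps)
    also have "\<dots> \<le> 4 * (q\<^sup>2 * real r + (q * q) * (real m * real r) + q\<^sup>2 * (real m ^ 2 * real r))"
      using q1 by (intro mult_left_mono add_mono mult_right_mono order_refl) auto
    also have "\<dots> = q\<^sup>2 * (4 * real r * real (1 + m + m\<^sup>2))"
      by (simp add: power2_eq_square algebra_simps)
    also have "\<dots> \<le> (2 * L ^ 6)\<^sup>2 * (4 * real r * real (1 + m + m\<^sup>2))"
      using qub q1 by (intro mult_right_mono power_mono) auto
    finally have "4 * ((real (3 * T + 1))\<^sup>2 * real r + real (3 * T + 1) * real (m * r + m\<^sup>2 * (3 * T + 1) * r)) * \<sigma>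
       \<le> (2 * L ^ 6)\<^sup>2 * (4 * real r * real (1 + m + m\<^sup>2)) * (32 * real r ^ 2 * L / L ^ 14)"
      by (rule mult_mono[OF _ sigub _ sig0]) simp_all
    also have "\<dots> = (512 * real r ^ 3 * real (1 + m + m\<^sup>2)) * (L ^ 13 / L ^ 14)"
    proof -
      have a: "(2 * L ^ 6)\<^sup>2 * (4 * real r * Y) * (32 * real r ^ 2 * L / L ^ 14)
          = (512 * real r ^ 3 * Y) * ((L ^ 6)\<^sup>2 * L / L ^ 14)" for Y
        by (simp add: power_mult_distrib power3_eq_cube power2_eq_square)
      have b: "(L ^ 6)\<^sup>2 * L = L ^ 13" by (simp add: power_mult[symmetric] power_Suc2[symmetric] del: power_Suc)
      show ?thesis unfolding a b ..
    qed
    also have "L ^ 13 / L ^ 14 = 1 / L"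
      using Lbig by (simp add: eval_nat_numeral field_simps)
    also have "(512 * real r ^ 3 * real (1 + m + m\<^sup>2)) * (1 / L) < 1" using L2 Lbig by simp
    finally show ?thesis .
  qed
  have gU: "finite (fst v)" "card (fst v) = r" "fst v \<subseteq> verts G" if "v \<in> U" for v
  proof -
    have "fst v \<in> Ks" using UX[OF that] XK by auto
    then show "card (fst v) = r" "fst v \<subseteq> verts G" by (auto simp: Ks_def rsubsets_def)
    then show "finite (fst v)" using finV finite_subset by auto
  qed
  have gne: "fst v \<noteq> {}" if "v \<in> U" for v using gU(2)[OF that] r by auto
  obtain H :: "('a set \<times> bool) graph" where H: "is_subdivision (complete_graph m) (L ^ 6) H" "verts H \<subseteq> U"
    "finite (verts H)"
    "\<And>v w. v \<in> verts H \<Longrightarrow> w \<in> verts H \<Longrightarrow> v \<noteq> w \<Longrightarrow> fst v \<inter> fst w = {}"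
    "\<And>v w. {v, w} \<in> edges H \<Longrightarrow> w \<in> N v"
    by (rule find_subdivision[of fst r \<sigma> T m "L ^ 6"])
      (use U(2) gU gne conf mix Tev T0 small T6 in auto)
  have adj: "{x, y} \<in> edges G" if "{v, w} \<in> edges H" "x \<in> fst v" "y \<in> fst w" for v w x y
  proof -
    have "fst w \<in> D (fst v)" using H(5)[OF that(1)] by (auto simp: N_def)
    then show ?thesis using that by (auto simp: D_def common_nbrs_def)
  qed
  show ?thesis
  proof (rule blow_up_embedding[OF H(1,3) simple_graph_complete_graph, of fst])
    show "fst v \<subseteq> verts G" "finite (fst v) \<and> card (fst v) = r" if "v \<in> verts H" for v
      using gU[OF subsetD[OF H(2) that]] by auto
  qed (use H(4) adj in blast)+
qed

theorem theorem4:
  fixes r m :: nat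
  assumes "r \<ge> 1" and "m \<ge> 1"
  shows "\<exists>N::nat. \<forall>n\<ge>N. \<forall>G :: 'a graph.
           simple_graph G \<and> card (verts G) = n \<and>
           real (card (edges G)) \<ge> real n powr (2 - 1 / real r) * (log 2 (real n)) powr (60 / real r)
           \<longrightarrow> (\<exists>H :: nat graph. is_subdivision (complete_graph m) ((log 2 (real n)) ^ 6) H \<and>
                  contains_copy G (blow_up r H))"
proof -
  \<comment> \<open>A sum rather than a maximum: its first term is positive, which gives the strict
    inequality for the second.\<close>
  define K where "K = 3000000 * real r ^ 5 + 512 * real r ^ 3 * real (1 + m + m\<^sup>2)
    + 2 * real r * (real r / 2) ^ r"
  have K: "3000000 * real r ^ 5 \<le> K" "512 * real r ^ 3 * real (1 + m + m\<^sup>2) < K"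
    "2 * real r * (real r / 2) ^ r \<le> K"
  proof -
    have "0 < 3000000 * real r ^ 5" "0 \<le> 512 * real r ^ 3 * real (1 + m + m\<^sup>2)" "0 \<le> 2 * real r * (real r / 2) ^ r"
      using assms by simp_all
    then show "3000000 * real r ^ 5 \<le> K" "512 * real r ^ 3 * real (1 + m + m\<^sup>2) < K"
      "2 * real r * (real r / 2) ^ r \<le> K"
      unfolding K_def by linarith+
  qed
  have "K \<le> log 2 (real n)" if "n \<ge> nat \<lceil>2 powr K\<rceil>" for n
  proof -
    have "2 powr K \<le> real n" using that by linarith
    then have "log 2 (2 powr K) \<le> log 2 (real n)" by (intro log_mono) auto
    then show ?thesis by simp
  qed
  then show ?thesis
    using K blow_up_of_subdivision[OF _ _ assms(1)] by (intro exI[of _ "nat \<lceil>2 powr K\<rceil>"]) fastforce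
qed

end
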